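(* There exists a universal constant $c>0$ such that the following holds. Let $G\subset\mathbb{R}^n$ be open, let $\mu$ be a Borel probability measure on $G$ satisfying a logarithmic Sobolev inequality with constant $\sigma^2>0$, let $d\in\mathbb{N}$, $d\ge1$, and let $f:G\to\mathbb{R}$ be a $\mathcal{C}^d$-smooth function such that $\int_G f\,d\mu=0$ and $\int_G\partial_{i_1\dots i_k}f\,d\mu=0$ for all $k=1,\dots,d-1$ and $1\le i_1,\dots,i_k\le n$. Assume that $$\lVert f^{(d)}\rVert_{\mathrm{HS},2}\le 1\qquad\text{and}\qquad\lVert f^{(d)}\rVert_{\mathrm{Op},\infty}\le 1.$$ Then $$\int_G\exp\Big\{\frac{c}{\sigma^2}|f|^{2/d}\Big\}\,d\mu\le 2.$$
   Context: $\mu$ satisfies a logarithmic Sobolev inequality with constant $\sigma^2$ if $\mathrm{Ent}_\mu(g^2)\le 2\sigma^2\int|\nabla g|^2\,d\mu$ for every bounded smooth function $g$ on $G$, where $\mathrm{Ent}_\mu(g^2)=\int g^2\log g^2\,d\mu-\int g^2\,d\mu\,\log\int g^2\,d\mu$. $f^{(d)}(x)$ is the hypermatrix of $d$-th order partial derivatives $\partial_{i_1\dots i_d}f(x)$, viewed as a symmetric $d$-linear form. $|f^{(d)}(x)|_{\mathrm{Op}}=\sup\{f^{(d)}(x)[v_1,\dots,v_d]:|v_1|=\dots=|v_d|=1\}$, and $|f^{(d)}(x)|_{\mathrm{HS}}$ is the Euclidean norm of $f^{(d)}(x)\in\mathbb{R}^{n^d}$. $\lVert f^{(d)}\rVert_{\mathrm{HS},2}$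 is the $L^2(\mu)$-norm of $|f^{(d)}|_{\mathrm{HS}}$ and $\lVert f^{(d)}\rVert_{\mathrm{Op},\infty}$ is the $L^\infty(\mu)$-norm of $|f^{(d)}|_{\mathrm{Op}}$. "Universal" means $c$ does not depend on $n,d,G,\mu,\sigma,f$. *)

theory Defs
  imports "HOL-Probability.Probability"
begin

text \<open>
  The dimension must be quantified inside the statement, below the universal constant, so
  \<open>\<real>\<^sup>n\<close> is the library's \<^const>\<open>Euclidean_space\<close> \<open>n\<close>: the functions \<^typ>\<open>nat \<Rightarrow> real\<close> vanishing
  outside \<open>{..<n}\<close>, with the topology inherited from the product topology. Coordinates are
  numbered from \<open>0\<close>, and the Euclidean norm of \<open>v\<close> is \<open>L2_set v {..<n}\<close>. Functions on \<open>G\<close> are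
  represented by total functions whose values outside \<open>G\<close> are irrelevant.
\<close>

definition partial_deriv :: "nat \<Rightarrow> ((nat \<Rightarrow> real) \<Rightarrow> real) \<Rightarrow> (nat \<Rightarrow> real) \<Rightarrow> real" where
  "partial_deriv i f x = deriv (\<lambda>t. f (x(i := t))) (x i)"

definition iter_partial_deriv :: "nat list \<Rightarrow> ((nat \<Rightarrow> real) \<Rightarrow> real) \<Rightarrow> (nat \<Rightarrow> real) \<Rightarrow> real" where
  "iter_partial_deriv is f = foldr partial_deriv is f"

text \<open>
  \<open>C\<^sup>k\<close>: all partial derivatives up to order \<open>k\<close> exist and are continuous on \<open>G\<close>.
\<close>

primrec Ck_on :: "nat \<Rightarrow> nat \<Rightarrow> (nat \<Rightarrow> real) set \<Rightarrow> ((nat \<Rightarrow> real) \<Rightarrow> real) \<Rightarrow> bool" where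
  "Ck_on n 0 G f \<longleftrightarrow> continuous_on G f"
| "Ck_on n (Suc k) G f \<longleftrightarrow> continuous_on G f \<and>
     (\<forall>i<n. (\<forall>x\<in>G. (\<lambda>t. f (x(i := t))) field_differentiable at (x i)) \<and>
            Ck_on n k G (partial_deriv i f))"

definition smooth_on :: "nat \<Rightarrow> (nat \<Rightarrow> real) set \<Rightarrow> ((nat \<Rightarrow> real) \<Rightarrow> real) \<Rightarrow> bool" where
  "smooth_on n G f \<longleftrightarrow> (\<forall>k. Ck_on n k G f)"

definition grad_norm :: "nat \<Rightarrow> ((nat \<Rightarrow> real) \<Rightarrow> real) \<Rightarrow> (nat \<Rightarrow> real) \<Rightarrow> real" where
  "grad_norm n f x = L2_set (\<lambda>i. partial_deriv i f x) {..<n}"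

definition multi_indices :: "nat \<Rightarrow> nat \<Rightarrow> nat list set" where
  "multi_indices n d = {is. set is \<subseteq> {..<n} \<and> length is = d}"

definition deriv_form ::
  "nat \<Rightarrow> nat \<Rightarrow> ((nat \<Rightarrow> real) \<Rightarrow> real) \<Rightarrow> (nat \<Rightarrow> real) \<Rightarrow> (nat \<Rightarrow> nat \<Rightarrow> real) \<Rightarrow> real" where
  "deriv_form n d f x v =
     (\<Sum>is\<in>multi_indices n d. iter_partial_deriv is f x * (\<Prod>j<d. v j (is ! j)))"

definition deriv_Op :: "nat \<Rightarrow> nat \<Rightarrow> ((nat \<Rightarrow> real) \<Rightarrow> real) \<Rightarrow> (nat \<Rightarrow> real) \<Rightarrow> real" where
  "deriv_Op n d f x =
     Sup {deriv_form n d f x v | v.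
            \<forall>j<d. v j \<in> topspace (Euclidean_space n) \<and> L2_set (v j) {..<n} = 1}"

definition deriv_HS :: "nat \<Rightarrow> nat \<Rightarrow> ((nat \<Rightarrow> real) \<Rightarrow> real) \<Rightarrow> (nat \<Rightarrow> real) \<Rightarrow> real" where
  "deriv_HS n d f x = L2_set (\<lambda>is. iter_partial_deriv is f x) (multi_indices n d)"

definition L2_norm :: "'a measure \<Rightarrow> ('a \<Rightarrow> real) \<Rightarrow> ereal" where
  "L2_norm M g =
     (if g \<in> borel_measurable M \<and> integrable M (\<lambda>x. (g x)\<^sup>2)
      then ereal (sqrt (LINT x|M. (g x)\<^sup>2)) else \<infinity>)"

definition Linf_norm :: "'a measure \<Rightarrow> ('a \<Rightarrow> real) \<Rightarrow> ereal" where
  "Linf_norm M g = esssup M (\<lambda>x. ereal \<bar>g x\<bar>)"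

text \<open>The convention \<open>0 log 0 = 0\<close> holds automatically.\<close>

definition Ent :: "'a measure \<Rightarrow> ('a \<Rightarrow> real) \<Rightarrow> real" where
  "Ent M h = (LINT x|M. h x * ln (h x)) - (LINT x|M. h x) * ln (LINT x|M. h x)"

text \<open>
  For bounded \<open>g\<close> and a probability measure, \<open>Ent M (g\<^sup>2)\<close> is a nonnegative real, so the coercion
  to \<^typ>\<open>ennreal\<close> truncates nothing; the energy on the right may be infinite, and the
  inequality is then void.
\<close>

definition log_Sobolev :: "nat \<Rightarrow> (nat \<Rightarrow> real) set \<Rightarrow> (nat \<Rightarrow> real) measure \<Rightarrow> real \<Rightarrow> bool" where
  "log_Sobolev n G M s \<longleftrightarrow>
     (\<forall>g. smooth_on n G g \<and> bounded (g ` G) \<longrightarrow>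
        ennreal (Ent M (\<lambda>x. (g x)\<^sup>2))
          \<le> ennreal (2 * s) * (\<integral>\<^sup>+ x. ennreal ((grad_norm n g x)\<^sup>2) \<partial>M))"

end

theory Submission
  imports Defs "HOL-Real_Asymp.Real_Asymp"
begin

text \<open>
  The tangent line inequality for \<open>ln\<close> turns the logarithmic Sobolev inequality into
  \<open>F ln (F / a\<^sup>2) \<le> 2 \<sigma>\<^sup>2 \<integral> |\<nabla>h|\<^sup>2\<close>, where \<open>F = \<integral> h\<^sup>2\<close> and \<open>a \<ge> \<integral> |h|\<close>; in this form it
  extends from smooth to \<open>C\<^sup>1\<close> functions by a global approximation on \<open>G\<close>. With \<open>h = 1 + \<epsilon> g\<close> it
  yields a Poincare inequality, and with \<open>h = g\<^sup>q\<close> it yields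
  \<open>\<parallel>g\<parallel>\<^sub>2\<^sub>q\<^sup>2 \<le> \<parallel>g\<parallel>\<^sub>q\<^sup>2 + 2 \<sigma>\<^sup>2 q \<parallel>\<nabla>g\<parallel>\<^sub>2\<^sub>q\<^sup>2\<close>. Applied to \<open>g = |f\<^sup>(\<^sup>k\<^sup>)|\<^sub>O\<^sub>p\<close>, whose gradient is bounded by
  \<open>|f\<^sup>(\<^sup>k\<^sup>+\<^sup>1\<^sup>)|\<^sub>O\<^sub>p\<close>, the doubling step gives by induction
  \<open>\<parallel>|f\<^sup>(\<^sup>k\<^sup>)|\<^sub>O\<^sub>p\<parallel>\<^sub>p\<^sup>2 \<le> (2 p \<sigma>\<^sup>2)\<^sup>d\<^sup>-\<^sup>k\<close> for all \<open>p = 2, 4, 8, \<dots>\<close>; the case \<open>p = 2\<close> follows from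
  the Poincare inequality and the bound on the Hilbert-Schmidt norm. For \<open>k = 0\<close> these moments
  control the exponential series.
\<close>

section \<open>Functions with continuous partial derivatives\<close>

text \<open>Two gaps have to be bridged. The inequality is assumed only for bounded smooth functions
  on G, whereas f is merely C^d: its derivatives of order d - 1 are no better than C^1, and nothing
  controls f near the boundary of G. The form with F and a contains no integral of h^2 ln h^2 and is
  continuous in F and a, so it survives approximation that is uniform on all of G, first derivatives
  included. Moreover, the operator norm is a supremum over uncountably many forms and need not be
  differentiable. It is replaced by a supremum over a countable dense set of unit vectors, which is
  approximated by C^1 soft maxima and truncated, so that every moment in the doubling step is
  finite; Fatou's lemma removes the approximation. Doubling the exponent stands in for
  differentiating the norm in p: all powers are integers, and the price is a constant factor. The
  centring of f and its derivatives is used only to start the doubling at p = 2.\<close>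

definition C1_on :: "nat \<Rightarrow> (nat \<Rightarrow> real) set \<Rightarrow> ((nat \<Rightarrow> real) \<Rightarrow> real) \<Rightarrow>
    (nat \<Rightarrow> (nat \<Rightarrow> real) \<Rightarrow> real) \<Rightarrow> bool" where
  "C1_on n U f D \<longleftrightarrow> continuous_on U f \<and>
     (\<forall>i<n. continuous_on U (D i) \<and>
        (\<forall>x\<in>U. ((\<lambda>t. f (x(i := t))) has_real_derivative D i x) (at (x i))))"

lemma C1_onD:
  assumes "C1_on n U f D"
  shows "continuous_on U f" "i < n \<Longrightarrow> continuous_on U (D i)"
    "i < n \<Longrightarrow> x \<in> U \<Longrightarrow> ((\<lambda>t. f (x(i := t))) has_real_derivative D i x) (at (x i))"
  using assms by (auto simp: C1_on_def)

lemma C1_on_partial_deriv: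
  assumes "C1_on n U f D" "i < n" "x \<in> U"
  shows "partial_deriv i f x = D i x"
  using C1_onD(3)[OF assms] unfolding partial_deriv_def by (rule DERIV_imp_deriv)

lemma C1_on_subset: "C1_on n U f D \<Longrightarrow> V \<subseteq> U \<Longrightarrow> C1_on n V f D"
  unfolding C1_on_def by (meson continuous_on_subset subsetD)

lemma C1_on_D_cong:
  assumes "C1_on n U f D" "\<And>i x. i < n \<Longrightarrow> x \<in> U \<Longrightarrow> D i x = D' i x"
  shows "C1_on n U f D'"
  using assms unfolding C1_on_def by (metis (no_types, lifting) continuous_on_cong)

text \<open>\<open>C1_on\<close> carries the partial derivatives as an explicit family, determined
  only on U and for indices below n. The calculus rules can then compute derivatives; this
  equivalence translates back to \<open>partial_deriv\<close>.\<close>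

lemma Ck_on_Suc_iff:
  "Ck_on n (Suc k) U f \<longleftrightarrow> C1_on n U f (\<lambda>i. partial_deriv i f) \<and> (\<forall>i<n. Ck_on n k U (partial_deriv i f))"
proof -
  have cont: "continuous_on U (partial_deriv i f)" if "Ck_on n k U (partial_deriv i f)" for i
    using that by (cases k) auto
  show ?thesis
    unfolding C1_on_def Ck_on.simps(2) partial_deriv_def[abs_def]
    using cont[unfolded partial_deriv_def[abs_def]]
    by (auto simp: DERIV_deriv_iff_field_differentiable)
qed

lemma Ck_on_1_iff: "Ck_on n 1 U f \<longleftrightarrow> C1_on n U f (\<lambda>i. partial_deriv i f)"
  unfolding One_nat_def Ck_on_Suc_iff by (auto simp: C1_on_def)

lemma Ck_on_continuous: "Ck_on n k U f \<Longrightarrow> continuous_on U f"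
  by (cases k) auto

lemma Ck_on_mono: "Ck_on n k U f \<Longrightarrow> V \<subseteq> U \<Longrightarrow> Ck_on n k V f"
proof (induction k arbitrary: f)
  case 0 then show ?case by (auto intro: continuous_on_subset)
next
  case (Suc k) then show ?case unfolding Ck_on_Suc_iff using C1_on_subset by blast
qed

text \<open>The type carries the product topology, so relatively open sets are traces of open sets
  of the type, and its filters and continuity notions remain usable. A nonempty set that is open in
  \<open>Euclidean_space n\<close> is never open in the type.\<close>

lemma openin_Euclidean_space_iff:
  "openin (Euclidean_space n) U \<longleftrightarrow> (\<exists>V. open V \<and> U = V \<inter> topspace (Euclidean_space n))"
  unfolding topspace_Euclidean_space
  unfolding Euclidean_space_def openin_subtopology euclidean_product_topology
  by simp

lemma continuous_on_upd [continuous_intros]: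
  fixes f :: "'a::topological_space \<Rightarrow> 'b \<Rightarrow> 'c::topological_space"
  assumes "continuous_on S f" "continuous_on S g"
  shows "continuous_on S (\<lambda>y. (f y)(i := g y))"
proof (rule continuous_on_coordinatewise_then_product)
  show "continuous_on S (\<lambda>y. ((f y)(i := g y)) j)" for j
    by (cases "j = i") (simp_all add: assms continuous_on_product_then_coordinatewise[OF assms(1)])
qed

lemma upd_in_Euclidean_space:
  "x \<in> topspace (Euclidean_space n) \<Longrightarrow> i < n \<Longrightarrow> x(i := t) \<in> topspace (Euclidean_space n)"
  by (auto simp: topspace_Euclidean_space)

text \<open>Small moves along an axis below n stay in U. Hence partial derivatives at points of U
  see only the values on U, and values outside G are harmless.\<close>

lemma eventually_upd_in:
  assumes "openin (Euclidean_space n) U" "x \<in> U" "i < n"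
  shows "\<forall>\<^sub>F t in nhds (x i). x(i := t) \<in> U"
proof -
  obtain V where V: "open V" "U = V \<inter> topspace (Euclidean_space n)"
    using assms(1) openin_Euclidean_space_iff by auto
  have "open ((\<lambda>t. x(i := t)) -` V)"
    by (rule open_vimage[OF V(1)]) (intro continuous_intros)
  then show ?thesis
    using V(2) assms(2,3) upd_in_Euclidean_space[of x n i]
    by (auto simp: eventually_nhds intro!: exI[of _ "(\<lambda>t. x(i := t)) -` V"])
qed

lemma partial_deriv_cong:
  assumes "openin (Euclidean_space n) U" "\<And>x. x \<in> U \<Longrightarrow> f x = g x" "x \<in> U" "i < n"
  shows "partial_deriv i f x = partial_deriv i g x"
  unfolding partial_deriv_def
  by (rule deriv_cong_ev) (use eventually_upd_in[OF assms(1,3,4)] assms(2) in \<open>auto elim: eventually_mono\<close>)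

lemma C1_on_cong:
  assumes "openin (Euclidean_space n) U" "\<And>x. x \<in> U \<Longrightarrow> f x = g x" "C1_on n U f D"
  shows "C1_on n U g D"
  unfolding C1_on_def
proof (intro conjI allI impI ballI)
  show "continuous_on U g"
    using C1_onD(1)[OF assms(3)] assms(2) by (metis continuous_on_cong)
  fix i assume i: "i < n"
  show "continuous_on U (D i)" using C1_onD(2)[OF assms(3) i] .
  fix x assume x: "x \<in> U"
  show "((\<lambda>t. g (x(i := t))) has_real_derivative D i x) (at (x i))"
  proof -
    have ev: "\<forall>\<^sub>F t in nhds (x i). g (x(i := t)) = f (x(i := t))"
      using eventually_upd_in[OF assms(1) x i] by eventually_elim (use assms(2) in auto)
    show ?thesis using C1_onD(3)[OF assms(3) i x] DERIV_cong_ev[OF refl ev refl] by blast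
  qed
qed

lemma Ck_on_cong:
  assumes "openin (Euclidean_space n) U" "\<And>x. x \<in> U \<Longrightarrow> f x = g x" "Ck_on n k U f"
  shows "Ck_on n k U g"
  using assms(2,3)
proof (induction k arbitrary: f g)
  case 0
  then show ?case by (metis Ck_on.simps(1) continuous_on_cong)
next
  case (Suc k)
  have pd: "partial_deriv i f x = partial_deriv i g x" if "i < n" "x \<in> U" for i x
    by (rule partial_deriv_cong[OF assms(1)]) (use that Suc.prems in auto)
  have "C1_on n U g (\<lambda>i. partial_deriv i f)"
    using C1_on_cong[OF assms(1), of f g, OF Suc.prems(1)] Suc.prems(2) unfolding Ck_on_Suc_iff by blast
  then have "C1_on n U g (\<lambda>i. partial_deriv i g)"
    by (rule C1_on_D_cong) (use pd in auto)
  moreover have "Ck_on n k U (partial_deriv i g)" if "i < n" for i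
    by (rule Suc.IH[of "partial_deriv i f"]) (use pd that Suc.prems(2)[unfolded Ck_on_Suc_iff] in auto)
  ultimately show ?case unfolding Ck_on_Suc_iff by blast
qed

text \<open>As U is not open in the type, an open V with trace U is used: near x the points of A lie
  in V, hence in U, so the two restrictions have the same limits at x.\<close>

lemma continuous_on_local:
  assumes "A \<subseteq> topspace (Euclidean_space n)"
    "\<And>x. x \<in> A \<Longrightarrow> \<exists>U. openin (Euclidean_space n) U \<and> x \<in> U \<and> continuous_on U f"
  shows "continuous_on A f"
  unfolding continuous_on_eq_continuous_within
proof
  fix x assume x: "x \<in> A"
  obtain U where U: "openin (Euclidean_space n) U" "x \<in> U" "continuous_on U f"
    using assms(2)[OF x] by blast
  obtain V where V: "open V" "U = V \<inter> topspace (Euclidean_space n)"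
    using U(1) openin_Euclidean_space_iff by auto
  have "continuous (at x within A \<inter> V) f"
    using U(2,3) assms(1) V(2) by (auto simp: continuous_on_eq_continuous_within intro: continuous_within_subset)
  moreover have "at x within A \<inter> V = at x within A"
    by (rule at_within_nhd[of _ V]) (use V U in auto)
  ultimately show "continuous (at x within A) f" by simp
qed

lemma C1_on_local:
  assumes "A \<subseteq> topspace (Euclidean_space n)"
    "\<And>x. x \<in> A \<Longrightarrow> \<exists>U. openin (Euclidean_space n) U \<and> x \<in> U \<and> C1_on n U f D"
  shows "C1_on n A f D"
  unfolding C1_on_def
proof (intro conjI allI impI ballI)
  show "continuous_on A f"
    by (rule continuous_on_local[OF assms(1)]) (use assms(2)[unfolded C1_on_def] in blast)
  show "continuous_on A (D i)" if "i < n" for i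
    by (rule continuous_on_local[OF assms(1)]) (use assms(2)[unfolded C1_on_def] that in blast)
  show "((\<lambda>t. f (x(i := t))) has_real_derivative D i x) (at (x i))" if "i < n" "x \<in> A" for i x
    using assms(2)[unfolded C1_on_def] that by blast
qed

lemma Ck_on_local:
  assumes "A \<subseteq> topspace (Euclidean_space n)"
    "\<And>x. x \<in> A \<Longrightarrow> \<exists>U. openin (Euclidean_space n) U \<and> x \<in> U \<and> Ck_on n k U f"
  shows "Ck_on n k A f"
  using assms(2)
proof (induction k arbitrary: f)
  case 0
  then have "continuous_on A f" by (intro continuous_on_local[OF assms(1)]) simp
  then show ?case by simp
next
  case (Suc k)
  have "C1_on n A f (\<lambda>i. partial_deriv i f)"
    by (rule C1_on_local[OF assms(1)]) (use Suc.prems[unfolded Ck_on_Suc_iff] in blast)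
  moreover have "Ck_on n k A (partial_deriv i f)" if "i < n" for i
    by (rule Suc.IH) (use that Suc.prems[unfolded Ck_on_Suc_iff] in blast)
  ultimately show ?case unfolding Ck_on_Suc_iff by blast
qed

section \<open>Sums, products and compositions of differentiable functions\<close>

lemma C1_on_const: "C1_on n U (\<lambda>x. c) (\<lambda>i x. 0)"
  by (auto simp: C1_on_def)

lemma C1_on_add:
  "C1_on n U f D \<Longrightarrow> C1_on n U g D' \<Longrightarrow> C1_on n U (\<lambda>x. f x + g x) (\<lambda>i x. D i x + D' i x)"
  by (auto simp: C1_on_def intro!: continuous_intros derivative_eq_intros)

lemma C1_on_mult:
  "C1_on n U f D \<Longrightarrow> C1_on n U g D' \<Longrightarrow>
    C1_on n U (\<lambda>x. f x * g x) (\<lambda>i x. D i x * g x + f x * D' i x)"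
  by (auto simp: C1_on_def intro!: continuous_intros derivative_eq_intros)

lemma C1_on_cmult: "C1_on n U f D \<Longrightarrow> C1_on n U (\<lambda>x. c * f x) (\<lambda>i x. c * D i x)"
  by (auto simp: C1_on_def intro!: continuous_intros derivative_eq_intros)

lemma C1_on_sum:
  assumes "\<And>a. a \<in> S \<Longrightarrow> C1_on n U (f a) (D a)"
  shows "C1_on n U (\<lambda>x. \<Sum>a\<in>S. f a x) (\<lambda>i x. \<Sum>a\<in>S. D a i x)"
  using assms
  by (auto simp: C1_on_def intro!: continuous_intros DERIV_sum)

lemma C1_on_prod:
  assumes "\<And>a. a \<in> S \<Longrightarrow> \<exists>D. C1_on n U (f a) D"
  shows "\<exists>D. C1_on n U (\<lambda>x. \<Prod>a\<in>S. f a x) D"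
proof (cases "finite S")
  case True
  then show ?thesis using assms
  proof (induction S)
    case empty then show ?case using C1_on_const by auto
  next
    case (insert a S)
    then obtain D D' where "C1_on n U (f a) D" "C1_on n U (\<lambda>x. \<Prod>a\<in>S. f a x) D'" by blast
    from C1_on_mult[OF this] insert.hyps show ?case by auto
  qed
qed (use C1_on_const in auto)

lemma C1_on_compose:
  assumes "C1_on n U f D" "\<And>t. (\<psi> has_real_derivative \<psi>' t) (at t)" "continuous_on UNIV \<psi>'"
  shows "C1_on n U (\<lambda>x. \<psi> (f x)) (\<lambda>i x. \<psi>' (f x) * D i x)"
  unfolding C1_on_def
proof (intro conjI allI impI ballI)
  have "continuous_on UNIV \<psi>" using assms(2) by (meson DERIV_isCont continuous_at_imp_continuous_on)
  then show "continuous_on U (\<lambda>x. \<psi> (f x))"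
    by (rule continuous_on_compose2[OF _ C1_onD(1)[OF assms(1)]]) auto
  show "continuous_on U (\<lambda>x. \<psi>' (f x) * D i x)" if "i < n" for i
    by (intro continuous_intros C1_onD[OF assms(1)] that continuous_on_compose2[OF assms(3)]) auto
  show "((\<lambda>t. \<psi> (f (x(i := t)))) has_real_derivative \<psi>' (f x) * D i x) (at (x i))" if "i < n" "x \<in> U" for i x
    by (rule DERIV_chain2[of \<psi>]) (use C1_onD(3)[OF assms(1) that] assms(2) in auto)
qed

lemma Ck_on_sum:
  assumes "openin (Euclidean_space n) U" "finite S" "\<And>a. a \<in> S \<Longrightarrow> Ck_on n k U (f a)"
  shows "Ck_on n k U (\<lambda>x. \<Sum>a\<in>S. f a x)"
  using assms(3)
proof (induction k arbitrary: f)
  case 0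
  then show ?case by (auto intro!: continuous_intros)
next
  case (Suc k)
  have C1: "C1_on n U (\<lambda>x. \<Sum>a\<in>S. f a x) (\<lambda>i x. \<Sum>a\<in>S. partial_deriv i (f a) x)"
    by (rule C1_on_sum) (use Suc.prems Ck_on_Suc_iff in blast)
  note pd = C1_on_partial_deriv[OF C1]
  have "Ck_on n k U (partial_deriv i (\<lambda>x. \<Sum>a\<in>S. f a x))" if "i < n" for i
    by (rule Ck_on_cong[OF assms(1) _ Suc.IH, of "\<lambda>a. partial_deriv i (f a)"])
      (use pd that Suc.prems Ck_on_Suc_iff in auto)
  moreover have "C1_on n U (\<lambda>x. \<Sum>a\<in>S. f a x) (\<lambda>i. partial_deriv i (\<lambda>x. \<Sum>a\<in>S. f a x))"
    by (rule C1_on_D_cong[OF C1]) (use pd in auto)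
  ultimately show ?case unfolding Ck_on_Suc_iff by blast
qed

lemma Ck_on_cmult:
  assumes "openin (Euclidean_space n) U" "Ck_on n k U f"
  shows "Ck_on n k U (\<lambda>x. c * f x)"
  using assms(2)
proof (induction k arbitrary: f)
  case 0
  then show ?case by (auto intro!: continuous_intros)
next
  case (Suc k)
  have C1: "C1_on n U (\<lambda>x. c * f x) (\<lambda>i x. c * partial_deriv i f x)"
    by (rule C1_on_cmult) (use Suc.prems Ck_on_Suc_iff in blast)
  note pd = C1_on_partial_deriv[OF C1]
  have "Ck_on n k U (partial_deriv i (\<lambda>x. c * f x))" if "i < n" for i
    by (rule Ck_on_cong[OF assms(1) _ Suc.IH, of "partial_deriv i f"])
      (use pd that Suc.prems Ck_on_Suc_iff in auto)
  moreover have "C1_on n U (\<lambda>x. c * f x) (\<lambda>i. partial_deriv i (\<lambda>x. c * f x))"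
    by (rule C1_on_D_cong[OF C1]) (use pd in auto)
  ultimately show ?case unfolding Ck_on_Suc_iff by blast
qed

section \<open>Mollification in one coordinate at a time\<close>

definition flat :: "real poly \<Rightarrow> real \<Rightarrow> real" where
  "flat p t = (if t > 0 then poly p (1 / t) * exp (- (1 / t)) else 0)"

lemma poly_exp_tendsto_0: "((\<lambda>x. poly p x * exp (- x)) \<longlongrightarrow> 0) at_top" for p :: "real poly"
proof -
  have "((\<lambda>x. \<Sum>i\<le>degree p. coeff p i * (x ^ i / exp x)) \<longlongrightarrow> (\<Sum>i\<le>degree p. coeff p i * 0)) at_top"
    by (intro tendsto_sum tendsto_mult tendsto_const tendsto_power_div_exp_0)
  moreover have "(\<Sum>i\<le>degree p. coeff p i * (x ^ i / exp x)) = poly p x * exp (- x)" for x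
    by (simp add: poly_altdef exp_minus divide_inverse sum_distrib_right mult.assoc)
  ultimately show ?thesis by simp
qed

text \<open>The family p(1/t) exp(-1/t), extended by 0, is closed under differentiation: both inner
  derivatives contribute 1/t^2, which gives the polynomial X^2 (p - p'). One first-order computation
  thus yields all orders.\<close>

lemma flat_has_derivative:
  "(flat p has_real_derivative flat (monom 1 2 * (p - pderiv p)) t) (at t)"
proof -
  consider "t < 0" | "t > 0" | "t = 0" by linarith
  then show ?thesis
  proof cases
    case 1
    have "\<forall>\<^sub>F x in nhds t. flat p x = 0"
      using eventually_nhds_in_open[of "{..<0}" t] 1 by (auto elim!: eventually_mono simp: flat_def)
    then show ?thesis
      using 1 DERIV_cong_ev[OF refl _ refl, of "flat p" "\<lambda>_. 0"] by (simp add: flat_def)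
  next
    case 2
    have ev: "\<forall>\<^sub>F x in nhds t. flat p x = poly p (1 / x) * exp (- (1 / x))"
      using eventually_nhds_in_open[of "{0<..}" t] 2 by (auto elim!: eventually_mono simp: flat_def)
    have "((\<lambda>x. poly p (1 / x) * exp (- (1 / x))) has_real_derivative
        flat (monom 1 2 * (p - pderiv p)) t) (at t)"
      using 2 by (auto simp: flat_def poly_monom field_simps power2_eq_square
          intro!: derivative_eq_intros DERIV_chain2[OF poly_DERIV])
    then show ?thesis using DERIV_cong_ev[OF refl ev refl] by simp
  next
    case 3
    \<comment> \<open>Dividing by h > 0 multiplies the polynomial by X, so the right difference
      quotient at 0 is again of this form and tends to 0 as 1/h goes to infinity.\<close>
    have "((\<lambda>x. poly (monom 1 1 * p) (1 / x) * exp (- (1 / x))) \<longlongrightarrow> 0) (at_right (0::real))"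
      by (rule filterlim_compose[OF poly_exp_tendsto_0])
        (simp add: divide_inverse filterlim_inverse_at_top_right)
    then have "((\<lambda>h. flat p h / h) \<longlongrightarrow> 0) (at_right 0)"
      by (rule Lim_transform_eventually)
        (auto simp: eventually_at_filter flat_def poly_monom)
    moreover have "((\<lambda>h. flat p h / h) \<longlongrightarrow> 0) (at_left (0::real))"
      by (rule Lim_transform_eventually[of "\<lambda>_. 0"]) (auto simp: eventually_at_filter flat_def)
    ultimately have "((\<lambda>h. flat p h / h) \<longlongrightarrow> 0) (at 0)"
      by (simp add: filterlim_split_at)
    then show ?thesis using 3 by (simp add: DERIV_def flat_def)
  qed
qed

text \<open>Generated by products of two flat functions, one vanishing left of -1 and one right of
  1. The class is large enough to contain derivatives of its members, and all of them vanish off the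
  open interval (-1, 1).\<close>

inductive bump_like :: "(real \<Rightarrow> real) \<Rightarrow> bool" where
  prod: "bump_like (\<lambda>t. flat p (1 + t) * flat q (1 - t))"
| diff: "bump_like f \<Longrightarrow> bump_like g \<Longrightarrow> bump_like (\<lambda>t. f t - g t)"
| cmult: "bump_like f \<Longrightarrow> bump_like (\<lambda>t. c * f t)"

lemma bump_like_vanishes: "bump_like f \<Longrightarrow> \<bar>t\<bar> \<ge> 1 \<Longrightarrow> f t = 0"
  by (induction rule: bump_like.induct) (auto simp: flat_def)

lemma bump_like_deriv: "bump_like f \<Longrightarrow> \<exists>g. bump_like g \<and> (\<forall>t. (f has_real_derivative g t) (at t))"
proof (induction rule: bump_like.induct)
  case (prod p q)
  let ?d = "\<lambda>p. monom 1 2 * (p - pderiv p)"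
  have 1: "((\<lambda>t. flat p (1 + t)) has_real_derivative flat (?d p) (1 + t)) (at t)" for t
    by (rule DERIV_cong[OF DERIV_chain2[OF flat_has_derivative]]) (auto intro!: derivative_eq_intros)
  have 2: "((\<lambda>t. flat q (1 - t)) has_real_derivative - flat (?d q) (1 - t)) (at t)" for t
    by (rule DERIV_cong[OF DERIV_chain2[OF flat_has_derivative]]) (auto intro!: derivative_eq_intros)
  have "bump_like (\<lambda>t. flat (?d p) (1 + t) * flat q (1 - t) - flat p (1 + t) * flat (?d q) (1 - t))"
    by (intro bump_like.intros)
  moreover have "((\<lambda>t. flat p (1 + t) * flat q (1 - t)) has_real_derivative
      flat (?d p) (1 + t) * flat q (1 - t) - flat p (1 + t) * flat (?d q) (1 - t)) (at t)" for t
    by (rule DERIV_cong[OF DERIV_mult[OF 1 2]]) simp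
  ultimately show ?case by blast
next
  case (diff f g)
  then obtain f' g' where "bump_like f'" "bump_like g'"
    "\<And>t. (f has_real_derivative f' t) (at t)" "\<And>t. (g has_real_derivative g' t) (at t)" by blast
  then show ?case by (intro exI[of _ "\<lambda>t. f' t - g' t"]) (auto intro: bump_like.diff DERIV_diff)
next
  case (cmult f c)
  then obtain f' where "bump_like f'" "\<And>t. (f has_real_derivative f' t) (at t)" by blast
  then show ?case by (intro exI[of _ "\<lambda>t. c * f' t"]) (auto intro: bump_like.cmult DERIV_cmult)
qed

text \<open>The kernel comes with all its derivatives as one sequence, so that smoothness in one
  variable never has to be mentioned again.\<close>

lemma smooth_bump_exists:
  obtains \<phi> :: "nat \<Rightarrow> real \<Rightarrow> real" where
    "\<And>k t. (\<phi> k has_real_derivative \<phi> (Suc k) t) (at t)"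
    "\<And>k t. \<bar>t\<bar> \<ge> 1 \<Longrightarrow> \<phi> k t = 0"
    "\<And>t. \<phi> 0 t \<ge> 0" "integral {-1..1} (\<phi> 0) = 1"
proof -
  define b where "b = (\<lambda>t. flat 1 (1 + t) * flat 1 (1 - t))"
  have b: "bump_like b" unfolding b_def by (rule bump_like.prod)
  have b0: "b t \<ge> 0" for t by (simp add: b_def flat_def)
  have cont: "continuous_on {-1..1} b"
    using bump_like_deriv[OF b] by (meson DERIV_isCont continuous_at_imp_continuous_on)
  define I where "I = integral {-1..1} b"
  \<comment> \<open>A nonnegative continuous function with zero integral vanishes, but
    \<open>b 0\<close> is exp(-1)^2.\<close>
  have "I > 0"
  proof (rule ccontr)
    assume "\<not> I > 0"
    moreover have "I \<ge> 0" unfolding I_def by (rule integral_nonneg) (auto intro: integrable_continuous_real cont b0)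
    ultimately have "(b has_integral 0) (cbox (-1) 1)"
      using integrable_integral[OF integrable_continuous_real[OF cont]] by (auto simp: I_def cbox_interval)
    then have "b 0 = 0"
      by (rule has_integral_0_cbox_imp_0[rotated 2]) (use cont b0 in \<open>auto simp: cbox_interval box_real\<close>)
    then show False by (simp add: b_def flat_def)
  qed
  \<comment> \<open>Each further derivative is selected by choice; the induction below shows that
    the selection never leaves \<open>bump_like\<close>.\<close>
  define \<phi> where "\<phi> = rec_nat (\<lambda>t. 1 / I * b t) (\<lambda>_ f. SOME g. bump_like g \<and> (\<forall>t. (f has_real_derivative g t) (at t)))"
  have \<phi>: "bump_like (\<phi> k)" for k
  proof (induction k)
    case 0 show ?case unfolding \<phi>_def using bump_like.cmult[OF b, of "1 / I"] by simp
  next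
    case (Suc k) show ?case using someI_ex[OF bump_like_deriv[OF Suc]] by (simp add: \<phi>_def)
  qed
  show ?thesis
  proof
    show "(\<phi> k has_real_derivative \<phi> (Suc k) t) (at t)" for k t
      using someI_ex[OF bump_like_deriv[OF \<phi>[of k]]] by (simp add: \<phi>_def)
    show "\<phi> k t = 0" if "\<bar>t\<bar> \<ge> 1" for k t using bump_like_vanishes[OF \<phi> that] .
    show "\<phi> 0 t \<ge> 0" for t using b0 \<open>I > 0\<close> by (simp add: \<phi>_def)
    show "integral {-1..1} (\<phi> 0) = 1" using \<open>I > 0\<close> by (simp add: \<phi>_def I_def)
  qed
qed

text \<open>Averaging acts on a single coordinate, so mollification in the variable dimension n uses
  only integrals over [-1, 1]. The argument is shifted forward by e t, hence the minus sign in the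
  integration by parts.\<close>

definition avg :: "real \<Rightarrow> nat \<Rightarrow> (real \<Rightarrow> real) \<Rightarrow> ((nat \<Rightarrow> real) \<Rightarrow> real) \<Rightarrow> (nat \<Rightarrow> real) \<Rightarrow> real" where
  "avg e i \<psi> u x = integral {-1..1} (\<lambda>t. \<psi> t * u (x(i := x i + e * t)))"

lemma continuous_on_shift:
  assumes "continuous_on (topspace (Euclidean_space n)) u" "i < n" "continuous_on S X" "continuous_on S \<tau>"
    "\<And>s. s \<in> S \<Longrightarrow> X s \<in> topspace (Euclidean_space n)"
  shows "continuous_on S (\<lambda>s. u ((X s)(i := X s i + e * \<tau> s)))"
proof (rule continuous_on_compose2[OF assms(1)])
  show "continuous_on S (\<lambda>s. (X s)(i := X s i + e * \<tau> s))"
    by (intro continuous_intros assms continuous_on_product_then_coordinatewise[OF assms(3)])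
  show "(\<lambda>s. (X s)(i := X s i + e * \<tau> s)) ` S \<subseteq> topspace (Euclidean_space n)"
    using upd_in_Euclidean_space[OF assms(5) assms(2)] by blast
qed

lemma avg_integrable:
  fixes u :: "(nat \<Rightarrow> real) \<Rightarrow> real"
  assumes "continuous_on (topspace (Euclidean_space n)) u" "i < n" "continuous_on {-1..1} \<psi>"
    "x \<in> topspace (Euclidean_space n)"
  shows "(\<lambda>t. \<psi> t * u (x(i := x i + e * t))) integrable_on {-1..1}"
proof (intro integrable_continuous_real continuous_on_mult assms(3))
  show "continuous_on {-1..1} (\<lambda>t. u (x(i := x i + e * t)))"
    by (rule continuous_on_shift[OF assms(1,2) continuous_on_const continuous_on_id assms(4)])
qed

lemma avg_continuous:
  assumes "continuous_on (topspace (Euclidean_space n)) u" "i < n" "continuous_on {-1..1} \<psi>"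
  shows "continuous_on (topspace (Euclidean_space n)) (avg e i \<psi> u)"
proof -
  have "continuous_on (topspace (Euclidean_space n) \<times> cbox (-1) 1) (\<lambda>z. \<psi> (snd z) * u ((fst z)(i := fst z i + e * snd z)))"
    by (intro continuous_intros continuous_on_shift[OF assms(1,2)] continuous_on_compose2[OF assms(3)])
      (auto simp: cbox_interval)
  then have "continuous_on (topspace (Euclidean_space n)) (\<lambda>x. integral (cbox (-1) 1) (\<lambda>t. \<psi> t * u (x(i := x i + e * t))))"
    by (intro integral_continuous_on_param) (simp add: case_prod_unfold)
  then show ?thesis by (simp add: avg_def[abs_def] cbox_interval)
qed

lemma C1_on_deriv_line:
  assumes "C1_on n U f D" "i < n" "x(i := t) \<in> U"
  shows "((\<lambda>t. f (x(i := t))) has_real_derivative D i (x(i := t))) (at t)"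
  using C1_onD(3)[OF assms] by simp

lemma avg_C1:
  assumes u: "C1_on n (topspace (Euclidean_space n)) u D" and i: "i < n" and \<psi>: "continuous_on {-1..1} \<psi>"
  shows "C1_on n (topspace (Euclidean_space n)) (avg e i \<psi> u) (\<lambda>j. avg e i \<psi> (D j))"
  unfolding C1_on_def
proof (intro conjI allI impI ballI)
  show "continuous_on (topspace (Euclidean_space n)) (avg e i \<psi> u)"
    by (intro avg_continuous C1_onD[OF u] i \<psi>)
  fix j assume j: "j < n"
  show "continuous_on (topspace (Euclidean_space n)) (avg e i \<psi> (D j))"
    by (intro avg_continuous C1_onD[OF u] i j \<psi>)
  fix x assume x: "x \<in> topspace (Euclidean_space n)"
  \<comment> \<open>Coordinate j is set to s before coordinate i is shifted; for j = i the shift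
    starts from s, which is why the cases are separated below.\<close>
  define P where "P s t = (x(j := s))(i := (x(j := s)) i + e * t)" for s t
  have P: "P s t \<in> topspace (Euclidean_space n)" for s t
    unfolding P_def by (intro upd_in_Euclidean_space x i j)
  have der: "((\<lambda>s. u (P s t)) has_real_derivative D j (P s t)) (at s)" for s t
  proof (cases "j = i")
    case True
    have "P s t = x(i := s + e * t)" for s t using True by (simp add: P_def)
    moreover have "((\<lambda>s. u (x(i := s + e * t))) has_real_derivative D i (x(i := s + e * t)) * 1) (at s)"
      by (rule DERIV_chain2[OF C1_on_deriv_line[OF u i]])
        (auto intro!: derivative_eq_intros upd_in_Euclidean_space x i)
    ultimately show ?thesis using True by simp
  next
    case False
    have eq: "P s t = (x(i := x i + e * t))(j := s)" for s t using False by (auto simp: P_def)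
    show ?thesis unfolding eq
      by (rule C1_on_deriv_line[OF u j]) (intro upd_in_Euclidean_space x i j)
  qed
  have cont: "continuous_on S (\<lambda>z. g (P (a z) (b z)))"
    if "continuous_on (topspace (Euclidean_space n)) g" "continuous_on S a" "continuous_on S b"
    for g :: "_ \<Rightarrow> real" and S :: "'c::topological_space set" and a b
    unfolding P_def
    by (intro continuous_on_shift[OF that(1) i] continuous_intros that upd_in_Euclidean_space x j)
  have "((\<lambda>s. integral (cbox (-1) 1) (\<lambda>t. \<psi> t * u (P s t))) has_real_derivative
      integral (cbox (-1) 1) (\<lambda>t. \<psi> t * D j (P (x j) t))) (at (x j) within UNIV)"
  proof (rule leibniz_rule_field_derivative)
    show "((\<lambda>s. \<psi> t * u (P s t)) has_real_derivative \<psi> t * D j (P s t)) (at s)" for s t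
      using der DERIV_cmult by blast
    show "(\<lambda>t. \<psi> t * u (P s t)) integrable_on cbox (-1) 1" for s
      by (rule integrable_continuous)
        (use \<psi> in \<open>auto simp: cbox_interval intro!: continuous_intros cont C1_onD[OF u]\<close>)
    show "continuous_on (UNIV \<times> cbox (-1) 1) (\<lambda>(s, t). \<psi> t * D j (P s t))"
      unfolding case_prod_unfold
      by (intro continuous_intros cont C1_onD[OF u] j continuous_on_compose2[OF \<psi>])
        (auto simp: cbox_interval)
  qed auto
  then show "((\<lambda>s. avg e i \<psi> u (x(j := s))) has_real_derivative avg e i \<psi> (D j) x) (at (x j))"
    by (simp add: avg_def P_def cbox_interval)
qed

text \<open>In t the chain rule produces e times the i-th partial derivative, and the kernel
  vanishes at both endpoints, so no boundary terms remain.\<close>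

lemma avg_by_parts:
  assumes u: "C1_on n (topspace (Euclidean_space n)) u D" and i: "i < n"
    and \<psi>: "\<And>t. (\<psi> has_real_derivative \<psi>' t) (at t)" "continuous_on {-1..1} \<psi>'" "\<psi> 1 = 0" "\<psi> (-1) = 0"
    and e: "e \<noteq> 0" and x: "x \<in> topspace (Euclidean_space n)"
  shows "avg e i \<psi> (D i) x = - 1 / e * avg e i \<psi>' u x"
proof -
  have cont\<psi>: "continuous_on {-1..1} \<psi>" using \<psi>(1) by (meson DERIV_isCont continuous_at_imp_continuous_on)
  have "((\<lambda>t. u (x(i := x i + e * t))) has_real_derivative D i (x(i := x i + e * t)) * e) (at t)" for t
    by (rule DERIV_chain2[OF C1_on_deriv_line[OF u i]])
      (auto intro!: derivative_eq_intros upd_in_Euclidean_space x i)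
  note der = DERIV_mult[OF \<psi>(1) this]
  have "((\<lambda>t. \<psi>' t * u (x(i := x i + e * t)) + D i (x(i := x i + e * t)) * e * \<psi> t) has_integral
      \<psi> 1 * u (x(i := x i + e * 1)) - \<psi> (-1) * u (x(i := x i + e * (-1)))) {-1..1}"
  proof (rule fundamental_theorem_of_calculus)
    show "((\<lambda>t. \<psi> t * u (x(i := x i + e * t))) has_vector_derivative
        \<psi>' t * u (x(i := x i + e * t)) + D i (x(i := x i + e * t)) * e * \<psi> t) (at t within {-1..1})" for t
      unfolding has_real_derivative_iff_has_vector_derivative[symmetric]
      using der[of t] by (rule has_field_derivative_at_within)
  qed simp
  then have "integral {-1..1} (\<lambda>t. \<psi>' t * u (x(i := x i + e * t)) + e * (\<psi> t * D i (x(i := x i + e * t)))) = 0"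
    using \<psi>(3,4) by (simp add: integral_unique mult_ac)
  moreover have "integral {-1..1} (\<lambda>t. \<psi>' t * u (x(i := x i + e * t)) + e * (\<psi> t * D i (x(i := x i + e * t))))
      = avg e i \<psi>' u x + e * avg e i \<psi> (D i) x"
    unfolding avg_def
    by (subst integral_add)
      (auto intro!: integrable_on_mult_right avg_integrable[OF C1_onD(1)[OF u] i \<psi>(2) x] avg_integrable[OF C1_onD(2)[OF u i] i cont\<psi> x])
  ultimately show ?thesis using e by (simp add: field_simps)
qed

lemma avg_cong:
  assumes "\<And>y. y \<in> topspace (Euclidean_space n) \<Longrightarrow> u y = v y" "i < n" "x \<in> topspace (Euclidean_space n)"
  shows "avg e i \<psi> u x = avg e i \<psi> v x"
  unfolding avg_def using assms by (simp add: upd_in_Euclidean_space)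

lemma avg_cmult: "avg e i \<psi> (\<lambda>y. c * u y) x = c * avg e i \<psi> u x"
  by (simp add: avg_def mult.left_commute[of _ c] )

lemma avg_close:
  assumes "continuous_on (topspace (Euclidean_space n)) u" "i < n" "x \<in> topspace (Euclidean_space n)"
    and \<phi>: "continuous_on {-1..1} \<phi>" "\<And>t. \<phi> t \<ge> 0" "integral {-1..1} \<phi> = 1"
    and le: "\<And>t. \<bar>t\<bar> \<le> 1 \<Longrightarrow> \<bar>u (x(i := x i + e * t)) - c\<bar> \<le> \<eta>"
  shows "\<bar>avg e i \<phi> u x - c\<bar> \<le> \<eta>"
proof -
  have int: "\<phi> integrable_on {-1..1}" by (rule integrable_continuous_real[OF \<phi>(1)])
  note intu = avg_integrable[OF assms(1,2) \<phi>(1) assms(3)]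
  have "avg e i \<phi> u x - c = integral {-1..1} (\<lambda>t. \<phi> t * u (x(i := x i + e * t)) - \<phi> t * c)"
    using int intu \<phi>(3) by (simp add: avg_def integral_diff integrable_on_mult_left)
  also have "norm \<dots> \<le> integral {-1..1} (\<lambda>t. \<phi> t * \<eta>)"
  proof (rule integral_norm_bound_integral)
    show "(\<lambda>t. \<phi> t * u (x(i := x i + e * t)) - \<phi> t * c) integrable_on {-1..1}"
      by (intro integrable_diff intu integrable_on_mult_left int)
    show "(\<lambda>t. \<phi> t * \<eta>) integrable_on {-1..1}" by (intro integrable_on_mult_left int)
    show "norm (\<phi> t * u (x(i := x i + e * t)) - \<phi> t * c) \<le> \<phi> t * \<eta>" if "t \<in> {-1..1}" for t
      unfolding right_diff_distrib[symmetric] real_norm_def abs_mult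
      using \<phi>(2)[of t] le[of t] that by (auto intro!: mult_left_mono)
  qed
  also have "\<dots> = \<eta>" using \<phi>(3) by simp
  finally show ?thesis by simp
qed

section \<open>Iterated averages over several coordinates\<close>

definition avgs :: "real \<Rightarrow> (nat \<Rightarrow> real \<Rightarrow> real) \<Rightarrow> nat list \<Rightarrow> ((nat \<Rightarrow> real) \<Rightarrow> real) \<Rightarrow> (nat \<Rightarrow> real) \<Rightarrow> real" where
  "avgs e \<kappa> is u = foldr (\<lambda>i. avg e i (\<kappa> i)) is u"

lemma avgs_simps [simp]: "avgs e \<kappa> [] u = u" "avgs e \<kappa> (i # is) u = avg e i (\<kappa> i) (avgs e \<kappa> is u)"
  by (simp_all add: avgs_def)

lemma avgs_continuous:
  assumes "continuous_on (topspace (Euclidean_space n)) u" "set is \<subseteq> {..<n}" "\<And>i. continuous_on {-1..1} (\<kappa> i)"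
  shows "continuous_on (topspace (Euclidean_space n)) (avgs e \<kappa> is u)"
  using assms(2) by (induction "is") (auto intro: avg_continuous assms)

lemma avgs_C1:
  assumes "C1_on n (topspace (Euclidean_space n)) u D" "set is \<subseteq> {..<n}" "\<And>i. continuous_on {-1..1} (\<kappa> i)"
  shows "C1_on n (topspace (Euclidean_space n)) (avgs e \<kappa> is u) (\<lambda>j. avgs e \<kappa> is (D j))"
  using assms(2) by (induction "is") (auto intro: avg_C1 assms)

lemma avgs_cong_kernel: "(\<And>i. i \<in> set is \<Longrightarrow> \<kappa> i = \<kappa>' i) \<Longrightarrow> avgs e \<kappa> is u = avgs e \<kappa>' is u"
  by (induction "is") auto

text \<open>Only the average in coordinate i is integrated by parts; the averages outside it pass
  the factor -1/e through by linearity, and those inside it commute with the derivative.\<close>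

lemma avgs_by_parts:
  assumes u: "C1_on n (topspace (Euclidean_space n)) u D" and \<kappa>: "\<And>i. continuous_on {-1..1} (\<kappa> i)"
    and \<psi>: "\<And>t. (\<kappa> i has_real_derivative \<psi>' t) (at t)" "continuous_on {-1..1} \<psi>'" "\<kappa> i 1 = 0" "\<kappa> i (-1) = 0"
    and e: "e \<noteq> 0" and "is": "set is \<subseteq> {..<n}" "distinct is" "i \<in> set is"
    and x: "x \<in> topspace (Euclidean_space n)"
  shows "avgs e \<kappa> is (D i) x = - 1 / e * avgs e (\<kappa>(i := \<psi>')) is u x"
  using "is" x
proof (induction "is" arbitrary: x)
  case Nil then show ?case by simp
next
  case (Cons a js)
  show ?case
  proof (cases "a = i")
    case True
    have "C1_on n (topspace (Euclidean_space n)) (avgs e \<kappa> js u) (\<lambda>j. avgs e \<kappa> js (D j))"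
      by (rule avgs_C1[OF u]) (use Cons.prems \<kappa> in auto)
    then have "avg e i (\<kappa> i) (avgs e \<kappa> js (D i)) x = - 1 / e * avg e i \<psi>' (avgs e \<kappa> js u) x"
      by (rule avg_by_parts) (use Cons.prems True \<psi> e in auto)
    \<comment> \<open>As the list is distinct, its tail never uses the kernel of coordinate
      i.\<close>
    moreover have "avgs e (\<kappa>(i := \<psi>')) js u = avgs e \<kappa> js u"
      by (rule avgs_cong_kernel) (use Cons.prems True in auto)
    ultimately show ?thesis using True by (simp del: fun_upd_apply add: fun_upd_same)
  next
    case False
    have "avg e a (\<kappa> a) (avgs e \<kappa> js (D i)) x = avg e a (\<kappa> a) (\<lambda>y. - 1 / e * avgs e (\<kappa>(i := \<psi>')) js u y) x"
    proof (rule avg_cong[of n])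
      fix y assume "y \<in> topspace (Euclidean_space n)"
      then show "avgs e \<kappa> js (D i) y = - 1 / e * avgs e (\<kappa>(i := \<psi>')) js u y"
        by (intro Cons.IH) (use Cons.prems False in auto)
    qed (use Cons.prems in auto)
    then show ?thesis using False by (simp only: avgs_simps avg_cmult fun_upd_other[OF False])
  qed
qed

text \<open>Since \<open>u\<close> is \<open>C\<^sup>1\<close>, every further derivative can be moved onto the kernel by parts, so no change
  of variables is needed.\<close>

lemma Ck_on_avgs:
  assumes u: "C1_on n (topspace (Euclidean_space n)) u D"
    and \<phi>: "\<And>k t. (\<phi> k has_real_derivative \<phi> (Suc k) t) (at t)" "\<And>k t. \<bar>t\<bar> \<ge> 1 \<Longrightarrow> \<phi> k t = 0" and e: "e \<noteq> 0"
  shows "Ck_on n k (topspace (Euclidean_space n)) (avgs e (\<lambda>i. \<phi> (m i)) [0..<n] u)"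
\<comment> \<open>The entry \<open>m j\<close> records how many derivatives have fallen on the
  kernel of coordinate j; each further derivative raises one entry, so m must be general.\<close>
proof (induction k arbitrary: m)
  have cont: "continuous_on {-1..1} (\<phi> k)" for k
    using \<phi>(1) by (meson DERIV_isCont continuous_at_imp_continuous_on)
  {
    case 0
    show ?case using avgs_continuous[OF C1_onD(1)[OF u], of "[0..<n]" "\<lambda>i. \<phi> (m i)" e] cont
      by (simp add: atLeast0LessThan)
  next
    case (Suc k)
    have op: "openin (Euclidean_space n) (topspace (Euclidean_space n))" by simp
    have C1: "C1_on n (topspace (Euclidean_space n)) (avgs e (\<lambda>i. \<phi> (m i)) [0..<n] u)
        (\<lambda>j. avgs e (\<lambda>i. \<phi> (m i)) [0..<n] (D j))"
      by (rule avgs_C1[OF u]) (use cont in auto)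
    note pd = C1_on_partial_deriv[OF C1]
    have eq: "- 1 / e * avgs e (\<lambda>i. \<phi> ((m(j := Suc (m j))) i)) [0..<n] u x =
        avgs e (\<lambda>i. \<phi> (m i)) [0..<n] (D j) x"
      if "j < n" "x \<in> topspace (Euclidean_space n)" for j x
    proof -
      have "(\<lambda>i. \<phi> ((m(j := Suc (m j))) i)) = (\<lambda>i. \<phi> (m i))(j := \<phi> (Suc (m j)))" by auto
      then show ?thesis
        using avgs_by_parts[OF u, of "\<lambda>i. \<phi> (m i)" j "\<phi> (Suc (m j))" e "[0..<n]" x] cont \<phi> e that
        by (simp add: atLeast0LessThan)
    qed
    have "Ck_on n k (topspace (Euclidean_space n)) (partial_deriv j (avgs e (\<lambda>i. \<phi> (m i)) [0..<n] u))"
      if "j < n" for j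
      by (rule Ck_on_cong[OF op _ Ck_on_cmult[OF op Suc.IH[of "m(j := Suc (m j))"], of "- 1 / e"]])
        (use eq pd that in auto)
    then show ?case unfolding Ck_on_Suc_iff using C1_on_D_cong[OF C1] pd by auto
  }
qed

text \<open>Averaging against a nonnegative kernel of mass 1 is taking a mean, so each coordinate
  adds one error \<eta>. The inner averages are compared with u at the shifted point, so only the
  variation of u itself enters.\<close>

lemma avgs_close:
  assumes u: "continuous_on (topspace (Euclidean_space n)) u"
    and \<phi>: "continuous_on {-1..1} \<phi>" "\<And>t. \<phi> t \<ge> 0" "integral {-1..1} \<phi> = 1"
    and le: "\<And>x i t. x \<in> topspace (Euclidean_space n) \<Longrightarrow> i < n \<Longrightarrow> \<bar>t\<bar> \<le> 1 \<Longrightarrow>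
        \<bar>u (x(i := x i + e * t)) - u x\<bar> \<le> \<eta>"
    and "is": "set is \<subseteq> {..<n}" and x: "x \<in> topspace (Euclidean_space n)"
  shows "\<bar>avgs e (\<lambda>_. \<phi>) is u x - u x\<bar> \<le> real (length is) * \<eta>"
  using "is" x
proof (induction "is" arbitrary: x)
  case Nil then show ?case by simp
next
  case (Cons a js)
  have "\<bar>avg e a \<phi> (avgs e (\<lambda>_. \<phi>) js u) x - u x\<bar> \<le> real (length js) * \<eta> + \<eta>"
  proof (rule avg_close[OF avgs_continuous[OF u] _ _ \<phi>])
    fix t :: real assume t: "\<bar>t\<bar> \<le> 1"
    let ?y = "x(a := x a + e * t)"
    have "?y \<in> topspace (Euclidean_space n)" using Cons.prems by (auto intro: upd_in_Euclidean_space)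
    then have "\<bar>avgs e (\<lambda>_. \<phi>) js u ?y - u ?y\<bar> \<le> real (length js) * \<eta>" using Cons by auto
    moreover have "\<bar>u ?y - u x\<bar> \<le> \<eta>" using le[of x a t] Cons.prems t by auto
    ultimately show "\<bar>avgs e (\<lambda>_. \<phi>) js u ?y - u x\<bar> \<le> real (length js) * \<eta> + \<eta>" by linarith
  qed (use Cons.prems \<phi> in auto)
  then show ?case by (simp add: algebra_simps)
qed

text \<open>Averaging spreads the support by at most |e| in each listed coordinate, since a distinct
  list shifts each coordinate only once. Local finiteness of the mollified sum rests on
  this.\<close>

lemma avgs_eq_0:
  assumes "set is \<subseteq> {..<n}" "distinct is" "x \<in> topspace (Euclidean_space n)"
    and "\<And>y. y \<in> topspace (Euclidean_space n) \<Longrightarrow> (\<And>j. j \<in> set is \<Longrightarrow> \<bar>y j - x j\<bar> \<le> \<bar>e\<bar>) \<Longrightarrow>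
        (\<And>j. j \<notin> set is \<Longrightarrow> y j = x j) \<Longrightarrow> u y = 0"
  shows "avgs e \<kappa> is u x = 0"
  using assms
proof (induction "is" arbitrary: x)
  case Nil then show ?case by simp
next
  case (Cons a js)
  have "avgs e \<kappa> js u (x(a := x a + e * t)) = 0" if "\<bar>t\<bar> \<le> 1" for t
  proof (rule Cons.IH)
    fix y assume y: "y \<in> topspace (Euclidean_space n)"
      "\<And>j. j \<in> set js \<Longrightarrow> \<bar>y j - (x(a := x a + e * t)) j\<bar> \<le> \<bar>e\<bar>"
      "\<And>j. j \<notin> set js \<Longrightarrow> y j = (x(a := x a + e * t)) j"
    show "u y = 0"
    proof (rule Cons.prems(4)[OF y(1)])
      fix j assume "j \<in> set (a # js)"
      then show "\<bar>y j - x j\<bar> \<le> \<bar>e\<bar>"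
        using y(2)[of j] y(3)[of j] Cons.prems(2) mult_left_mono[OF that, of "\<bar>e\<bar>"]
        by (cases "j = a") (auto simp: abs_mult)
    next
      fix j assume "j \<notin> set (a # js)"
      then show "y j = x j" using y(3)[of j] by auto
    qed
  next
    show "x(a := x a + e * t) \<in> topspace (Euclidean_space n)"
      by (rule upd_in_Euclidean_space) (use Cons.prems in auto)
  qed (use Cons.prems in auto)
  then have "integral {-1..1} (\<lambda>t. \<kappa> a t * avgs e \<kappa> js u (x(a := x a + e * t))) = integral {-1..1} (\<lambda>t::real. 0::real)"
    by (intro Henstock_Kurzweil_Integration.integral_cong) auto
  then show ?case by (simp add: avg_def)
qed

section \<open>Smooth approximation on open sets\<close>

text \<open>The factor \<open>2\<close> is there because \<open>from_nat\<close> need not be injective, not even on \<^typ>\<open>nat\<close>: one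
  coordinate may occur several times in the sum defining \<^const>\<open>dist\<close>.\<close>

lemma dist_le_sum_coords:
  assumes "x \<in> topspace (Euclidean_space n)" "y \<in> topspace (Euclidean_space n)"
  shows "dist x y \<le> 2 * (\<Sum>i<n. \<bar>x i - y i\<bar>)"
proof -
  let ?S = "\<Sum>i<n. \<bar>x i - y i\<bar>"
  have S: "?S \<ge> 0" by (intro sum_nonneg) auto
  have le: "min (dist (x j) (y j)) 1 \<le> ?S" for j
  proof (cases "j < n")
    case True
    then have "\<bar>x j - y j\<bar> \<le> ?S" by (intro member_le_sum) auto
    then show ?thesis by (simp add: dist_real_def min.coboundedI1)
  next
    case False
    then show ?thesis using assms S by (simp add: topspace_Euclidean_space)
  qed
  have geo: "(\<lambda>m. (1/2::real) ^ m) sums 2" using geometric_sums[of "1/2::real"] by simp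
  have "dist x y \<le> (\<Sum>m. (1/2)^m * ?S)"
    unfolding dist_fun_def
  proof (rule suminf_le)
    show "(1/2)^m * min (dist (x (from_nat m)) (y (from_nat m))) 1 \<le> (1/2)^m * ?S" for m
      by (intro mult_left_mono le) auto
    show "summable (\<lambda>m. (1/2)^m * min (dist (x (from_nat m)) (y (from_nat m))) 1)"
      by (rule summable_comparison_test'[OF sums_summable[OF geo], of 0]) (auto simp: mult_left_le)
    show "summable (\<lambda>m. (1/2)^m * ?S)" using sums_mult2[OF geo, of ?S] by (rule sums_summable)
  qed
  also have "\<dots> = 2 * ?S" using sums_mult2[OF geo, of ?S] by (rule sums_unique[symmetric])
  finally show ?thesis .
qed

lemma openin_contains_box:
  assumes "openin (Euclidean_space n) U" "x \<in> U"
  obtains r where "r > 0"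
    "\<And>y. y \<in> topspace (Euclidean_space n) \<Longrightarrow> (\<And>i. i < n \<Longrightarrow> \<bar>y i - x i\<bar> \<le> r) \<Longrightarrow> y \<in> U"
proof -
  obtain V where V: "open V" "U = V \<inter> topspace (Euclidean_space n)"
    using assms(1) openin_Euclidean_space_iff by auto
  then obtain e where e: "e > 0" "\<And>y. dist y x < e \<Longrightarrow> y \<in> V"
    using assms(2) by (metis IntD1 open_dist)
  \<comment> \<open>The summand 1 makes the final bound strict and covers n = 0.\<close>
  define r where "r = e / (2 * real n + 1)"
  have r: "r > 0" using e by (simp add: r_def)
  have "y \<in> U" if y: "y \<in> topspace (Euclidean_space n)" "\<And>i. i < n \<Longrightarrow> \<bar>y i - x i\<bar> \<le> r" for y
  proof -
    have "dist y x \<le> 2 * (\<Sum>i<n. \<bar>y i - x i\<bar>)"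
      by (rule dist_le_sum_coords) (use y(1) assms(2) V(2) in auto)
    also have "\<dots> \<le> 2 * (\<Sum>i<n. r)" using y(2) by (intro mult_left_mono sum_mono) auto
    also have "\<dots> < e" using e(1) by (simp add: r_def field_simps)
    finally show "y \<in> U" using e(2) V(2) y(1) by auto
  qed
  then show thesis using that r by blast
qed

text \<open>Tychonoff: the box is a product of compact intervals, with the factor {0} at every index
  from n on.\<close>

lemma compact_box:
  "compact {x \<in> topspace (Euclidean_space n). \<forall>i<n. \<bar>x i\<bar> \<le> R}"
proof -
  have "{x \<in> topspace (Euclidean_space n). \<forall>i<n. \<bar>x i\<bar> \<le> R} = PiE UNIV (\<lambda>i. if i < n then {-R..R} else {0})"
  proof (intro set_eqI iffI)
    fix x assume "x \<in> PiE UNIV (\<lambda>i. if i < n then {-R..R} else {0})"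
    then have "x i \<in> (if i < n then {-R..R} else {0})" for i by (rule PiE_mem) auto
    then have "i < n \<Longrightarrow> \<bar>x i\<bar> \<le> R" "i \<ge> n \<Longrightarrow> x i = 0" for i
      by (metis abs_le_iff atLeastAtMost_iff minus_le_iff, metis not_le singletonD)
    then show "x \<in> {x \<in> topspace (Euclidean_space n). \<forall>i<n. \<bar>x i\<bar> \<le> R}"
      by (simp add: topspace_Euclidean_space)
  qed (auto simp: topspace_Euclidean_space PiE_iff abs_le_iff)
  moreover have "compactin (product_topology (\<lambda>i. euclidean) UNIV) (PiE UNIV (\<lambda>i. if i < n then {-R..R} else {0::real}))"
    unfolding compactin_PiE by auto
  ultimately show ?thesis by (simp add: euclidean_product_topology)
qed

text \<open>Compactness gives uniform continuity on a box, and vanishing outside a smaller box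
  extends it to the whole space. The modulus concerns shifts along an axis, the only moves made by
  the averages.\<close>

lemma uniformly_continuous_shift:
  assumes u: "continuous_on (topspace (Euclidean_space n)) u"
    and supp: "\<And>x j. x \<in> topspace (Euclidean_space n) \<Longrightarrow> j < n \<Longrightarrow> \<bar>x j\<bar> > R \<Longrightarrow> u x = 0" and "\<eta> > 0"
  shows "\<exists>\<delta>>0. \<forall>x\<in>topspace (Euclidean_space n). \<forall>i<n. \<forall>s. \<bar>s\<bar> \<le> \<delta> \<longrightarrow> \<bar>u (x(i := x i + s)) - u x\<bar> \<le> (\<eta>::real)"
proof -
  \<comment> \<open>One unit of room: when one of the two points lies in the box of size R, the
    other one still lies in K.\<close>
  define K where "K = {x \<in> topspace (Euclidean_space n). \<forall>i<n. \<bar>x i\<bar> \<le> R + 1}"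
  have "uniformly_continuous_on K u"
    by (rule compact_uniformly_continuous) (auto simp: K_def compact_box intro: continuous_on_subset[OF u])
  then obtain d where d: "d > 0" "\<And>x y. x \<in> K \<Longrightarrow> y \<in> K \<Longrightarrow> dist y x < d \<Longrightarrow> dist (u y) (u x) < \<eta>"
    using \<open>\<eta> > 0\<close> unfolding uniformly_continuous_on_def by metis
  \<comment> \<open>The distance is at most twice the shift, so d/3 keeps it below d.\<close>
  define \<delta> where "\<delta> = min (d / 3) 1"
  have "\<bar>u (x(i := x i + s)) - u x\<bar> \<le> \<eta>"
    if x: "x \<in> topspace (Euclidean_space n)" and i: "i < n" and s: "\<bar>s\<bar> \<le> \<delta>" for x i s
  proof -
    define y where "y = x(i := x i + s)"
    have y: "y \<in> topspace (Euclidean_space n)" unfolding y_def by (rule upd_in_Euclidean_space[OF x i])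
    have yi: "\<bar>y j - x j\<bar> \<le> (if j = i then \<bar>s\<bar> else 0)" for j by (auto simp: y_def)
    have close: "\<bar>y j - x j\<bar> \<le> 1" for j
      using yi[of j] s by (auto simp: \<delta>_def split: if_splits)
    have "dist y x \<le> 2 * (\<Sum>j<n. \<bar>y j - x j\<bar>)" by (rule dist_le_sum_coords[OF y x])
    also have "\<dots> \<le> 2 * (\<Sum>j<n. if j = i then \<bar>s\<bar> else 0)" using yi by (intro mult_left_mono sum_mono) auto
    also have "\<dots> = 2 * \<bar>s\<bar>" using i by simp
    also have "\<dots> < d" using s d(1) by (auto simp: \<delta>_def)
    finally have dist: "dist y x < d" .
    show ?thesis
    proof (cases "(\<forall>j<n. \<bar>x j\<bar> \<le> R) \<or> (\<forall>j<n. \<bar>y j\<bar> \<le> R)")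
      case True
      have "x \<in> K" "y \<in> K"
        unfolding K_def using x y True close by (smt (verit, best) mem_Collect_eq)+
      from d(2)[OF this dist] show ?thesis by (simp add: y_def dist_real_def)
    next
      case False
      then have "u x = 0" "u y = 0" using supp x y by (meson not_le)+
      then show ?thesis using \<open>\<eta> > 0\<close> by (simp add: y_def)
    qed
  qed
  moreover have "\<delta> > 0" using d(1) by (simp add: \<delta>_def)
  ultimately show ?thesis by blast
qed

lemma C1_mollify:
  assumes u: "C1_on n (topspace (Euclidean_space n)) u D"
    and supp: "\<And>x j. x \<in> topspace (Euclidean_space n) \<Longrightarrow> j < n \<Longrightarrow> \<bar>x j\<bar> > R \<Longrightarrow> u x = 0" and \<epsilon>: "\<epsilon> > 0"
  obtains g D' where "\<And>k. Ck_on n k (topspace (Euclidean_space n)) g"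
    "C1_on n (topspace (Euclidean_space n)) g D'"
    "\<And>x. x \<in> topspace (Euclidean_space n) \<Longrightarrow> \<bar>g x - u x\<bar> \<le> \<epsilon>"
    "\<And>x i. x \<in> topspace (Euclidean_space n) \<Longrightarrow> i < n \<Longrightarrow> \<bar>D' i x - D i x\<bar> \<le> \<epsilon>"
    "\<And>x. x \<in> topspace (Euclidean_space n) \<Longrightarrow>
      (\<And>y. y \<in> topspace (Euclidean_space n) \<Longrightarrow> (\<And>j. j < n \<Longrightarrow> \<bar>y j - x j\<bar> \<le> \<epsilon>) \<Longrightarrow> u y = 0) \<Longrightarrow> g x = 0"
proof -
  let ?E = "topspace (Euclidean_space n)"
  obtain \<phi> :: "nat \<Rightarrow> real \<Rightarrow> real" where
    \<phi>: "\<And>k t. (\<phi> k has_real_derivative \<phi> (Suc k) t) (at t)"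
    "\<And>k t. \<bar>t\<bar> \<ge> 1 \<Longrightarrow> \<phi> k t = 0"
    "\<And>t. \<phi> 0 t \<ge> 0" "integral {-1..1} (\<phi> 0) = 1"
    using smooth_bump_exists by blast
  have cont: "continuous_on {-1..1} (\<phi> k)" for k
    using \<phi>(1) by (meson DERIV_isCont continuous_at_imp_continuous_on)
  \<comment> \<open>The derivatives inherit the support: on the i-th line u is zero near x, either
    because the large coordinate is the moving one and stays large, or because it does not
    move.\<close>
  have suppD: "D i x = 0" if x: "x \<in> ?E" and j: "j < n" "\<bar>x j\<bar> > R" and i: "i < n" for x i j
  proof -
    have "\<forall>\<^sub>F t in nhds (x i). u (x(i := t)) = 0"
    proof (cases "j = i")
      case True
      have "open {t::real. \<bar>t\<bar> > R}" by (intro open_Collect_less continuous_intros)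
      then have "\<forall>\<^sub>F t in nhds (x i). \<bar>t\<bar> > R"
        using j(2) True by (auto simp: eventually_nhds)
      then show ?thesis
      proof eventually_elim
        case (elim t)
        show "u (x(i := t)) = 0" by (rule supp[OF upd_in_Euclidean_space[OF x i] i]) (use elim in simp)
      qed
    next
      case False
      show ?thesis
      proof (rule always_eventually, rule allI)
        show "u (x(i := t)) = 0" for t
          by (rule supp[OF upd_in_Euclidean_space[OF x i] j(1)]) (use j(2) False in simp)
      qed
    qed
    then have 0: "((\<lambda>t. u (x(i := t))) has_real_derivative 0) (at (x i))"
      using DERIV_cong_ev[OF refl _ refl, of "\<lambda>t. u (x(i := t))" "\<lambda>_. 0" "x i" 0] by auto
    show ?thesis by (rule DERIV_unique[OF C1_onD(3)[OF u i x] 0])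
  qed
  define \<eta> where "\<eta> = \<epsilon> / (real n + 1)"
  have \<eta>: "\<eta> > 0" "real n * \<eta> \<le> \<epsilon>" using \<epsilon> by (auto simp: \<eta>_def field_simps)
  have "\<exists>d>0. \<forall>x\<in>?E. \<forall>i<n. \<forall>s. \<bar>s\<bar> \<le> d \<longrightarrow> \<bar>u (x(i := x i + s)) - u x\<bar> \<le> \<eta>"
    by (rule uniformly_continuous_shift[OF C1_onD(1)[OF u] _ \<eta>(1), of R]) (rule supp)
  then obtain d where d: "d > 0" "\<And>x i s. x \<in> ?E \<Longrightarrow> i < n \<Longrightarrow> \<bar>s\<bar> \<le> d \<Longrightarrow> \<bar>u (x(i := x i + s)) - u x\<bar> \<le> \<eta>"
    by blast
  have "\<forall>j. j < n \<longrightarrow> (\<exists>\<delta>>0. \<forall>x\<in>?E. \<forall>i<n. \<forall>s. \<bar>s\<bar> \<le> \<delta> \<longrightarrow> \<bar>D j (x(i := x i + s)) - D j x\<bar> \<le> \<eta>)"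
  proof (intro allI impI)
    fix j assume j: "j < n"
    show "\<exists>\<delta>>0. \<forall>x\<in>?E. \<forall>i<n. \<forall>s. \<bar>s\<bar> \<le> \<delta> \<longrightarrow> \<bar>D j (x(i := x i + s)) - D j x\<bar> \<le> \<eta>"
      by (rule uniformly_continuous_shift[OF C1_onD(2)[OF u j] _ \<eta>(1), of R]) (rule suppD[OF _ _ _ j])
  qed
  then obtain \<delta> where \<delta>: "\<And>j. j < n \<Longrightarrow> \<delta> j > 0"
    "\<And>j x i s. j < n \<Longrightarrow> x \<in> ?E \<Longrightarrow> i < n \<Longrightarrow> \<bar>s\<bar> \<le> \<delta> j \<Longrightarrow> \<bar>D j (x(i := x i + s)) - D j x\<bar> \<le> \<eta>"
    by metis
  \<comment> \<open>One scale for u and all its derivatives, and at most \<epsilon>, so that the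
    support spreads by no more than \<epsilon>.\<close>
  define e where "e = Min (insert \<epsilon> (insert d (\<delta> ` {..<n})))"
  have e: "e > 0" using \<epsilon> d(1) \<delta>(1) by (auto simp: e_def)
  have e_le: "e \<le> \<epsilon>" "e \<le> d" "\<And>j. j < n \<Longrightarrow> e \<le> \<delta> j"
    unfolding e_def by (auto intro!: Min_le simp del: Min_insert)
  have et: "\<bar>e * t\<bar> \<le> e" if "\<bar>t\<bar> \<le> 1" for t :: real
    using e that by (simp add: abs_mult)
  define g where "g = avgs e (\<lambda>i. \<phi> 0) [0..<n] u"
  define D' where "D' = (\<lambda>j. avgs e (\<lambda>i. \<phi> 0) [0..<n] (D j))"
  show thesis
  proof
    show "Ck_on n k ?E g" for k
      unfolding g_def using Ck_on_avgs[OF u, of \<phi> e k "\<lambda>_. 0"] \<phi>(1,2) e by simp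
    show "C1_on n ?E g D'"
      unfolding g_def D'_def by (rule avgs_C1[OF u]) (use cont in auto)
    show "\<bar>g x - u x\<bar> \<le> \<epsilon>" if "x \<in> ?E" for x
    proof -
      have "\<bar>g x - u x\<bar> \<le> real (length [0..<n]) * \<eta>"
        unfolding g_def
      proof (rule avgs_close[OF C1_onD(1)[OF u] cont[of 0] \<phi>(3,4)])
        show "\<bar>u (x(i := x i + e * t)) - u x\<bar> \<le> \<eta>" if "x \<in> ?E" "i < n" "\<bar>t\<bar> \<le> 1" for x i t
          by (rule d(2)[OF that(1,2) order_trans[OF et[OF that(3)] e_le(2)]])
      qed (use that in auto)
      then show ?thesis using \<eta>(2) by simp
    qed
    show "\<bar>D' i x - D i x\<bar> \<le> \<epsilon>" if "x \<in> ?E" "i < n" for x i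
    proof -
      have "\<bar>D' i x - D i x\<bar> \<le> real (length [0..<n]) * \<eta>"
        unfolding D'_def
      proof (rule avgs_close[OF C1_onD(2)[OF u that(2)] cont[of 0] \<phi>(3,4)])
        show "\<bar>D i (x(j := x j + e * t)) - D i x\<bar> \<le> \<eta>" if "x \<in> ?E" "j < n" "\<bar>t\<bar> \<le> 1" for x j t
          by (rule \<delta>(2)[OF \<open>i < n\<close> that(1,2) order_trans[OF et[OF that(3)] e_le(3)[OF \<open>i < n\<close>]]])
      qed (use that in auto)
      then show ?thesis using \<eta>(2) by simp
    qed
    show "g x = 0" if x: "x \<in> ?E"
      and 0: "\<And>y. y \<in> ?E \<Longrightarrow> (\<And>j. j < n \<Longrightarrow> \<bar>y j - x j\<bar> \<le> \<epsilon>) \<Longrightarrow> u y = 0" for x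
      unfolding g_def
    proof (rule avgs_eq_0[OF _ _ x])
      show "u y = 0" if "y \<in> ?E" "\<And>j. j \<in> set [0..<n] \<Longrightarrow> \<bar>y j - x j\<bar> \<le> \<bar>e\<bar>" for y
        by (rule 0[OF that(1)]) (use that(2) e_le(1) e in force)
    qed auto
  qed
qed

text \<open>Regularity C^1 is enough because each piece is mollified afterwards. The square q of the
  positive part is C^1, and q(1 - q(N)) with N = |x - c|^2 / r^2 - 1 equals 1 for N \<le> 0 and 0
  for N \<ge> 1.\<close>

lemma C1_cutoff:
  assumes r: "r > 0"
  obtains \<eta> D where "C1_on n U \<eta> D" "\<And>x. 0 \<le> \<eta> x" "\<And>x. \<eta> x \<le> 1"
    "\<And>x. (\<Sum>i<n. (x i - c i)\<^sup>2) \<le> r\<^sup>2 \<Longrightarrow> \<eta> x = 1"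
    "\<And>x. (\<Sum>i<n. (x i - c i)\<^sup>2) \<ge> 2 * r\<^sup>2 \<Longrightarrow> \<eta> x = 0"
proof -
  define q :: "real \<Rightarrow> real" where "q y = (max 0 y)\<^sup>2" for y
  have q: "(q has_real_derivative 2 * max 0 y) (at y)" for y
  proof -
    consider "y < 0" | "y > 0" | "y = 0" by linarith
    then show ?thesis
    proof cases
      case 1
      have "\<forall>\<^sub>F x in nhds y. q x = 0"
        using eventually_nhds_in_open[of "{..<0}" y] 1 by (auto elim!: eventually_mono simp: q_def)
      then show ?thesis using 1 DERIV_cong_ev[OF refl _ refl, of q "\<lambda>_. 0" y 0] by auto
    next
      case 2
      have "\<forall>\<^sub>F x in nhds y. q x = x\<^sup>2"
        using eventually_nhds_in_open[of "{0<..}" y] 2 by (auto elim!: eventually_mono simp: q_def)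
      moreover have "((\<lambda>x. x\<^sup>2) has_real_derivative 2 * max 0 y) (at y)"
        using 2 by (auto intro!: derivative_eq_intros)
      ultimately show ?thesis using DERIV_cong_ev[OF refl _ refl, of q "\<lambda>x. x\<^sup>2" y] by auto
    next
      case 3
      have "((\<lambda>h. q h / h) \<longlongrightarrow> 0) (at 0)"
      proof (rule Lim_null_comparison)
        show "\<forall>\<^sub>F h in at 0. norm (q h / h) \<le> \<bar>h\<bar>"
          by (auto simp: eventually_at_filter q_def max_def power2_eq_square)
        show "((\<lambda>h::real. \<bar>h\<bar>) \<longlongrightarrow> 0) (at 0)" by (intro tendsto_eq_intros) auto
      qed
      then show ?thesis using 3 by (simp add: DERIV_def q_def)
    qed
  qed
  have q2: "((\<lambda>y. q (1 - q y)) has_real_derivative 2 * max 0 (1 - q y) * (- (2 * max 0 y))) (at y)" for y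
    by (rule DERIV_chain2[OF q]) (auto intro!: derivative_eq_intros q)
  have contq: "continuous_on UNIV q" unfolding q_def by (intro continuous_intros)
  define N where "N x = (\<Sum>i<n. (x i - c i)\<^sup>2) / r\<^sup>2 - 1" for x
  have N: "C1_on n U N (\<lambda>i x. 2 * (x i - c i) / r\<^sup>2)"
    unfolding C1_on_def N_def
  proof (intro conjI allI impI ballI)
    have coord: "continuous_on U (\<lambda>x. x i)" for i :: nat
      by (rule continuous_on_product_then_coordinatewise) (rule continuous_on_id)
    show "continuous_on U (\<lambda>x. (\<Sum>i<n. (x i - c i)\<^sup>2) / r\<^sup>2 - 1)"
      using r by (intro continuous_intros coord) auto
    show "continuous_on U (\<lambda>x. 2 * (x i - c i) / r\<^sup>2)" for i
      using r by (intro continuous_intros coord) auto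
    fix i x assume i: "i < n" "x \<in> U"
    have "(\<Sum>j<n. ((x(i := t)) j - c j)\<^sup>2) = (t - c i)\<^sup>2 + (\<Sum>j\<in>{..<n}-{i}. (x j - c j)\<^sup>2)" for t
      using i by (subst sum.remove[of _ i]) auto
    then show "((\<lambda>t. (\<Sum>j<n. ((x(i := t)) j - c j)\<^sup>2) / r\<^sup>2 - 1) has_real_derivative 2 * (x i - c i) / r\<^sup>2) (at (x i))"
      using r by (auto intro!: derivative_eq_intros simp: power2_eq_square)
  qed
  have "continuous_on UNIV (\<lambda>y. 2 * max 0 (1 - q y) * (- (2 * max 0 y)))"
    by (intro continuous_intros contq)
  note C1 = C1_on_compose[OF N q2 this]
  have q01: "q y \<ge> 0" for y by (simp add: q_def)
  show thesis
  proof (rule that[OF C1])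
    show "0 \<le> q (1 - q (N x))" for x by (rule q01)
    show "q (1 - q (N x)) \<le> 1" for x
      using q01[of "N x"] unfolding q_def[of "1 - q (N x)"] by (intro power_le_one) auto
    show "q (1 - q (N x)) = 1" if "(\<Sum>i<n. (x i - c i)\<^sup>2) \<le> r\<^sup>2" for x
    proof -
      have "N x \<le> 0" using that r by (simp add: N_def)
      then have "q (N x) = 0" by (simp add: q_def)
      then show ?thesis by (simp add: q_def)
    qed
    show "q (1 - q (N x)) = 0" if "(\<Sum>i<n. (x i - c i)\<^sup>2) \<ge> 2 * r\<^sup>2" for x
    proof -
      have "N x \<ge> 1" using that r by (simp add: N_def field_simps)
      then have "1 \<le> (max 0 (N x))\<^sup>2" by (intro one_le_power) auto
      then show ?thesis by (simp add: q_def)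
    qed
  qed
qed

text \<open>By Lindelof's theorem countably many balls \<open>B k\<close> cover G. The sets
  \<open>S k\<close> are bounded, relatively closed, contained in G, and contain all points where
  \<open>\<eta> k\<close> is nonzero; so a function on G times a cutoff extends by zero.\<close>

lemma cutoff_cover:
  assumes G: "openin (Euclidean_space n) G" "G \<noteq> {}"
  obtains \<eta> D S B R where
    "\<And>k::nat. C1_on n (topspace (Euclidean_space n)) (\<eta> k) (D k)"
    "\<And>k x. 0 \<le> \<eta> k x" "\<And>k x. \<eta> k x \<le> 1"
    "\<And>k. S k \<subseteq> G" "\<And>k. openin (Euclidean_space n) (topspace (Euclidean_space n) - S k)"
    "\<And>k x. x \<in> topspace (Euclidean_space n) - S k \<Longrightarrow> \<eta> k x = 0"
    "\<And>k x i. x \<in> S k \<Longrightarrow> i < n \<Longrightarrow> \<bar>x i\<bar> \<le> R k"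
    "\<And>k. openin (Euclidean_space n) (B k)" "\<And>k x. x \<in> B k \<Longrightarrow> \<eta> k x = 1" "G \<subseteq> (\<Union>k. B k)"
proof -
  let ?E = "topspace (Euclidean_space n)"
  define N where "N c x = (\<Sum>i<n. (x i - c i)\<^sup>2)" for c x :: "nat \<Rightarrow> real"
  have contN: "continuous_on UNIV (N c)" for c
    unfolding N_def by (intro continuous_intros continuous_on_product_then_coordinatewise[OF continuous_on_id])
  have Nle: "\<bar>x i - c i\<bar> \<le> s" if "N c x \<le> s\<^sup>2" "s \<ge> 0" "i < n" for c x s i
  proof -
    have "(x i - c i)\<^sup>2 \<le> N c x" unfolding N_def using that(3) by (intro member_le_sum) auto
    then have "(x i - c i)\<^sup>2 \<le> s\<^sup>2" using that by simp
    then show ?thesis using that(2) by (simp add: abs_le_square_iff[symmetric])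
  qed
  have "\<exists>r>0. \<forall>x\<in>?E. N c x \<le> 2 * r\<^sup>2 \<longrightarrow> x \<in> G" if c: "c \<in> G" for c
  proof -
    obtain r where r: "r > 0" "\<And>y. y \<in> ?E \<Longrightarrow> (\<And>i. i < n \<Longrightarrow> \<bar>y i - c i\<bar> \<le> r) \<Longrightarrow> y \<in> G"
      using openin_contains_box[OF G(1) c] by blast
    have "x \<in> G" if x: "x \<in> ?E" "N c x \<le> 2 * (r / 2)\<^sup>2" for x
    proof (rule r(2)[OF x(1)])
      have "N c x \<le> r\<^sup>2" using order_trans[OF x(2), of "r\<^sup>2"] by (simp add: power_divide)
      then show "\<bar>x i - c i\<bar> \<le> r" if "i < n" for i using Nle[of c x r i] r(1) that by simp
    qed
    then show ?thesis using r(1) by (intro exI[of _ "r / 2"]) auto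
  qed
  then obtain r where r: "\<And>c. c \<in> G \<Longrightarrow> r c > 0"
    "\<And>c x. c \<in> G \<Longrightarrow> x \<in> ?E \<Longrightarrow> N c x \<le> 2 * (r c)\<^sup>2 \<Longrightarrow> x \<in> G" by metis
  define F where "F c = {x. N c x < (r c)\<^sup>2}" for c
  have openF: "open (F c)" for c
    unfolding F_def by (intro open_Collect_less contN continuous_intros)
  obtain \<F> where \<F>: "\<F> \<subseteq> F ` G" "countable \<F>" "\<Union>\<F> = \<Union>(F ` G)"
    using Lindelof[of "F ` G"] openF by blast
  then obtain C where C: "C \<subseteq> G" "countable C" "\<F> = F ` C"
    using countable_subset_image by metis
  have inF: "c \<in> F c" if "c \<in> G" for c using r(1)[OF that] by (simp add: F_def N_def)
  have "C \<noteq> {}" using C \<F>(3) G(2) inF by auto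
  define c where "c = from_nat_into C"
  have cG: "c k \<in> G" for k using from_nat_into[OF \<open>C \<noteq> {}\<close>] C(1) by (auto simp: c_def)
  have "range c = C" unfolding c_def using range_from_nat_into[OF \<open>C \<noteq> {}\<close> C(2)] .
  then have "\<Union>\<F> = (\<Union>k. F (c k))" using C(3) by auto
  moreover have "G \<subseteq> \<Union>(F ` G)"
  proof
    show "x \<in> \<Union>(F ` G)" if "x \<in> G" for x using inF[OF that] that by (rule UN_I[rotated])
  qed
  ultimately have cov: "G \<subseteq> (\<Union>k. F (c k))" using \<F>(3) by simp
  have "\<forall>k. \<exists>\<eta> D. C1_on n ?E \<eta> D \<and> (\<forall>x. 0 \<le> \<eta> x) \<and> (\<forall>x. \<eta> x \<le> 1) \<and>
      (\<forall>x. N (c k) x \<le> (r (c k))\<^sup>2 \<longrightarrow> \<eta> x = 1) \<and> (\<forall>x. N (c k) x \<ge> 2 * (r (c k))\<^sup>2 \<longrightarrow> \<eta> x = 0)"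
  proof
    fix k
    show "\<exists>\<eta> D. C1_on n ?E \<eta> D \<and> (\<forall>x. 0 \<le> \<eta> x) \<and> (\<forall>x. \<eta> x \<le> 1) \<and>
      (\<forall>x. N (c k) x \<le> (r (c k))\<^sup>2 \<longrightarrow> \<eta> x = 1) \<and> (\<forall>x. N (c k) x \<ge> 2 * (r (c k))\<^sup>2 \<longrightarrow> \<eta> x = 0)"
      unfolding N_def by (rule C1_cutoff[OF r(1)[OF cG], of n ?E "c k" k]) blast
  qed
  then obtain \<eta> D where \<eta>: "\<And>k. C1_on n ?E (\<eta> k) (D k)" "\<And>k x. 0 \<le> \<eta> k x" "\<And>k x. \<eta> k x \<le> 1"
      "\<And>k x. N (c k) x \<le> (r (c k))\<^sup>2 \<Longrightarrow> \<eta> k x = 1" "\<And>k x. N (c k) x \<ge> 2 * (r (c k))\<^sup>2 \<Longrightarrow> \<eta> k x = 0"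
    by metis
  define S where "S k = {x \<in> ?E. N (c k) x \<le> 2 * (r (c k))\<^sup>2}" for k
  \<comment> \<open>Twice the radius \<open>r (c k)\<close> exceeds sqrt 2 times it, which is the
    radius of \<open>S k\<close>.\<close>
  define R where "R k = Max (insert 0 ((\<lambda>i. \<bar>c k i\<bar>) ` {..<n})) + 2 * r (c k)" for k
  show thesis
  proof (rule that[of \<eta> D S R "\<lambda>k. F (c k) \<inter> ?E"])
    show "S k \<subseteq> G" for k using r(2)[OF cG] by (auto simp: S_def)
    have "?E - S k = {x. N (c k) x > 2 * (r (c k))\<^sup>2} \<inter> ?E" for k by (auto simp: S_def)
    moreover have "open {x. N (c k) x > 2 * (r (c k))\<^sup>2}" for k
      by (intro open_Collect_less contN continuous_intros)
    ultimately show "openin (Euclidean_space n) (?E - S k)" for k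
      unfolding openin_Euclidean_space_iff by blast
    show "\<eta> k x = 0" if "x \<in> ?E - S k" for k x using that by (intro \<eta>(5)) (auto simp: S_def)
    show "\<bar>x i\<bar> \<le> R k" if "x \<in> S k" "i < n" for k x i
    proof -
      have "N (c k) x \<le> (2 * r (c k))\<^sup>2"
        using that order_trans[of "N (c k) x" "2 * (r (c k))\<^sup>2" "4 * (r (c k))\<^sup>2"]
        by (simp add: S_def power_mult_distrib)
      then have "\<bar>x i - c k i\<bar> \<le> 2 * r (c k)" using Nle r(1)[OF cG] that(2) by (simp add: less_imp_le)
      moreover have "\<bar>c k i\<bar> \<le> Max (insert 0 ((\<lambda>i. \<bar>c k i\<bar>) ` {..<n}))" using that(2) by (intro Max_ge) auto
      ultimately show ?thesis unfolding R_def by linarith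
    qed
    show "openin (Euclidean_space n) (F (c k) \<inter> ?E)" for k
      using openF openin_Euclidean_space_iff by blast
    show "\<eta> k x = 1" if "x \<in> F (c k) \<inter> ?E" for k x using that by (intro \<eta>(4)) (auto simp: F_def)
    show "G \<subseteq> (\<Union>k. F (c k) \<inter> ?E)" using cov openin_subset[OF G(1)] by auto
  qed (fact \<eta>)+
qed

text \<open>Near the boundary of G, f may be wild, and mollifying it there would use values outside
  G. So f is cut into C^1 pieces \<open>u k\<close> living on bounded closed subsets of G, each
  mollified at its own scale with error \<epsilon> / 2^(k+1), as in the proof of the Meyers-Serrin
  theorem.\<close>

theorem C1_smooth_approx:
  assumes G: "openin (Euclidean_space n) G" and f: "Ck_on n 1 G f" and \<epsilon>: "\<epsilon> > 0"
  obtains g where "smooth_on n G g" "\<And>x. x \<in> G \<Longrightarrow> \<bar>g x - f x\<bar> \<le> \<epsilon>"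
    "\<And>x i. x \<in> G \<Longrightarrow> i < n \<Longrightarrow> \<bar>partial_deriv i g x - partial_deriv i f x\<bar> \<le> \<epsilon>"
proof (cases "G = {}")
  case True
  have "Ck_on n k {} f" for k f by (induction k arbitrary: f) auto
  then show thesis using that[of f] True by (auto simp: smooth_on_def)
next
  case False
  let ?E = "topspace (Euclidean_space n)"
  have GE: "G \<subseteq> ?E" using openin_subset[OF G] .
  have f1: "C1_on n G f (\<lambda>i. partial_deriv i f)" using f Ck_on_1_iff by blast
  obtain \<eta> D S B R where \<eta>: "\<And>k::nat. C1_on n ?E (\<eta> k) (D k)"
    "\<And>k x. 0 \<le> \<eta> k x" "\<And>k x. \<eta> k x \<le> 1"
    and S: "\<And>k. S k \<subseteq> G" "\<And>k. openin (Euclidean_space n) (?E - S k)"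
    "\<And>k x. x \<in> ?E - S k \<Longrightarrow> \<eta> k x = 0" "\<And>k x i. x \<in> S k \<Longrightarrow> i < n \<Longrightarrow> \<bar>x i\<bar> \<le> R k"
    and B: "\<And>k. openin (Euclidean_space n) (B k)" "\<And>k x. x \<in> B k \<Longrightarrow> \<eta> k x = 1" "G \<subseteq> (\<Union>k. B k)"
    using cutoff_cover[OF G False] by (smt (verit, best))
  \<comment> \<open>A partition of unity: the sums telescope, and local finiteness is automatic because all \<open>\<zeta> k\<close> with
    \<open>k > m\<close> vanish on \<open>B m\<close>. The mollified pieces keep it because \<open>e k\<close> tends to \<open>0\<close>.\<close>
  define \<zeta> where "\<zeta> k x = \<eta> k x * (\<Prod>j<k. 1 - \<eta> j x)" for k x
  define u where "u k x = (if x \<in> G then \<zeta> k x * f x else 0)" for k x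
  have \<zeta>_sum: "(\<Sum>k<m. \<zeta> k x) = 1 - (\<Prod>j<m. 1 - \<eta> j x)" for m x
    by (induction m) (auto simp: \<zeta>_def algebra_simps)
  have \<zeta>C1: "\<exists>Z. C1_on n ?E (\<zeta> k) Z" for k
  proof -
    have "\<exists>Z. C1_on n ?E (\<lambda>x. 1 - \<eta> j x) Z" for j
      using C1_on_add[OF C1_on_const[of n ?E 1] C1_on_cmult[OF \<eta>(1)[of j], of "-1"]] by auto
    then have "\<exists>Z. C1_on n ?E (\<lambda>x. \<Prod>j<k. 1 - \<eta> j x) Z"
      by (intro C1_on_prod[of _ n ?E "\<lambda>j x. 1 - \<eta> j x"])
    then obtain Z where "C1_on n ?E (\<lambda>x. \<Prod>j<k. 1 - \<eta> j x) Z" by blast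
    from C1_on_mult[OF \<eta>(1)[of k] this] show ?thesis by (auto simp: \<zeta>_def[abs_def])
  qed
  have "\<exists>Du. C1_on n ?E (u k) Du" for k
  proof -
    obtain Z where Z: "C1_on n ?E (\<zeta> k) Z" using \<zeta>C1 by blast
    \<comment> \<open>Given on the whole space at once: product rule on G, zero elsewhere. It is
      verified on G and on the complement of \<open>S k\<close>, two relatively open sets that cover
      the space.\<close>
    define Du where "Du i x = (if x \<in> G then Z i x * f x + \<zeta> k x * partial_deriv i f x else 0)" for i x
    have onG: "C1_on n G (u k) Du"
    proof (rule C1_on_cong[OF G])
      show "C1_on n G (\<lambda>x. \<zeta> k x * f x) Du"
        by (rule C1_on_D_cong[OF C1_on_mult[OF C1_on_subset[OF Z GE] f1]]) (auto simp: Du_def)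
    qed (auto simp: u_def)
    have off: "C1_on n (?E - S k) (u k) Du"
    proof (rule C1_on_cong[OF S(2)])
      have z: "C1_on n (?E - S k) (\<zeta> k) (\<lambda>i x. 0)"
        by (rule C1_on_cong[OF S(2) _ C1_on_const[of _ _ 0]]) (auto simp: \<zeta>_def S(3))
      \<comment> \<open>On this open set \<open>\<zeta> k\<close> is identically zero, so its
        derivatives vanish too.\<close>
      have "Z i x = 0" if "i < n" "x \<in> ?E - S k" for i x
        using C1_onD(3)[OF z that] C1_onD(3)[OF Z that(1)] that(2) DERIV_unique by blast
      then show "C1_on n (?E - S k) (\<lambda>_. 0) Du"
        by (intro C1_on_D_cong[OF C1_on_const]) (auto simp: Du_def \<zeta>_def S(3))
      show "0 = u k x" if "x \<in> ?E - S k" for x using that by (simp add: u_def \<zeta>_def S(3))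
    qed
    have "C1_on n ?E (u k) Du"
    proof (rule C1_on_local)
      fix x assume "x \<in> ?E"
      then show "\<exists>U. openin (Euclidean_space n) U \<and> x \<in> U \<and> C1_on n U (u k) Du"
        using onG off G S(1,2) by (cases "x \<in> G") blast+
    qed simp
    then show ?thesis by blast
  qed
  then obtain Du where Du: "\<And>k. C1_on n ?E (u k) (Du k)" by metis
  have usupp: "u k x = 0" if "x \<in> ?E" "j < n" "\<bar>x j\<bar> > R k" for k x j
    using S(3)[of x k] S(4)[of x k j] that by (fastforce simp: u_def \<zeta>_def)
  define e where "e k = \<epsilon> * (1/2) ^ Suc k" for k
  have e: "e k > 0" for k using \<epsilon> by (simp add: e_def)
  have "\<exists>g D'. (\<forall>m. Ck_on n m ?E g) \<and> C1_on n ?E g D' \<and> (\<forall>x\<in>?E. \<bar>g x - u k x\<bar> \<le> e k) \<and>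
      (\<forall>x\<in>?E. \<forall>i<n. \<bar>D' i x - Du k i x\<bar> \<le> e k) \<and>
      (\<forall>x\<in>?E. (\<forall>y\<in>?E. (\<forall>j<n. \<bar>y j - x j\<bar> \<le> e k) \<longrightarrow> u k y = 0) \<longrightarrow> g x = 0)" for k
    by (rule C1_mollify[OF Du[of k] usupp[of _ _ k] e[of k]], assumption+) blast
  then obtain g D' where g: "\<And>k m. Ck_on n m ?E (g k)" "\<And>k. C1_on n ?E (g k) (D' k)"
      "\<And>k x. x \<in> ?E \<Longrightarrow> \<bar>g k x - u k x\<bar> \<le> e k"
      "\<And>k x i. x \<in> ?E \<Longrightarrow> i < n \<Longrightarrow> \<bar>D' k i x - Du k i x\<bar> \<le> e k"
      "\<And>k x. x \<in> ?E \<Longrightarrow> (\<forall>y\<in>?E. (\<forall>j<n. \<bar>y j - x j\<bar> \<le> e k) \<longrightarrow> u k y = 0) \<Longrightarrow> g k x = 0"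
    by metis
  have e_sum: "(\<Sum>k<M. e k) \<le> \<epsilon>" for M
  proof -
    have "(\<Sum>k<M. e k) = \<epsilon> * (1 - (1/2) ^ M)"
      by (induction M) (auto simp: e_def field_simps)
    then show ?thesis using \<epsilon> by (simp add: mult_left_le)
  qed
  have e_lim: "e \<longlonglongrightarrow> 0"
    unfolding e_def[abs_def]
    using tendsto_mult[OF tendsto_const LIMSEQ_Suc[OF LIMSEQ_power_zero[of "1/2::real"]], of \<epsilon>] by simp
  have loc: "\<exists>U M. openin (Euclidean_space n) U \<and> x \<in> U \<and> U \<subseteq> G \<and>
      (\<forall>z\<in>U. (\<forall>k\<ge>M. g k z = 0) \<and> f z = (\<Sum>k<M. u k z))" if x: "x \<in> G" for x
  proof -
    obtain m where m: "x \<in> B m" using B(3) x by blast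
    obtain r where r: "r > 0" "\<And>y. y \<in> ?E \<Longrightarrow> (\<And>i. i < n \<Longrightarrow> \<bar>y i - x i\<bar> \<le> r) \<Longrightarrow> y \<in> B m"
      using openin_contains_box[OF B(1) m] by blast
    obtain M0 where M0: "\<And>k. k \<ge> M0 \<Longrightarrow> e k < r / 2"
      using order_tendstoD(2)[OF e_lim, of "r / 2"] r(1) unfolding eventually_sequentially by auto
    \<comment> \<open>From \<open>M0\<close> on, mollification spreads a piece by less than r/2;
      beyond m, the product in \<open>\<zeta> k\<close> contains the factor 1 -
      \<open>\<eta> m\<close>.\<close>
    define M where "M = max M0 (Suc m)"
    define U where "U = (\<Inter>i<n. {y. \<bar>y i - x i\<bar> < r / 2}) \<inter> G"
    have op: "open (\<Inter>i<n. {y. \<bar>y i - x i\<bar> < r / 2})"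
      by (intro open_INT open_Collect_less ballI continuous_intros
          continuous_on_product_then_coordinatewise[OF continuous_on_id]) auto
    obtain V where V: "open V" "G = V \<inter> ?E" using G openin_Euclidean_space_iff by auto
    have "openin (Euclidean_space n) U"
      unfolding openin_Euclidean_space_iff
      by (rule exI[of _ "(\<Inter>i<n. {y. \<bar>y i - x i\<bar> < r / 2}) \<inter> V"])
        (use op V in \<open>auto simp: U_def\<close>)
    moreover have "x \<in> U" using x r(1) by (auto simp: U_def)
    moreover have "g k z = 0" if z: "z \<in> U" and k: "k \<ge> M" for z k
    proof (rule g(5))
      show "z \<in> ?E" using z GE by (auto simp: U_def)
      show "\<forall>y\<in>?E. (\<forall>j<n. \<bar>y j - z j\<bar> \<le> e k) \<longrightarrow> u k y = 0"
      proof (intro ballI impI)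
        fix y assume y: "y \<in> ?E" "\<forall>j<n. \<bar>y j - z j\<bar> \<le> e k"
        have "\<bar>y i - x i\<bar> \<le> r" if "i < n" for i
        proof -
          have "\<bar>y i - z i\<bar> < r / 2" using y(2) that M0[of k] k by (force simp: M_def)
          moreover have "\<bar>z i - x i\<bar> < r / 2" using z that by (auto simp: U_def)
          ultimately show ?thesis by linarith
        qed
        then have "\<eta> m y = 1" using r(2)[OF y(1)] B(2) by blast
        moreover have "m < k" using k by (simp add: M_def)
        ultimately have "(\<Prod>j<k. 1 - \<eta> j y) = 0" by (intro prod_zero) auto
        then show "u k y = 0" by (simp add: u_def \<zeta>_def)
      qed
    qed
    moreover have "f z = (\<Sum>k<M. u k z)" if z: "z \<in> U" for z
    proof -
      have zG: "z \<in> G" using z by (simp add: U_def)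
      have "z \<in> B m" using zG GE z r(1) by (intro r(2)) (force simp: U_def)+
      then have "\<eta> m z = 1" by (rule B(2))
      moreover have "m < M" by (simp add: M_def)
      ultimately have "(\<Prod>j<M. 1 - \<eta> j z) = 0" by (intro prod_zero) auto
      then have "(\<Sum>k<M. \<zeta> k z) = 1" using \<zeta>_sum by simp
      then show ?thesis using zG by (simp add: u_def sum_distrib_right[symmetric])
    qed
    ultimately show ?thesis by (intro exI[of _ U] exI[of _ M]) (auto simp: U_def)
  qed
  define h where "h x = (\<Sum>k. g k x)" for x
  have h_loc: "h z = (\<Sum>k<M. g k z)" if "\<forall>k\<ge>M. g k z = 0" for z M
    unfolding h_def using that by (intro suminf_finite) auto
  show thesis
  proof (rule that[of h])
    show "smooth_on n G h"
      unfolding smooth_on_def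
    proof (intro allI Ck_on_local[OF GE])
      fix k x assume "x \<in> G"
      from loc[OF this] obtain U M where U: "openin (Euclidean_space n) U" "x \<in> U" "U \<subseteq> G"
        "\<forall>z\<in>U. (\<forall>k\<ge>M. g k z = 0) \<and> f z = (\<Sum>k<M. u k z)" by blast
      have "Ck_on n k U (\<lambda>z. \<Sum>k<M. g k z)"
        by (rule Ck_on_sum[OF U(1) finite_lessThan Ck_on_mono[OF g(1)]]) (use U(3) GE in blast)
      then have "Ck_on n k U h" by (rule Ck_on_cong[OF U(1), rotated]) (use h_loc U(4) in auto)
      then show "\<exists>U. openin (Euclidean_space n) U \<and> x \<in> U \<and> Ck_on n k U h" using U by blast
    qed
    fix x assume xG: "x \<in> G"
    then have xE: "x \<in> ?E" using GE by blast
    obtain U M where U: "openin (Euclidean_space n) U" "x \<in> U" "U \<subseteq> G"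
      "\<forall>z\<in>U. (\<forall>k\<ge>M. g k z = 0) \<and> f z = (\<Sum>k<M. u k z)" using loc[OF xG] by blast
    have UE: "U \<subseteq> ?E" using U GE by blast
    have "\<bar>h x - f x\<bar> = \<bar>\<Sum>k<M. g k x - u k x\<bar>"
      using U h_loc[of M x] by (simp add: sum_subtractf)
    also have "\<dots> \<le> (\<Sum>k<M. e k)" by (rule order_trans[OF sum_abs sum_mono]) (use g(3)[OF xE] in auto)
    finally show "\<bar>h x - f x\<bar> \<le> \<epsilon>" using e_sum[of M] by linarith
    fix i assume i: "i < n"
    have hC: "C1_on n U h (\<lambda>i x. \<Sum>k<M. D' k i x)"
      by (rule C1_on_cong[OF U(1) _ C1_on_sum[OF C1_on_subset[OF g(2) UE]]]) (use h_loc U(4) in auto)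
    have fC: "C1_on n U f (\<lambda>i x. \<Sum>k<M. Du k i x)"
      by (rule C1_on_cong[OF U(1) _ C1_on_sum[OF C1_on_subset[OF Du UE]]]) (use U(4) in auto)
    have "\<bar>partial_deriv i h x - partial_deriv i f x\<bar> = \<bar>\<Sum>k<M. D' k i x - Du k i x\<bar>"
      using C1_on_partial_deriv[OF hC i U(2)] C1_on_partial_deriv[OF fC i U(2)] by (simp add: sum_subtractf)
    also have "\<dots> \<le> (\<Sum>k<M. e k)" by (rule order_trans[OF sum_abs sum_mono]) (use g(4)[OF xE i] in auto)
    finally show "\<bar>partial_deriv i h x - partial_deriv i f x\<bar> \<le> \<epsilon>" using e_sum[of M] by linarith
  qed
qed

section \<open>Consequences of the logarithmic Sobolev inequality\<close>

lemma abs_arctan_le: "\<bar>arctan t\<bar> \<le> \<bar>t\<bar>"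
proof -
  have pos: "arctan t \<le> t" if "t \<ge> 0" for t
  proof -
    have "0 - arctan 0 \<le> t - arctan t"
    proof (rule DERIV_nonneg_imp_nondecreasing[OF that])
      fix x :: real
      have "((\<lambda>x. x - arctan x) has_real_derivative 1 - inverse (1 + x\<^sup>2)) (at x)"
        by (auto intro!: derivative_eq_intros)
      moreover have "0 \<le> 1 - inverse (1 + x\<^sup>2)" by (simp add: inverse_le_1_iff)
      ultimately show "\<exists>y. ((\<lambda>x. x - arctan x) has_real_derivative y) (at x) \<and> 0 \<le> y" by blast
    qed
    then show ?thesis by simp
  qed
  show ?thesis
  proof (cases "t \<ge> 0")
    case False
    then show ?thesis using pos[of "-t"] by (simp add: arctan_minus)
  qed (use pos in auto)
qed

text \<open>A differentiable replacement for cutting off at height K: bounded, increasing, with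
  derivative in (0, 1], and convergent to the identity as K grows. Truncation therefore never
  enlarges a gradient.\<close>

definition trunc :: "real \<Rightarrow> real \<Rightarrow> real" where
  "trunc K y = K * arctan (y / K)"

lemma trunc_has_derivative:
  "K > 0 \<Longrightarrow> (trunc K has_real_derivative inverse (1 + (y / K)\<^sup>2)) (at y)"
  unfolding trunc_def by (auto intro!: derivative_eq_intros)

lemma abs_trunc_le: "K > 0 \<Longrightarrow> \<bar>trunc K y\<bar> \<le> \<bar>y\<bar>"
  using mult_left_mono[OF abs_arctan_le[of "y / K"], of K] by (simp add: trunc_def abs_mult)

lemma abs_trunc_le_const: "K > 0 \<Longrightarrow> \<bar>trunc K y\<bar> \<le> 2 * K"
proof -
  assume K: "K > 0"
  have "\<bar>arctan (y / K)\<bar> \<le> 2" using arctan_bounded[of "y / K"] pi_half_less_two by linarith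
  from mult_left_mono[OF this, of K] K show ?thesis by (simp add: trunc_def abs_mult)
qed

lemma trunc_mono: "K > 0 \<Longrightarrow> x \<le> y \<Longrightarrow> trunc K x \<le> trunc K y"
  by (simp add: trunc_def arctan_le_iff divide_right_mono)

lemma trunc_tendsto: "(\<lambda>j. trunc (real (Suc j)) y) \<longlonglongrightarrow> y"
proof (cases "y = 0")
  case True then show ?thesis by (simp add: trunc_def)
next
  case False
  have "((\<lambda>h. arctan h / h) \<longlongrightarrow> 1) (at 0)"
    using DERIV_arctan[of 0] by (simp add: DERIV_def)
  moreover have "filterlim (\<lambda>j. y / real (Suc j)) (at 0) sequentially"
    unfolding filterlim_at
    using False tendsto_mult[OF tendsto_const LIMSEQ_inverse_real_of_nat, of y]
    by (auto simp: divide_inverse)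
  ultimately have "(\<lambda>j. arctan (y / real (Suc j)) / (y / real (Suc j))) \<longlonglongrightarrow> 1"
    by (rule filterlim_compose)
  from tendsto_mult[OF tendsto_const this, of y]
  show ?thesis using False by (simp add: trunc_def mult_ac)
qed

text \<open>Weighted arithmetic-geometric mean inequality with weights q - 1 and 1; after division
  by a^q it is Bernoulli's inequality at b/a.\<close>

lemma young_nat:
  fixes a b :: real
  assumes "a \<ge> 0" "b \<ge> 0" "q \<ge> 1"
  shows "real q * (a ^ (q - 1) * b) \<le> real (q - 1) * a ^ q + b ^ q"
proof (cases "a = 0")
  case True
  then show ?thesis using assms by (cases "q = 1") (auto simp: power_0_left)
next
  case False
  then have a: "a > 0" using assms by simp
  define t where "t = b / a"
  have "1 + real q * (t - 1) \<le> (1 + (t - 1)) ^ q"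
    by (rule Bernoulli_inequality) (use assms a in \<open>simp add: t_def\<close>)
  then have "real q * t \<le> real (q - 1) + t ^ q"
    using assms(3) by (simp add: algebra_simps of_nat_diff)
  from mult_left_mono[OF this, of "a ^ q"] a
  have "a ^ q * (real q * t) \<le> real (q - 1) * a ^ q + (a * t) ^ q"
    by (simp add: algebra_simps power_mult_distrib)
  moreover have "a ^ q * t = a ^ (q - 1) * b"
    using a assms(3) by (simp add: t_def power_eq_if)
  moreover have "a * t = b" using a by (simp add: t_def)
  ultimately show ?thesis by (simp add: mult.left_commute)
qed

context prob_space
begin

text \<open>The tangent line inequality \<open>ln y \<le> y - 1\<close>, applied to \<open>y = b / \<bar>h\<bar>\<close> and optimised in \<open>b\<close>.\<close>

lemma Ent_square_lower_bound:
  assumes h: "h \<in> borel_measurable M" "\<And>x. x \<in> space M \<Longrightarrow> \<bar>h x\<bar> \<le> K"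
    and a: "a > 0" "expectation (\<lambda>x. \<bar>h x\<bar>) \<le> a" and F: "expectation (\<lambda>x. (h x)\<^sup>2) > 0"
  shows "expectation (\<lambda>x. (h x)\<^sup>2) * ln (expectation (\<lambda>x. (h x)\<^sup>2) / a\<^sup>2) \<le> Ent M (\<lambda>x. (h x)\<^sup>2)"
proof -
  note [measurable] = h(1)
  define F where "F = expectation (\<lambda>x. (h x)\<^sup>2)"
  \<comment> \<open>The maximiser of the bound F ln b^2 - 2 a b + 2 F.\<close>
  define b where "b = F / a"
  have F0: "F > 0" using F by (simp add: F_def)
  have b: "b > 0" using F0 a by (simp add: b_def)
  have sq: "(h x)\<^sup>2 \<le> K\<^sup>2" if "x \<in> space M" for x
    using power_mono[OF h(2)[OF that], of 2] by simp
  have i1: "integrable M (\<lambda>x. \<bar>h x\<bar>)"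
    by (rule integrable_const_bound[where B=K]) (use h(2) in auto)
  have i2: "integrable M (\<lambda>x. (h x)\<^sup>2)"
    by (rule integrable_const_bound[where B="K\<^sup>2"]) (use sq in auto)
  have i3: "integrable M (\<lambda>x. (h x)\<^sup>2 * ln ((h x)\<^sup>2))"
  proof (rule integrable_const_bound[where B="1 + K\<^sup>2 * K\<^sup>2"])
    \<comment> \<open>The function t ln t lies between -1 and t^2, so a bounded h yields a bounded
      integrand.\<close>
    have bd: "\<bar>t * ln t\<bar> \<le> 1 + L * L" if t: "0 \<le> t" "t \<le> L" for t L :: real
    proof (cases "t = 0")
      case False
      then have t0: "t > 0" using t by simp
      have "t * ln t \<le> t * t" using ln_le_minus_one[OF t0] t0 by (intro mult_left_mono) auto
      also have "\<dots> \<le> L * L" using t by (intro mult_mono) auto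
      finally have 1: "t * ln t \<le> L * L" .
      have "ln (1 / t) \<le> 1 / t - 1" using t0 by (intro ln_le_minus_one) auto
      then have "t * (1 - 1 / t) \<le> t * ln t" using t0 by (intro mult_left_mono) (auto simp: ln_div)
      then have "-1 \<le> t * ln t" using t0 by (simp add: right_diff_distrib)
      then show ?thesis using 1 by (simp add: abs_le_iff) (smt (verit) mult_nonneg_nonneg t)
    qed simp
    show "AE x in M. norm ((h x)\<^sup>2 * ln ((h x)\<^sup>2)) \<le> 1 + K\<^sup>2 * K\<^sup>2"
      using bd[OF _ sq] by auto
  qed simp
  have pos: "y\<^sup>2 * (2 * ln b) - 2 * b * y + 2 * y\<^sup>2 \<le> y\<^sup>2 * (2 * ln y)" if "y > 0" for y
  proof -
    have "ln (b / y) \<le> b / y - 1" using b that by (intro ln_le_minus_one) auto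
    then have "ln b - ln y \<le> b / y - 1" using b that by (simp add: ln_div)
    then have "2 * y\<^sup>2 * (ln b - ln y) \<le> 2 * y\<^sup>2 * (b / y - 1)" by (intro mult_left_mono) auto
    moreover have "y\<^sup>2 * (b / y) = b * y" using that by (simp add: power2_eq_square)
    ultimately show ?thesis by (simp add: right_diff_distrib)
  qed
  have pt: "(h x)\<^sup>2 * ln (b\<^sup>2) - 2 * b * \<bar>h x\<bar> + 2 * (h x)\<^sup>2 \<le> (h x)\<^sup>2 * ln ((h x)\<^sup>2)" for x
  proof (cases "h x = 0")
    case False
    have "ln ((h x)\<^sup>2) = 2 * ln \<bar>h x\<bar>"
      using False ln_realpow[of "\<bar>h x\<bar>" 2] by simp
    moreover have "ln (b\<^sup>2) = 2 * ln b" using b ln_realpow[of b 2] by simp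
    ultimately show ?thesis using pos[of "\<bar>h x\<bar>"] False by simp
  qed simp
  have "F * ln (b\<^sup>2) - 2 * b * a + 2 * F \<le> F * ln (b\<^sup>2) - 2 * b * expectation (\<lambda>x. \<bar>h x\<bar>) + 2 * F"
    using b a by simp
  also have "\<dots> = expectation (\<lambda>x. (h x)\<^sup>2 * ln (b\<^sup>2) - 2 * b * \<bar>h x\<bar> + 2 * (h x)\<^sup>2)"
    using i1 i2 by (simp add: F_def)
  also have "\<dots> \<le> expectation (\<lambda>x. (h x)\<^sup>2 * ln ((h x)\<^sup>2))"
    by (rule integral_mono) (use i1 i2 i3 pt in auto)
  \<comment> \<open>By the choice of b the terms -2 b a and 2 F cancel.\<close>
  finally have "F * ln (b\<^sup>2) \<le> expectation (\<lambda>x. (h x)\<^sup>2 * ln ((h x)\<^sup>2))"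
    using a by (simp add: b_def)
  moreover have "F * ln (F / a\<^sup>2) = F * ln (b\<^sup>2) - F * ln F"
    using F0 a by (simp add: b_def ln_div ln_realpow ln_mult power_divide algebra_simps)
  ultimately show ?thesis by (simp add: Ent_def F_def)
qed

end

lemma grad_norm_nonneg: "grad_norm n f x \<ge> 0"
  by (simp add: grad_norm_def)

lemma C1_on_grad_norm:
  "C1_on n U f D \<Longrightarrow> x \<in> U \<Longrightarrow> grad_norm n f x = L2_set (\<lambda>i. D i x) {..<n}"
  unfolding grad_norm_def by (intro L2_set_cong) (auto simp: C1_on_partial_deriv)

lemma C1_on_imp_Ck_on: 
  assumes "C1_on n U f D" shows "Ck_on n 1 U f"
  unfolding Ck_on_1_iff by (rule C1_on_D_cong[OF assms]) (simp add: C1_on_partial_deriv[OF assms])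

lemma C1_on_trunc:
  assumes "Ck_on n 1 G g" "K > 0"
  shows "Ck_on n 1 G (\<lambda>x. trunc K (g x))"
    "x \<in> G \<Longrightarrow> grad_norm n (\<lambda>x. trunc K (g x)) x \<le> grad_norm n g x"
proof -
  have cont: "continuous_on UNIV (\<lambda>t. inverse (1 + (t / K)\<^sup>2))"
    by (intro continuous_intros) (use assms(2) in \<open>auto simp: add_nonneg_eq_0_iff\<close>)
  note C = C1_on_compose[OF assms(1)[unfolded Ck_on_1_iff] trunc_has_derivative[OF assms(2)] cont]
  show "Ck_on n 1 G (\<lambda>x. trunc K (g x))" by (rule C1_on_imp_Ck_on[OF C])
  assume x: "x \<in> G"
  have le1: "0 \<le> inverse (1 + (g x / K)\<^sup>2)" "inverse (1 + (g x / K)\<^sup>2) \<le> 1"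
    by (auto simp: inverse_le_1_iff)
  have "grad_norm n (\<lambda>x. trunc K (g x)) x = inverse (1 + (g x / K)\<^sup>2) * grad_norm n g x"
    using C1_on_grad_norm[OF C x] le1(1) by (simp add: grad_norm_def L2_set_right_distrib)
  also have "\<dots> \<le> grad_norm n g x" using le1 by (intro mult_left_le_one_le grad_norm_nonneg)
  finally show "grad_norm n (\<lambda>x. trunc K (g x)) x \<le> grad_norm n g x" .
qed

locale log_Sobolev_space = prob_space M for M :: "(nat \<Rightarrow> real) measure" +
  fixes n :: nat and G :: "(nat \<Rightarrow> real) set" and s :: real
  assumes openin_G: "openin (Euclidean_space n) G" and sets_M: "sets M = sets (restrict_space borel G)"
    and s_pos: "s > 0" and lsi: "log_Sobolev n G M s"
begin

lemma space_M: "space M = G"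
  using sets_eq_imp_space_eq[OF sets_M] by (simp add: space_restrict_space)

lemma continuous_on_measurable: "continuous_on G f \<Longrightarrow> f \<in> borel_measurable M" for f :: "_ \<Rightarrow> real"
  using borel_measurable_continuous_on_restrict[of G f] measurable_cong_sets[OF sets_M refl] by blast

lemma grad_norm_measurable:
  assumes "Ck_on n 1 G f" shows "grad_norm n f \<in> borel_measurable M"
proof (rule continuous_on_measurable)
  show "continuous_on G (grad_norm n f)"
    unfolding grad_norm_def L2_set_def
    using assms[unfolded Ck_on_1_iff] by (intro continuous_intros) (auto dest: C1_onD(2))
qed

lemma lsi_smooth:
  assumes h: "smooth_on n G h" "\<And>x. x \<in> G \<Longrightarrow> \<bar>h x\<bar> \<le> K"
    and a: "a > 0" "expectation (\<lambda>x. \<bar>h x\<bar>) \<le> a" and F: "expectation (\<lambda>x. (h x)\<^sup>2) > 0"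
    and W: "(\<integral>\<^sup>+ x. ennreal ((grad_norm n h x)\<^sup>2) \<partial>M) \<le> ennreal W" "W \<ge> 0"
  shows "expectation (\<lambda>x. (h x)\<^sup>2) * ln (expectation (\<lambda>x. (h x)\<^sup>2) / a\<^sup>2) \<le> 2 * s * W"
proof -
  have "continuous_on G h" using h(1) Ck_on_continuous unfolding smooth_on_def by blast
  then have meas: "h \<in> borel_measurable M" by (rule continuous_on_measurable)
  have "bounded (h ` G)" using h(2) by (auto simp: bounded_iff)
  then have "ennreal (Ent M (\<lambda>x. (h x)\<^sup>2)) \<le> ennreal (2 * s) * (\<integral>\<^sup>+ x. ennreal ((grad_norm n h x)\<^sup>2) \<partial>M)"
    using lsi h(1) unfolding log_Sobolev_def by blast
  also have "\<dots> \<le> ennreal (2 * s) * ennreal W" using W(1) by (rule mult_left_mono) simp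
  also have "\<dots> = ennreal (2 * s * W)" using s_pos W(2) by (simp add: ennreal_mult)
  finally have "Ent M (\<lambda>x. (h x)\<^sup>2) \<le> 2 * s * W" using s_pos W(2) by simp
  then show ?thesis
    using Ent_square_lower_bound[OF meas _ a F, of K] h(2) space_M by auto
qed

text \<open>Uniform closeness of the functions controls F and E|h|, uniform closeness of the
  derivatives controls the energy; convergence of entropies is never invoked. Along the
  approximation the bound a is relaxed to a + \<epsilon>.\<close>

lemma lsi_C1:
  assumes h: "Ck_on n 1 G h" "\<And>x. x \<in> G \<Longrightarrow> \<bar>h x\<bar> \<le> K"
    and a: "a > 0" "expectation (\<lambda>x. \<bar>h x\<bar>) \<le> a" and F: "expectation (\<lambda>x. (h x)\<^sup>2) > 0"
    and W: "(\<integral>\<^sup>+ x. ennreal ((grad_norm n h x)\<^sup>2) \<partial>M) \<le> ennreal W" "W \<ge> 0"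
  shows "expectation (\<lambda>x. (h x)\<^sup>2) * ln (expectation (\<lambda>x. (h x)\<^sup>2) / a\<^sup>2) \<le> 2 * s * W"
proof -
  define \<epsilon> where "\<epsilon> j = inverse (real (Suc j))" for j
  have \<epsilon>: "\<epsilon> j > 0" "\<epsilon> j \<le> 1" for j by (auto simp: \<epsilon>_def field_simps)
  have \<epsilon>_lim: "\<epsilon> \<longlonglongrightarrow> 0" unfolding \<epsilon>_def[abs_def] by (rule LIMSEQ_inverse_real_of_nat)
  have "\<exists>g. smooth_on n G g \<and> (\<forall>x\<in>G. \<bar>g x - h x\<bar> \<le> \<epsilon> j) \<and>
      (\<forall>x\<in>G. \<forall>i<n. \<bar>partial_deriv i g x - partial_deriv i h x\<bar> \<le> \<epsilon> j)" for j
    by (rule C1_smooth_approx[OF openin_G h(1) \<epsilon>(1)[of j]]) blast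
  then obtain g where g: "\<And>j. smooth_on n G (g j)" "\<And>j x. x \<in> G \<Longrightarrow> \<bar>g j x - h x\<bar> \<le> \<epsilon> j"
      "\<And>j x i. x \<in> G \<Longrightarrow> i < n \<Longrightarrow> \<bar>partial_deriv i (g j) x - partial_deriv i h x\<bar> \<le> \<epsilon> j" by metis
  have hm [measurable]: "h \<in> borel_measurable M"
    by (rule continuous_on_measurable[OF Ck_on_continuous[OF h(1)]])
  have gm [measurable]: "g j \<in> borel_measurable M" for j
    using g(1) Ck_on_continuous unfolding smooth_on_def by (blast intro: continuous_on_measurable)
  have wm [measurable]: "grad_norm n h \<in> borel_measurable M" by (rule grad_norm_measurable[OF h(1)])
  have gK: "\<bar>g j x\<bar> \<le> K + 1" if "x \<in> G" for j x
    using g(2)[OF that, of j] h(2)[OF that] \<epsilon>(2)[of j] by linarith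
  have ih: "integrable M (\<lambda>x. \<bar>h x\<bar>)" 
    by (rule integrable_const_bound[where B=K]) (use h(2) space_M in auto)
  have ig: "integrable M (\<lambda>x. \<bar>g j x\<bar>)" for j
    by (rule integrable_const_bound[where B="K + 1"]) (use gK space_M in auto)
  define Fj where "Fj j = expectation (\<lambda>x. (g j x)\<^sup>2)" for j
  define F0 where "F0 = expectation (\<lambda>x. (h x)\<^sup>2)"
  have Flim: "Fj \<longlonglongrightarrow> F0"
    unfolding Fj_def[abs_def] F0_def
  proof (rule integral_dominated_convergence[where w="\<lambda>_. (K + 1)\<^sup>2"])
    show "AE x in M. (\<lambda>j. (g j x)\<^sup>2) \<longlonglongrightarrow> (h x)\<^sup>2"
    proof (rule AE_I2)
      fix x assume "x \<in> space M"
      then have "(\<lambda>j. g j x - h x) \<longlonglongrightarrow> 0"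
        by (intro Lim_null_comparison[OF _ \<epsilon>_lim]) (use g(2) space_M in auto)
      then show "(\<lambda>j. (g j x)\<^sup>2) \<longlonglongrightarrow> (h x)\<^sup>2" by (intro tendsto_power) (rule LIM_zero_cancel)
    qed
    show "AE x in M. norm ((g j x)\<^sup>2) \<le> (K + 1)\<^sup>2" for j
      using power_mono[OF gK, of _ j 2] space_M by auto
  qed auto
  have ea: "expectation (\<lambda>x. \<bar>g j x\<bar>) \<le> a + \<epsilon> j" for j
  proof -
    have "expectation (\<lambda>x. \<bar>g j x\<bar>) \<le> expectation (\<lambda>x. \<bar>h x\<bar> + \<epsilon> j)"
      by (rule integral_mono) (use ig ih g(2)[of _ j] space_M in \<open>force+\<close>)
    also have "\<dots> = expectation (\<lambda>x. \<bar>h x\<bar>) + \<epsilon> j" using ih by (simp add: prob_space)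
    finally show ?thesis using a(2) by simp
  qed
  \<comment> \<open>From (w + e)^2 \<le> (1 + e) w^2 + e + e^2 with e = n \<epsilon>, a consequence
    of 2 w \<le> w^2 + 1.\<close>
  define Wj where "Wj j = (1 + real n * \<epsilon> j) * W + (real n * \<epsilon> j + (real n * \<epsilon> j)\<^sup>2)" for j
  have Wj0: "Wj j \<ge> 0" for j using W(2) \<epsilon>(1)[of j] by (simp add: Wj_def)
  have Wlim: "Wj \<longlonglongrightarrow> W"
    unfolding Wj_def[abs_def] by (rule tendsto_eq_intros \<epsilon>_lim refl)+ simp
  have gradj: "(grad_norm n (g j) x)\<^sup>2 \<le> (1 + real n * \<epsilon> j) * (grad_norm n h x)\<^sup>2 + (real n * \<epsilon> j + (real n * \<epsilon> j)\<^sup>2)"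
    if x: "x \<in> G" for j x
  proof -
    let ?w = "grad_norm n h x" and ?e = "real n * \<epsilon> j"
    have "grad_norm n (g j) x = L2_set (\<lambda>i. partial_deriv i h x + (partial_deriv i (g j) x - partial_deriv i h x)) {..<n}"
      by (simp add: grad_norm_def)
    also have "\<dots> \<le> ?w + L2_set (\<lambda>i. partial_deriv i (g j) x - partial_deriv i h x) {..<n}"
      unfolding grad_norm_def by (rule L2_set_triangle_ineq)
    also have "L2_set (\<lambda>i. partial_deriv i (g j) x - partial_deriv i h x) {..<n} \<le>
        (\<Sum>i<n. \<bar>partial_deriv i (g j) x - partial_deriv i h x\<bar>)" by (rule L2_set_le_sum_abs)
    also have "\<dots> \<le> (\<Sum>i<n. \<epsilon> j)" using g(3)[OF x] by (intro sum_mono) auto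
    finally have "grad_norm n (g j) x \<le> ?w + ?e" by simp
    then have "(grad_norm n (g j) x)\<^sup>2 \<le> (?w + ?e)\<^sup>2" by (intro power_mono grad_norm_nonneg)
    also have "\<dots> = ?w\<^sup>2 + ?e * (2 * ?w * 1) + ?e\<^sup>2" by (simp add: power2_sum)
    also have "\<dots> \<le> ?w\<^sup>2 + ?e * (?w\<^sup>2 + 1\<^sup>2) + ?e\<^sup>2"
      using sum_squares_bound[of ?w 1] \<epsilon>(1)[of j] by (intro add_mono mult_left_mono) auto
    finally show ?thesis by (simp add: algebra_simps)
  qed
  have EW: "(\<integral>\<^sup>+ x. ennreal ((grad_norm n (g j) x)\<^sup>2) \<partial>M) \<le> ennreal (Wj j)" for j
  proof -
    have e: "real n * \<epsilon> j \<ge> 0" using \<epsilon>(1)[of j] by simp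
    have "(\<integral>\<^sup>+ x. ennreal ((grad_norm n (g j) x)\<^sup>2) \<partial>M) \<le>
        (\<integral>\<^sup>+ x. ennreal (1 + real n * \<epsilon> j) * ennreal ((grad_norm n h x)\<^sup>2) + ennreal (real n * \<epsilon> j + (real n * \<epsilon> j)\<^sup>2) \<partial>M)"
      by (rule nn_integral_mono)
        (use gradj e space_M in \<open>simp add: ennreal_mult[symmetric] ennreal_plus[symmetric] del: ennreal_plus\<close>)
    also have "\<dots> = ennreal (1 + real n * \<epsilon> j) * (\<integral>\<^sup>+ x. ennreal ((grad_norm n h x)\<^sup>2) \<partial>M) + ennreal (real n * \<epsilon> j + (real n * \<epsilon> j)\<^sup>2)"
      by (simp add: nn_integral_add nn_integral_cmult emeasure_space_1)
    also have "\<dots> \<le> ennreal (1 + real n * \<epsilon> j) * ennreal W + ennreal (real n * \<epsilon> j + (real n * \<epsilon> j)\<^sup>2)"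
      using W(1) by (intro add_mono mult_left_mono) auto
    also have "\<dots> = ennreal (Wj j)"
      using e W(2) by (simp add: Wj_def ennreal_mult[symmetric] ennreal_plus[symmetric] del: ennreal_plus)
    finally show ?thesis .
  qed
  have F0: "F0 > 0" using F by (simp add: F0_def)
  \<comment> \<open>The smooth inequality asks for a positive second moment, which the approximants
    are known to have only eventually.\<close>
  have "\<forall>\<^sub>F j in sequentially. Fj j * ln (Fj j / (a + \<epsilon> j)\<^sup>2) \<le> 2 * s * Wj j"
    using order_tendstoD(1)[OF Flim F0]
  proof eventually_elim
    case (elim j)
    show ?case
      using lsi_smooth[OF g(1) gK _ ea _ EW Wj0, of j] elim a(1) \<epsilon>(1)[of j] by (simp add: Fj_def)
  qed
  moreover have "(\<lambda>j. Fj j * ln (Fj j / (a + \<epsilon> j)\<^sup>2)) \<longlonglongrightarrow> F0 * ln (F0 / (a + 0)\<^sup>2)"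
    by (intro tendsto_intros Flim \<epsilon>_lim) (use a F0 in auto)
  moreover have "(\<lambda>j. 2 * s * Wj j) \<longlonglongrightarrow> 2 * s * W" by (intro tendsto_intros Wlim)
  ultimately show ?thesis
    using tendsto_le[OF sequentially_bot] by (fastforce simp: F0_def)
qed

text \<open>For centred g and h = 1 + \<epsilon> g \<ge> 0 one has E|h| = 1 and F = 1 + \<epsilon>^2
  V, and F ln F \<ge> F - 1 already gives the claim, with no limit in \<epsilon>. Bounding the
  entropy from below in this way costs a factor 2 against the classical constant s.\<close>

lemma poincare_bounded:
  assumes g: "Ck_on n 1 G g" "\<And>x. x \<in> G \<Longrightarrow> \<bar>g x\<bar> \<le> K" "expectation g = 0"
    and W: "(\<integral>\<^sup>+ x. ennreal ((grad_norm n g x)\<^sup>2) \<partial>M) \<le> ennreal W" "W \<ge> 0"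
  shows "expectation (\<lambda>x. (g x)\<^sup>2) \<le> 2 * s * W"
proof -
  have [measurable]: "g \<in> borel_measurable M"
    by (rule continuous_on_measurable[OF Ck_on_continuous[OF g(1)]])
  have [measurable]: "grad_norm n g \<in> borel_measurable M" by (rule grad_norm_measurable[OF g(1)])
  \<comment> \<open>Small enough that |\<epsilon> g| \<le> 1, so that h \<ge> 0.\<close>
  define \<epsilon> where "\<epsilon> = 1 / (\<bar>K\<bar> + 1)"
  have \<epsilon>: "\<epsilon> > 0" by (simp add: \<epsilon>_def)
  define h where "h x = 1 + \<epsilon> * g x" for x
  have \<epsilon>g: "\<bar>\<epsilon> * g x\<bar> \<le> 1" if "x \<in> G" for x
    using g(2)[OF that] by (simp add: \<epsilon>_def abs_mult field_simps)
  have ig: "integrable M g"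
    by (rule integrable_const_bound[where B=K]) (use g(2) space_M in auto)
  have ig2: "integrable M (\<lambda>x. (g x)\<^sup>2)"
    by (rule integrable_const_bound[where B="K\<^sup>2"])
      (use power_mono[OF g(2), of _ 2] space_M in auto)
  have hC: "C1_on n G h (\<lambda>i x. \<epsilon> * partial_deriv i g x)"
    unfolding h_def
    by (rule C1_on_D_cong[OF C1_on_add[OF C1_on_const C1_on_cmult[OF g(1)[unfolded Ck_on_1_iff]]]]) simp
  have grad: "(grad_norm n h x)\<^sup>2 = \<epsilon>\<^sup>2 * (grad_norm n g x)\<^sup>2" if "x \<in> G" for x
    using C1_on_grad_norm[OF hC that] \<epsilon>
    by (simp add: grad_norm_def L2_set_right_distrib[symmetric] power_mult_distrib)
  have nn: "(\<integral>\<^sup>+ x. ennreal ((grad_norm n h x)\<^sup>2) \<partial>M) \<le> ennreal (\<epsilon>\<^sup>2 * W)"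
  proof -
    have "(\<integral>\<^sup>+ x. ennreal ((grad_norm n h x)\<^sup>2) \<partial>M) = (\<integral>\<^sup>+ x. ennreal (\<epsilon>\<^sup>2) * ennreal ((grad_norm n g x)\<^sup>2) \<partial>M)"
      by (rule nn_integral_cong) (use grad space_M in \<open>simp add: ennreal_mult\<close>)
    also have "\<dots> = ennreal (\<epsilon>\<^sup>2) * (\<integral>\<^sup>+ x. ennreal ((grad_norm n g x)\<^sup>2) \<partial>M)" by (simp add: nn_integral_cmult)
    also have "\<dots> \<le> ennreal (\<epsilon>\<^sup>2) * ennreal W" using W(1) by (rule mult_left_mono) simp
    finally show ?thesis using W(2) by (simp add: ennreal_mult)
  qed
  define V where "V = expectation (\<lambda>x. (g x)\<^sup>2)"
  have V0: "V \<ge> 0" by (simp add: V_def)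
  have F: "expectation (\<lambda>x. (h x)\<^sup>2) = 1 + \<epsilon>\<^sup>2 * V"
  proof -
    have "expectation (\<lambda>x. (h x)\<^sup>2) = expectation (\<lambda>x. 1 + 2 * \<epsilon> * g x + \<epsilon>\<^sup>2 * (g x)\<^sup>2)"
      by (rule Bochner_Integration.integral_cong) (simp_all add: h_def power2_sum power_mult_distrib)
    also have "\<dots> = 1 + \<epsilon>\<^sup>2 * V" using ig ig2 g(3) by (simp add: prob_space V_def)
    finally show ?thesis .
  qed
  have a: "expectation (\<lambda>x. \<bar>h x\<bar>) = 1"
  proof -
    have "expectation (\<lambda>x. \<bar>h x\<bar>) = expectation (\<lambda>x. 1 + \<epsilon> * g x)"
    proof (rule Bochner_Integration.integral_cong)
      show "\<bar>h x\<bar> = 1 + \<epsilon> * g x" if "x \<in> space M" for x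
        using \<epsilon>g[of x] that space_M by (auto simp: h_def)
    qed simp
    also have "\<dots> = 1" using ig g(3) by (simp add: prob_space)
    finally show ?thesis .
  qed
  have hK: "\<bar>h x\<bar> \<le> 2" if "x \<in> G" for x using \<epsilon>g[OF that] by (auto simp: h_def)
  have F1: "1 + \<epsilon>\<^sup>2 * V > 0" using V0 by (simp add: add_pos_nonneg)
  have "(1 + \<epsilon>\<^sup>2 * V) * ln (1 + \<epsilon>\<^sup>2 * V) \<le> 2 * s * (\<epsilon>\<^sup>2 * W)"
    using lsi_C1[OF C1_on_imp_Ck_on[OF hC] hK, of 1 "\<epsilon>\<^sup>2 * W"] a F F1 nn W(2) by simp
  moreover have "\<epsilon>\<^sup>2 * V \<le> (1 + \<epsilon>\<^sup>2 * V) * ln (1 + \<epsilon>\<^sup>2 * V)"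
  proof -
    have "ln (1 / (1 + \<epsilon>\<^sup>2 * V)) \<le> 1 / (1 + \<epsilon>\<^sup>2 * V) - 1" using F1 by (intro ln_le_minus_one) auto
    then have "1 - 1 / (1 + \<epsilon>\<^sup>2 * V) \<le> ln (1 + \<epsilon>\<^sup>2 * V)" using F1 by (simp add: ln_div)
    from mult_left_mono[OF this less_imp_le[OF F1]] F1 show ?thesis by (simp add: right_diff_distrib)
  qed
  ultimately have "\<epsilon>\<^sup>2 * V \<le> \<epsilon>\<^sup>2 * (2 * s * W)" by (simp add: mult_ac)
  then show ?thesis using \<epsilon> by (simp add: V_def)
qed

text \<open>Square integrability of g is part of the conclusion, so g is truncated and recentred;
  the means \<open>m j\<close> of the truncations tend to 0 by dominated convergence, and Fatou's
  lemma returns to g.\<close>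

lemma poincare:
  assumes g: "Ck_on n 1 G g" "has_bochner_integral M g 0"
    and W: "(\<integral>\<^sup>+ x. ennreal ((grad_norm n g x)\<^sup>2) \<partial>M) \<le> ennreal W" "W \<ge> 0"
  shows "(\<integral>\<^sup>+ x. ennreal ((g x)\<^sup>2) \<partial>M) \<le> ennreal (2 * s * W)"
proof -
  have ig: "integrable M g" and g0: "expectation g = 0"
    using g(2) by (auto simp: has_bochner_integral_iff)
  define T where "T j x = trunc (real (Suc j)) (g x)" for j x
  have TC: "Ck_on n 1 G (T j)" and Tgrad: "x \<in> G \<Longrightarrow> grad_norm n (T j) x \<le> grad_norm n g x" for j x
    using C1_on_trunc[OF g(1), of "real (Suc j)"] by (auto simp: T_def[abs_def])
  have Tm [measurable]: "T j \<in> borel_measurable M" for j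
    by (rule continuous_on_measurable[OF Ck_on_continuous[OF TC]])
  have [measurable]: "g \<in> borel_measurable M" using ig by auto
  have Tb: "\<bar>T j x\<bar> \<le> 2 * real (Suc j)" for j x unfolding T_def by (rule abs_trunc_le_const) simp
  have iT: "integrable M (T j)" for j by (rule integrable_const_bound[OF _ Tm]) (use Tb in auto)
  have iT2: "integrable M (\<lambda>x. (T j x)\<^sup>2)" for j
    by (rule integrable_const_bound[where B="(2 * real (Suc j))\<^sup>2"])
      (use power_mono[OF Tb[of j], of _ 2] in auto)
  define m where "m j = expectation (T j)" for j
  have mlim: "m \<longlonglongrightarrow> 0"
    unfolding m_def[abs_def] g0[symmetric]
  proof (rule integral_dominated_convergence[where w="\<lambda>x. \<bar>g x\<bar>"])
    show "AE x in M. (\<lambda>j. T j x) \<longlonglongrightarrow> g x" unfolding T_def by (intro AE_I2 trunc_tendsto)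
    show "AE x in M. norm (T j x) \<le> \<bar>g x\<bar>" for j unfolding T_def using abs_trunc_le by auto
  qed (use ig in auto)
  have bd: "expectation (\<lambda>x. (T j x)\<^sup>2) \<le> 2 * s * W + (m j)\<^sup>2" for j
  proof -
    have C: "C1_on n G (\<lambda>x. T j x + (- m j)) (\<lambda>i x. partial_deriv i (T j) x)"
      by (rule C1_on_D_cong[OF C1_on_add[OF TC[unfolded Ck_on_1_iff] C1_on_const]]) simp
    have "expectation (\<lambda>x. (T j x + (- m j))\<^sup>2) \<le> 2 * s * W"
    proof (rule poincare_bounded[OF C1_on_imp_Ck_on[OF C] _ _ _ W(2)])
      show "\<bar>T j x + - m j\<bar> \<le> 2 * real (Suc j) + \<bar>m j\<bar>" for x using Tb[of j x] by linarith
      show "expectation (\<lambda>x. T j x + - m j) = 0" using iT by (simp add: m_def prob_space)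
      have "(\<integral>\<^sup>+ x. ennreal ((grad_norm n (\<lambda>x. T j x + - m j) x)\<^sup>2) \<partial>M) \<le> (\<integral>\<^sup>+ x. ennreal ((grad_norm n g x)\<^sup>2) \<partial>M)"
      proof (rule nn_integral_mono)
        fix x assume "x \<in> space M"
        then have x: "x \<in> G" by (simp add: space_M)
        have "grad_norm n (\<lambda>x. T j x + - m j) x = grad_norm n (T j) x"
          using C1_on_grad_norm[OF C x] by (simp add: grad_norm_def)
        then show "ennreal ((grad_norm n (\<lambda>x. T j x + - m j) x)\<^sup>2) \<le> ennreal ((grad_norm n g x)\<^sup>2)"
          using power_mono[OF Tgrad[OF x] grad_norm_nonneg, of j 2] by (simp add: ennreal_leI)
      qed
      also note W(1)
      finally show "(\<integral>\<^sup>+ x. ennreal ((grad_norm n (\<lambda>x. T j x + - m j) x)\<^sup>2) \<partial>M) \<le> ennreal W" .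
    qed
    moreover have "expectation (\<lambda>x. (T j x + (- m j))\<^sup>2) = expectation (\<lambda>x. (T j x)\<^sup>2) - (m j)\<^sup>2"
    proof -
      have "expectation (\<lambda>x. (T j x + (- m j))\<^sup>2) = expectation (\<lambda>x. (T j x)\<^sup>2 - 2 * m j * T j x + (m j)\<^sup>2)"
        by (rule Bochner_Integration.integral_cong) (simp_all add: power2_diff)
      also have "\<dots> = expectation (\<lambda>x. (T j x)\<^sup>2) - 2 * m j * m j + (m j)\<^sup>2"
        using iT iT2 by (simp add: prob_space m_def)
      finally show ?thesis by (simp add: power2_eq_square)
    qed
    ultimately show ?thesis by simp
  qed
  have "(\<integral>\<^sup>+ x. ennreal ((g x)\<^sup>2) \<partial>M) = (\<integral>\<^sup>+ x. liminf (\<lambda>j. ennreal ((T j x)\<^sup>2)) \<partial>M)"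
  proof (rule nn_integral_cong)
    fix x
    have "(\<lambda>j. ennreal ((T j x)\<^sup>2)) \<longlonglongrightarrow> ennreal ((g x)\<^sup>2)"
      unfolding T_def by (intro tendsto_ennrealI tendsto_power trunc_tendsto)
    from lim_imp_Liminf[OF sequentially_bot this]
    show "ennreal ((g x)\<^sup>2) = liminf (\<lambda>j. ennreal ((T j x)\<^sup>2))" by simp
  qed
  also have "\<dots> \<le> liminf (\<lambda>j. \<integral>\<^sup>+ x. ennreal ((T j x)\<^sup>2) \<partial>M)" by (rule nn_integral_liminf) measurable
  also have "\<dots> \<le> liminf (\<lambda>j. ennreal (2 * s * W + (m j)\<^sup>2))"
    by (rule Liminf_mono, rule always_eventually, rule allI, subst nn_integral_eq_integral)
      (use iT2 bd in \<open>auto intro: ennreal_leI\<close>)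
  also have "\<dots> = ennreal (2 * s * W)"
  proof (rule lim_imp_Liminf[OF sequentially_bot])
    have "(\<lambda>j. 2 * s * W + (m j)\<^sup>2) \<longlonglongrightarrow> 2 * s * W + 0\<^sup>2" by (intro tendsto_intros mlim)
    then show "(\<lambda>j. ennreal (2 * s * W + (m j)\<^sup>2)) \<longlonglongrightarrow> ennreal (2 * s * W)"
      by (intro tendsto_ennrealI) simp
  qed
  finally show ?thesis .
qed

text \<open>A and B bound the squared norms of g in L^q and of \<Gamma> in L^(2q). With h = g^q and
  x0 = F^(1/q) the inequality reads q x0^(q-1) x0 ln(x0/A) \<le> 2 s E|grad h|^2, and Young's
  inequality bounds the energy by q x0^(q-1) q B. Dividing, and using x0 - A \<le> x0 ln(x0/A),
  gives x0 \<le> A + 2 s q B.\<close>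

lemma moment_step:
  assumes g: "Ck_on n 1 G g" "\<And>x. x \<in> G \<Longrightarrow> \<bar>g x\<bar> \<le> K"
    and \<Gamma>: "\<Gamma> \<in> borel_measurable M" "\<And>x. x \<in> G \<Longrightarrow> grad_norm n g x \<le> \<Gamma> x"
    and q: "q \<ge> 1" and A: "A > 0" "(expectation (\<lambda>x. \<bar>g x\<bar> ^ q))\<^sup>2 \<le> A ^ q"
    and B: "B > 0" "(\<integral>\<^sup>+ x. ennreal (\<Gamma> x ^ (2 * q)) \<partial>M) \<le> ennreal (B ^ q)"
  shows "expectation (\<lambda>x. g x ^ (2 * q)) \<le> (A + 2 * s * real q * B) ^ q"
\<comment> \<open>The negated claim makes F positive, so that division by x0 and F is
  possible.\<close>
proof (rule ccontr)
  note [measurable] = \<Gamma>(1)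
  have [measurable]: "g \<in> borel_measurable M"
    by (rule continuous_on_measurable[OF Ck_on_continuous[OF g(1)]])
  define F where "F = expectation (\<lambda>x. g x ^ (2 * q))"
  define A' where "A' = A + 2 * s * real q * B"
  have A': "A' > A" "A' > 0" using A B q s_pos by (auto simp: A'_def add_pos_pos)
  assume "\<not> expectation (\<lambda>x. g x ^ (2 * q)) \<le> (A + 2 * s * real q * B) ^ q"
  then have FA: "F > A' ^ q" by (simp add: F_def A'_def)
  then have F0: "F > 0" using A' by (meson less_trans zero_less_power)
  define x0 where "x0 = root q F"
  have x0: "x0 > 0" "x0 ^ q = F" using F0 q by (auto simp: x0_def)
  have xA: "x0 > A'" using FA x0 by (metis power_less_imp_less_base less_imp_le)
  have iF: "integrable M (\<lambda>x. g x ^ (2 * q))"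
    by (rule integrable_const_bound[where B="K ^ (2 * q)"])
      (use power_mono[OF g(2), of _ "2 * q"] space_M in \<open>auto simp: power_abs\<close>)
  define h where "h x = g x ^ q" for x
  have pw: "((\<lambda>t. t ^ q) has_real_derivative real q * t ^ (q - 1)) (at t)" for t :: real
    using DERIV_pow[of q t] by simp
  have cont: "continuous_on UNIV (\<lambda>t::real. real q * t ^ (q - 1))" by (intro continuous_intros)
  have hC: "C1_on n G h (\<lambda>i x. real q * g x ^ (q - 1) * partial_deriv i g x)"
    unfolding h_def by (rule C1_on_compose[OF g(1)[unfolded Ck_on_1_iff] pw cont])
  have hK: "\<bar>h x\<bar> \<le> K ^ q" if "x \<in> G" for x
    unfolding h_def power_abs using g(2)[OF that] by (intro power_mono) auto
  define a where "a = sqrt (A ^ q)"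
  have a: "a > 0" "a\<^sup>2 = A ^ q" using A by (auto simp: a_def)
  have ha: "expectation (\<lambda>x. \<bar>h x\<bar>) \<le> a"
    unfolding a_def h_def power_abs by (rule real_le_rsqrt) (rule A(2))
  have Fh: "expectation (\<lambda>x. (h x)\<^sup>2) = F"
    by (simp add: h_def F_def power_mult[symmetric] mult.commute)
  \<comment> \<open>The energy density is at most c q (g^2/x0)^(q-1) (\<Gamma>^2/B); the q-th powers
    of the two quotients have mean 1 and at most 1.\<close>
  define c where "c = real q * x0 ^ (q - 1) * B"
  have c: "c \<ge> 0" using x0 B by (simp add: c_def)
  have pt: "(grad_norm n h x)\<^sup>2 \<le> c * (real (q - 1) / F * g x ^ (2 * q) + 1 / B ^ q * \<Gamma> x ^ (2 * q))"
    if x: "x \<in> G" for x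
  proof -
    have "grad_norm n h x = \<bar>real q * g x ^ (q - 1)\<bar> * grad_norm n g x"
      unfolding C1_on_grad_norm[OF hC x] unfolding grad_norm_def
      by (simp add: L2_set_def power_mult_distrib sum_distrib_left[symmetric] real_sqrt_mult abs_mult)
    then have "(grad_norm n h x)\<^sup>2 = (real q)\<^sup>2 * ((g x)\<^sup>2) ^ (q - 1) * (grad_norm n g x)\<^sup>2"
      by (simp add: power_mult_distrib power_mult[symmetric] mult.commute)
    also have "\<dots> \<le> (real q)\<^sup>2 * ((g x)\<^sup>2) ^ (q - 1) * (\<Gamma> x)\<^sup>2"
      using \<Gamma>(2)[OF x] by (intro mult_left_mono power_mono grad_norm_nonneg) auto
    also have "\<dots> = c * (real q * (((g x)\<^sup>2 / x0) ^ (q - 1) * ((\<Gamma> x)\<^sup>2 / B)))"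
      using x0 B by (simp add: c_def power_divide power2_eq_square field_simps)
    also have "\<dots> \<le> c * (real (q - 1) * ((g x)\<^sup>2 / x0) ^ q + ((\<Gamma> x)\<^sup>2 / B) ^ q)"
      using x0 B by (intro mult_left_mono young_nat q c) auto
    also have "\<dots> = c * (real (q - 1) / F * g x ^ (2 * q) + 1 / B ^ q * \<Gamma> x ^ (2 * q))"
      using x0(2) by (simp add: power_divide power_mult[symmetric])
    finally show ?thesis .
  qed
  have \<Gamma>0: "\<Gamma> x ^ (2 * q) \<ge> 0" "g x ^ (2 * q) \<ge> 0" for x by (simp_all add: power_mult)
  have "(\<integral>\<^sup>+ x. ennreal ((grad_norm n h x)\<^sup>2) \<partial>M) \<le>
      (\<integral>\<^sup>+ x. ennreal c * (ennreal (real (q - 1) / F) * ennreal (g x ^ (2 * q)) + ennreal (1 / B ^ q) * ennreal (\<Gamma> x ^ (2 * q))) \<partial>M)"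
    by (rule nn_integral_mono)
      (use pt F0 B(1) \<Gamma>0 c space_M in \<open>simp add: ennreal_mult[symmetric] ennreal_plus[symmetric] del: ennreal_plus\<close>)
  also have "\<dots> = ennreal c * (ennreal (real (q - 1) / F) * (\<integral>\<^sup>+ x. ennreal (g x ^ (2 * q)) \<partial>M)
      + ennreal (1 / B ^ q) * (\<integral>\<^sup>+ x. ennreal (\<Gamma> x ^ (2 * q)) \<partial>M))"
    by (simp add: nn_integral_add nn_integral_cmult)
  also have "\<dots> \<le> ennreal c * (ennreal (real (q - 1) / F) * ennreal F + ennreal (1 / B ^ q) * ennreal (B ^ q))"
    using B(2) nn_integral_eq_integral[OF iF] \<Gamma>0 by (intro mult_left_mono add_mono) (auto simp: F_def)
  also have "\<dots> = ennreal (c * (real (q - 1) / F * F + 1 / B ^ q * B ^ q))"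
  proof -
    have "ennreal (real (q - 1) / F) * ennreal F = ennreal (real (q - 1) / F * F)"
      "ennreal (1 / B ^ q) * ennreal (B ^ q) = ennreal (1 / B ^ q * B ^ q)"
      using F0 B(1) by (intro ennreal_mult[symmetric]; simp)+
    moreover have "ennreal c * (ennreal u + ennreal v) = ennreal (c * (u + v))" if "u \<ge> 0" "v \<ge> 0" for u v
      using c that by (simp add: ennreal_mult)
    moreover have "real (q - 1) / F * F \<ge> 0" "1 / B ^ q * B ^ q \<ge> 0" using F0 B(1) by auto
    ultimately show ?thesis by presburger
  qed
  also have "real (q - 1) / F * F + 1 / B ^ q * B ^ q = real q"
    using F0 B(1) q by (simp add: of_nat_diff)
  finally have W: "(\<integral>\<^sup>+ x. ennreal ((grad_norm n h x)\<^sup>2) \<partial>M) \<le> ennreal (c * real q)" .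
  have "F * ln (F / a\<^sup>2) \<le> 2 * s * (c * real q)"
    using lsi_C1[OF C1_on_imp_Ck_on[OF hC] hK a(1) ha _ W] Fh F0 c by auto
  moreover have "F * ln (F / a\<^sup>2) = (real q * x0 ^ (q - 1)) * (x0 * ln (x0 / A))"
  proof -
    have "F / a\<^sup>2 = (x0 / A) ^ q" using a x0 by (simp add: power_divide)
    moreover have "F = x0 ^ (q - 1) * x0" using x0(2) q by (simp add: power_eq_if mult.commute)
    ultimately show ?thesis using x0 A by (simp add: ln_realpow)
  qed
  moreover have "2 * s * (c * real q) = (real q * x0 ^ (q - 1)) * (2 * s * real q * B)"
    by (simp add: c_def)
  ultimately have "x0 * ln (x0 / A) \<le> 2 * s * real q * B"
    using x0 q by simp
  moreover have "x0 - A \<le> x0 * ln (x0 / A)"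
  proof -
    have "ln (A / x0) \<le> A / x0 - 1" using A x0 by (intro ln_le_minus_one) auto
    then have "1 - A / x0 \<le> ln (x0 / A)" using A x0 by (simp add: ln_div)
    from mult_left_mono[OF this, of x0] x0 show ?thesis by (simp add: right_diff_distrib)
  qed
  ultimately show False using xA by (simp add: A'_def)
qed

end

section \<open>Derivative forms and their operator norms\<close>

text \<open>One point is chosen from every basic open set that meets S. Density is phrased by closed
  sets because closed conditions on unit vectors are to be extended; countability makes the supremum
  measurable and a limit of finite maxima.\<close>

lemma countable_dense_subset:
  fixes S :: "'a::second_countable_topology set"
  obtains W where "countable W" "W \<subseteq> S" "\<And>C. closed C \<Longrightarrow> W \<subseteq> C \<Longrightarrow> S \<subseteq> C"
proof -
  obtain \<B> :: "'a set set" where basis: "countable \<B> \<and> topological_basis \<B>"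
    using ex_countable_basis ..
  then have \<B>: "countable \<B>" "topological_basis \<B>" by simp_all
  define W where "W = (\<lambda>b. SOME x. x \<in> b \<inter> S) ` {b \<in> \<B>. b \<inter> S \<noteq> {}}"
  have pick: "(SOME x. x \<in> b \<inter> S) \<in> b \<inter> S" if "b \<inter> S \<noteq> {}" for b
    using that someI_ex[of "\<lambda>x. x \<in> b \<inter> S"] by blast
  show thesis
  proof
    show "countable W" unfolding W_def using \<B>(1) by auto
    show "W \<subseteq> S" unfolding W_def using pick by auto
    show "S \<subseteq> C" if C: "closed C" "W \<subseteq> C" for C
    proof
      fix x assume x: "x \<in> S"
      show "x \<in> C"
      proof (rule ccontr)
        assume "x \<notin> C"
        then obtain b where b: "b \<in> \<B>" "x \<in> b" "b \<subseteq> - C"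
          using topological_basisE[OF \<B>(2), of "- C" x] C(1) by auto
        then have "b \<inter> S \<noteq> {}" using x by auto
        then show False using b pick[of b] C(2) by (auto simp: W_def)
      qed
    qed
  qed
qed

definition unit_vectors :: "nat \<Rightarrow> (nat \<Rightarrow> real) set" where
  "unit_vectors n = {v \<in> topspace (Euclidean_space n). L2_set v {..<n} = 1}"

lemma first_basis_vector_unit: "n \<ge> 1 \<Longrightarrow> (\<lambda>i. if i = 0 then 1 else 0) \<in> unit_vectors n"
  by (auto simp: unit_vectors_def topspace_Euclidean_space L2_set_def if_distrib[of "\<lambda>t. t\<^sup>2"] cong: if_cong)

text \<open>Duality of the Euclidean norm: testing against all unit vectors recovers the norm, and
  each test is a closed condition on the vector, so a dense set suffices.\<close>

lemma L2_set_le_if_unit_dense: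
  assumes n: "n \<ge> 1" and W: "\<And>C. closed C \<Longrightarrow> W \<subseteq> C \<Longrightarrow> unit_vectors n \<subseteq> C"
    and le: "\<And>w. w \<in> W \<Longrightarrow> (\<Sum>i<n. w i * y i) \<le> c"
  shows "L2_set y {..<n} \<le> c"
proof -
  have "closed {w. (\<Sum>i<n. w i * y i) \<le> c}"
    by (intro closed_Collect_le continuous_intros continuous_on_product_then_coordinatewise[OF continuous_on_id])
  then have all: "(\<Sum>i<n. w i * y i) \<le> c" if "w \<in> unit_vectors n" for w
    using W[of "{w. (\<Sum>i<n. w i * y i) \<le> c}"] le that by blast
  define L where "L = L2_set y {..<n}"
  show ?thesis
  proof (cases "L = 0")
    case True
    \<comment> \<open>For y = 0 the claim is c \<ge> 0; it follows from testing any unit vector,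
      which exists because n \<ge> 1.\<close>
    note first_basis_vector_unit[OF n]
    moreover have "y i = 0" if "i < n" for i
      using True that unfolding L_def by (simp add: L2_set_eq_0_iff)
    ultimately show ?thesis using all True by (fastforce simp: L_def)
  next
    case False
    then have L: "L > 0" using L2_set_nonneg[of y "{..<n}"] unfolding L_def by linarith
    define w where "w i = (if i < n then y i / L else 0)" for i
    have sq: "(\<Sum>i<n. (y i)\<^sup>2) = L\<^sup>2" unfolding L_def L2_set_def by (simp add: sum_nonneg)
    have "L2_set w {..<n} = sqrt ((\<Sum>i<n. (y i)\<^sup>2) / L\<^sup>2)"
      by (simp add: L2_set_def w_def power_divide sum_divide_distrib)
    also have "\<dots> = 1" using L sq by simp
    finally have "w \<in> unit_vectors n" by (simp add: unit_vectors_def topspace_Euclidean_space w_def)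
    from all[OF this] have "(\<Sum>i<n. (y i)\<^sup>2) / L \<le> c"
      by (simp add: w_def power2_eq_square sum_divide_distrib)
    then show ?thesis using L sq by (simp add: power2_eq_square L_def)
  qed
qed

section \<open>Multi-indices and multilinear derivative forms\<close>

lemma finite_multi_indices [simp]: "finite (multi_indices n k)"
  unfolding multi_indices_def by (rule finite_lists_length_eq) simp

lemma multi_indices_0 [simp]: "multi_indices n 0 = {[]}"
  by (auto simp: multi_indices_def)

lemma sum_multi_indices_Suc:
  "(\<Sum>is\<in>multi_indices n (Suc k). F is) = (\<Sum>i<n. \<Sum>is\<in>multi_indices n k. F (i # is))"
proof -
  have eq: "multi_indices n (Suc k) = (\<lambda>(i, is). i # is) ` ({..<n} \<times> multi_indices n k)"
    by (force simp: multi_indices_def length_Suc_conv)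
  have "inj_on (\<lambda>(i, is). i # is) ({..<n} \<times> multi_indices n k)" by (auto intro!: inj_onI)
  then show ?thesis
    unfolding eq by (subst sum.reindex) (auto simp: sum.cartesian_product case_prod_unfold)
qed

lemma sum_prod_squares_unit:
  assumes "\<And>j. j < k \<Longrightarrow> L2_set (v j) {..<n} = 1"
  shows "(\<Sum>is\<in>multi_indices n k. (\<Prod>j<k. v j (is ! j))\<^sup>2) = 1"
  using assms
proof (induction k arbitrary: v)
  case 0
  then show ?case by simp
next
  case (Suc k)
  have 1: "(\<Sum>i<n. (v 0 i)\<^sup>2) = 1"
    using Suc.prems[of 0] by (simp add: L2_set_def)
  have "(\<Sum>is\<in>multi_indices n (Suc k). (\<Prod>j<Suc k. v j (is ! j))\<^sup>2) =
      (\<Sum>i<n. \<Sum>is\<in>multi_indices n k. (v 0 i)\<^sup>2 * (\<Prod>j<k. v (Suc j) (is ! j))\<^sup>2)"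
    unfolding sum_multi_indices_Suc prod.lessThan_Suc_shift by (simp add: power_mult_distrib)
  also have "\<dots> = (\<Sum>i<n. (v 0 i)\<^sup>2 * (\<Sum>is\<in>multi_indices n k. (\<Prod>j<k. v (Suc j) (is ! j))\<^sup>2))"
    by (simp add: sum_distrib_left)
  also have "\<dots> = 1" using Suc.IH[of "\<lambda>j. v (Suc j)"] Suc.prems 1 by simp
  finally show ?case .
qed

text \<open>Cauchy-Schwarz: the tensor product of unit vectors has Euclidean norm 1.\<close>

lemma abs_deriv_form_le_HS:
  assumes "\<And>j. j < k \<Longrightarrow> L2_set (v j) {..<n} = 1"
  shows "\<bar>deriv_form n k f x v\<bar> \<le> deriv_HS n k f x"
proof -
  have "\<bar>deriv_form n k f x v\<bar> \<le>
      (\<Sum>is\<in>multi_indices n k. \<bar>iter_partial_deriv is f x\<bar> * \<bar>\<Prod>j<k. v j (is ! j)\<bar>)"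
    unfolding deriv_form_def by (rule order_trans[OF sum_abs]) (simp add: abs_mult)
  also have "\<dots> \<le> L2_set (\<lambda>is. iter_partial_deriv is f x) (multi_indices n k) *
      L2_set (\<lambda>is. \<Prod>j<k. v j (is ! j)) (multi_indices n k)"
    by (rule L2_set_mult_ineq)
  also have "L2_set (\<lambda>is. \<Prod>j<k. v j (is ! j)) (multi_indices n k) = 1"
    using sum_prod_squares_unit[OF assms] by (simp add: L2_set_def)
  finally show ?thesis by (simp add: deriv_HS_def)
qed

text \<open>\<open>deriv_Op\<close> is a supremum of values without absolute values; flipping the
  sign of the first vector, available for d \<ge> 1, makes the bound two-sided.\<close>

lemma abs_deriv_form_le_Op:
  assumes v: "\<And>j. j < d \<Longrightarrow> v j \<in> unit_vectors n" and d: "d \<ge> 1"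
  shows "\<bar>deriv_form n d f x v\<bar> \<le> deriv_Op n d f x"
proof -
  let ?S = "{deriv_form n d f x v | v. \<forall>j<d. v j \<in> topspace (Euclidean_space n) \<and> L2_set (v j) {..<n} = 1}"
  \<comment> \<open>A real \<open>Sup\<close> dominates the values only if they are bounded above;
    the Hilbert-Schmidt norm provides the bound.\<close>
  have bdd: "bdd_above ?S"
    by (rule bdd_aboveI[of _ "deriv_HS n d f x"]) (use abs_deriv_form_le_HS abs_le_D1 in blast)
  have up: "deriv_form n d f x v \<le> deriv_Op n d f x" if "\<And>j. j < d \<Longrightarrow> v j \<in> unit_vectors n" for v
    unfolding deriv_Op_def using that by (intro cSup_upper bdd) (auto simp: unit_vectors_def)
  define v' where "v' j = (if j = 0 then \<lambda>i. - v 0 i else v j)" for j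
  have "deriv_form n d f x v' = - deriv_form n d f x v"
  proof -
    obtain e where e: "d = Suc e" using d by (cases d) auto
    have "(\<Prod>j<d. v' j (is ! j)) = - (\<Prod>j<d. v j (is ! j))" for "is" :: "nat list"
      unfolding e prod.lessThan_Suc_shift by (simp add: v'_def)
    then show ?thesis by (simp add: deriv_form_def sum_negf)
  qed
  moreover have "v' j \<in> unit_vectors n" if "j < d" for j
    using v[OF that] by (auto simp: v'_def unit_vectors_def topspace_Euclidean_space L2_set_def)
  ultimately show ?thesis using up[of v] up[of v'] v by (simp add: abs_le_iff)
qed

lemma iter_partial_deriv_Nil [simp]: "iter_partial_deriv [] f = f"
  and iter_partial_deriv_Cons: "iter_partial_deriv (i # is) f = partial_deriv i (iter_partial_deriv is f)"
  by (simp_all add: iter_partial_deriv_def)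

lemma Ck_on_iter_partial_deriv:
  assumes "Ck_on n d G f" "set is \<subseteq> {..<n}" "length is \<le> d"
  shows "Ck_on n (d - length is) G (iter_partial_deriv is f)"
  using assms(2,3)
proof (induction "is")
  case Nil
  then show ?case using assms(1) by simp
next
  case (Cons i js)
  then have "Ck_on n (Suc (d - length (i # js))) G (iter_partial_deriv js f)"
    by (simp add: Suc_diff_Suc)
  then show ?case using Cons.prems by (simp add: Ck_on_Suc_iff iter_partial_deriv_Cons)
qed

lemma Ck_on_1_mono: "Ck_on n k G f \<Longrightarrow> k \<ge> 1 \<Longrightarrow> Ck_on n 1 G f"
  unfolding Ck_on_1_iff by (cases k) (auto simp: Ck_on_Suc_iff simp del: Ck_on.simps)

text \<open>A smooth substitute for \<open>max \<bar>y\<^sub>i\<bar>\<close>; unlike the sum of exponentials, the mean of \<open>cosh\<close> is at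
  least \<open>1\<close> and yields a nonnegative function that never exceeds the maximum.\<close>

definition soft_max :: "nat \<Rightarrow> real \<Rightarrow> (nat \<Rightarrow> real) \<Rightarrow> real" where
  "soft_max N b y = ln ((\<Sum>i<N. cosh (b * y i)) / real N) / b"

lemma cosh_le_exp_abs: "cosh x \<le> exp \<bar>x :: real\<bar>"
  by (cases "x \<ge> 0") (auto simp: cosh_def)

lemma exp_abs_le_cosh: "exp \<bar>x :: real\<bar> \<le> 2 * cosh x"
  by (cases "x \<ge> 0") (auto simp: cosh_def)

lemma cosh_real_has_derivative: "(cosh has_real_derivative sinh x) (at (x::real))"
  by (auto intro!: derivative_eq_intros)

lemma abs_sinh_le_cosh: "\<bar>sinh x\<bar> \<le> cosh (x :: real)"
  by (simp add: abs_le_iff sinh_def cosh_def)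

text \<open>As cosh x lies between exp|x| / 2 and exp|x|, the mean of N values loses at most a
  factor 2 N, that is ln(2 N) / b after the logarithm.\<close>

lemma soft_max_bounds:
  assumes N: "N \<ge> 1" and b: "b > 0" and le: "\<And>i. i < N \<Longrightarrow> \<bar>y i\<bar> \<le> c"
  shows "0 \<le> soft_max N b y" "soft_max N b y \<le> c"
    "\<And>i. i < N \<Longrightarrow> \<bar>y i\<bar> - ln (2 * real N) / b \<le> soft_max N b y"
proof -
  define S where "S = (\<Sum>i<N. cosh (b * y i)) / real N"
  have "real N * 1 \<le> (\<Sum>i<N. cosh (b * y i))"
    using sum_mono[of "{..<N}" "\<lambda>_. 1" "\<lambda>i. cosh (b * y i)"] cosh_real_ge_1 by simp
  then have S1: "S \<ge> 1" using N by (simp add: S_def field_simps)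
  then show "0 \<le> soft_max N b y" using b by (simp add: soft_max_def S_def[symmetric])
  have "(\<Sum>i<N. cosh (b * y i)) \<le> (\<Sum>i<N. exp (b * c))"
  proof (rule sum_mono)
    fix i assume "i \<in> {..<N}"
    then have "\<bar>b * y i\<bar> \<le> b * c" using le b by (simp add: abs_mult)
    then show "cosh (b * y i) \<le> exp (b * c)" using cosh_le_exp_abs order_trans exp_le_cancel_iff by blast
  qed
  then have "S \<le> exp (b * c)" using N by (simp add: S_def field_simps)
  then have "ln S \<le> b * c" using S1 ln_le_cancel_iff[of S "exp (b * c)"] by simp
  then show "soft_max N b y \<le> c" using b by (simp add: soft_max_def S_def[symmetric] field_simps)
  fix i assume i: "i < N"
  have "exp (b * \<bar>y i\<bar>) = exp \<bar>b * y i\<bar>" using b by (simp add: abs_mult)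
  also have "\<dots> \<le> 2 * cosh (b * y i)" by (rule exp_abs_le_cosh)
  also have "\<dots> \<le> 2 * (\<Sum>i<N. cosh (b * y i))"
    using i by (intro mult_left_mono member_le_sum) (auto intro: cosh_real_nonneg)
  also have "\<dots> = 2 * real N * S" using N by (simp add: S_def)
  finally have "exp (b * \<bar>y i\<bar>) \<le> 2 * real N * S" .
  then have "b * \<bar>y i\<bar> \<le> ln (2 * real N * S)" using S1 N by (subst ln_ge_iff) auto
  also have "\<dots> = ln (2 * real N) + ln S" using S1 N by (subst ln_mult) auto
  finally show "\<bar>y i\<bar> - ln (2 * real N) / b \<le> soft_max N b y"
    using divide_right_mono[of "b * \<bar>y i\<bar>" "ln (2 * real N) + ln S" b] b
    by (simp add: soft_max_def S_def[symmetric] add_divide_distrib)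
qed

lemma L2_set_weighted_le:
  assumes "\<And>a. a \<in> A \<Longrightarrow> L2_set (\<lambda>i. D a i) I \<le> c" "finite A"
  shows "L2_set (\<lambda>i. \<Sum>a\<in>A. w a * D a i) I \<le> (\<Sum>a\<in>A. \<bar>w a\<bar>) * c"
  using assms(2,1)
proof (induction A)
  case empty
  then show ?case by (simp add: L2_set_def)
next
  case (insert a A)
  have "L2_set (\<lambda>i. \<Sum>a\<in>insert a A. w a * D a i) I = L2_set (\<lambda>i. w a * D a i + (\<Sum>a\<in>A. w a * D a i)) I"
    using insert.hyps by simp
  also have "\<dots> \<le> L2_set (\<lambda>i. w a * D a i) I + L2_set (\<lambda>i. \<Sum>a\<in>A. w a * D a i) I"
    by (rule L2_set_triangle_ineq)
  also have "L2_set (\<lambda>i. w a * D a i) I = \<bar>w a\<bar> * L2_set (\<lambda>i. D a i) I"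
    by (simp add: L2_set_def power_mult_distrib sum_distrib_left[symmetric] real_sqrt_mult)
  also have "\<dots> \<le> \<bar>w a\<bar> * c" using insert.prems by (intro mult_left_mono) auto
  finally show ?case using insert by (simp add: distrib_right)
qed

text \<open>The gradient combines the gradients of the h_a with weights sinh(b h_a) / S, whose
  absolute values sum to at most 1 because |sinh| \<le> cosh. A common gradient bound thus survives,
  whatever N and b are.\<close>

lemma soft_max_C1:
  assumes h: "\<And>i. i < N \<Longrightarrow> Ck_on n 1 G (h i)" and N: "N \<ge> 1" and b: "b > 0"
  shows "Ck_on n 1 G (\<lambda>x. soft_max N b (\<lambda>i. h i x))"
    "x \<in> G \<Longrightarrow> (\<And>i. i < N \<Longrightarrow> grad_norm n (h i) x \<le> c) \<Longrightarrow>
      grad_norm n (\<lambda>x. soft_max N b (\<lambda>i. h i x)) x \<le> c"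
proof -
  define S where "S x = (\<Sum>i<N. cosh (b * h i x))" for x
  define w where "w a x = sinh (b * h a x) / S x" for a x
  have S0: "S x > 0" for x
    unfolding S_def using N by (intro sum_pos) (auto simp: cosh_real_pos lessThan_empty_iff)
  have der: "((\<lambda>t. soft_max N b (\<lambda>i. h i (x(j := t)))) has_real_derivative
      (\<Sum>a<N. w a x * partial_deriv j (h a) x)) (at (x j))" if "x \<in> G" "j < n" for x j
  proof -
    have hd: "((\<lambda>t. h i (x(j := t))) has_real_derivative partial_deriv j (h i) x) (at (x j))" if "i < N" for i
      using C1_onD(3)[OF h[OF that, unfolded Ck_on_1_iff] \<open>j < n\<close> \<open>x \<in> G\<close>] .
    have "((\<lambda>t. S (x(j := t))) has_real_derivative
        (\<Sum>i<N. sinh (b * h i x) * (b * partial_deriv j (h i) x))) (at (x j))"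
      unfolding S_def
    proof (rule DERIV_sum)
      fix i assume "i \<in> {..<N}"
      then have i: "i < N" by simp
      show "((\<lambda>t. cosh (b * h i (x(j := t)))) has_real_derivative
          sinh (b * h i x) * (b * partial_deriv j (h i) x)) (at (x j))"
        by (rule DERIV_cong[OF DERIV_chain2[OF cosh_real_has_derivative DERIV_cmult[OF hd[OF i]]]]) simp
    qed
    then have "((\<lambda>t. ln (S (x(j := t)) / real N) / b) has_real_derivative
        (\<Sum>i<N. sinh (b * h i x) * (b * partial_deriv j (h i) x)) / S x / b) (at (x j))"
      using S0[of x] N b by (auto intro!: derivative_eq_intros simp: field_simps)
    also have "(\<Sum>i<N. sinh (b * h i x) * (b * partial_deriv j (h i) x)) / S x / b = (\<Sum>a<N. w a x * partial_deriv j (h a) x)"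
      using b by (simp add: sum_divide_distrib w_def)
    finally show ?thesis unfolding soft_max_def S_def .
  qed
  have conth: "continuous_on G (h i)" if "i < N" for i using Ck_on_continuous[OF h[OF that]] .
  have contS: "continuous_on G S"
    unfolding S_def by (intro continuous_intros conth) auto
  have C: "C1_on n G (\<lambda>x. soft_max N b (\<lambda>i. h i x)) (\<lambda>j x. \<Sum>a<N. w a x * partial_deriv j (h a) x)"
    unfolding C1_on_def
  proof (intro conjI allI impI ballI der)
    show "continuous_on G (\<lambda>x. soft_max N b (\<lambda>i. h i x))"
      unfolding soft_max_def S_def[symmetric]
      by (intro continuous_intros contS) (use S0 N b in \<open>auto simp: less_imp_neq[symmetric]\<close>)
    show "continuous_on G (\<lambda>x. \<Sum>a<N. w a x * partial_deriv j (h a) x)" if "j < n" for j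
    proof (intro continuous_on_sum continuous_on_mult)
      fix a assume "a \<in> {..<N}"
      then have a: "a < N" by simp
      show "continuous_on G (partial_deriv j (h a))"
        using C1_onD(2)[OF h[OF a, unfolded Ck_on_1_iff] that] .
      show "continuous_on G (w a)"
        unfolding w_def by (intro continuous_intros contS conth a) (use S0 in \<open>auto simp: less_imp_neq[symmetric]\<close>)
    qed
  qed auto
  show "Ck_on n 1 G (\<lambda>x. soft_max N b (\<lambda>i. h i x))" by (rule C1_on_imp_Ck_on[OF C])
  assume x: "x \<in> G" and le: "\<And>i. i < N \<Longrightarrow> grad_norm n (h i) x \<le> c"
  have c: "c \<ge> 0" using le[of 0] N grad_norm_nonneg[of n "h 0" x] by (simp add: order_trans)
  have "grad_norm n (\<lambda>x. soft_max N b (\<lambda>i. h i x)) x \<le> (\<Sum>a<N. \<bar>w a x\<bar>) * c"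
    unfolding C1_on_grad_norm[OF C x]
    by (rule L2_set_weighted_le) (use le in \<open>auto simp: grad_norm_def\<close>)
  also have "(\<Sum>a<N. \<bar>w a x\<bar>) \<le> (\<Sum>a<N. cosh (b * h a x) / S x)"
    using S0[of x] abs_sinh_le_cosh by (intro sum_mono) (simp add: w_def divide_right_mono)
  also have "\<dots> = 1" using S0[of x] by (simp add: sum_divide_distrib[symmetric] S_def[symmetric])
  finally show "grad_norm n (\<lambda>x. soft_max N b (\<lambda>i. h i x)) x \<le> c" using c by (simp add: mult_right_mono)
qed

text \<open>Soft maxima of the first m + 1 functions with sharpness m + 1, truncated at scale m + 1:
  the loss ln(2 (m+1)) / (m+1) tends to 0. Nothing is claimed about monotonicity in m, so Fatou's
  lemma is the tool later on.\<close>

lemma C1_approx_SUP: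
  assumes h: "\<And>i::nat. Ck_on n 1 G (h i)" and bdd: "\<And>x. x \<in> G \<Longrightarrow> bdd_above (range (\<lambda>i. \<bar>h i x\<bar>))"
    and \<Gamma>: "\<And>i x. x \<in> G \<Longrightarrow> grad_norm n (h i) x \<le> \<Gamma> x"
  obtains g :: "nat \<Rightarrow> (nat \<Rightarrow> real) \<Rightarrow> real" where "\<And>m. Ck_on n 1 G (g m)" "\<And>m x. x \<in> G \<Longrightarrow> 0 \<le> g m x"
    "\<And>m x. x \<in> G \<Longrightarrow> g m x \<le> (SUP i. \<bar>h i x\<bar>)" "\<And>m x. \<bar>g m x\<bar> \<le> 2 * real (Suc m)"
    "\<And>m x. x \<in> G \<Longrightarrow> grad_norm n (g m) x \<le> \<Gamma> x"
    "\<And>x. x \<in> G \<Longrightarrow> (\<lambda>m. g m x) \<longlonglongrightarrow> (SUP i. \<bar>h i x\<bar>)"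
proof -
  define S where "S m x = soft_max (Suc m) (real (Suc m)) (\<lambda>i. h i x)" for m x
  define O' where "O' x = (SUP i. \<bar>h i x\<bar>)" for x
  have hO: "\<bar>h i x\<bar> \<le> O' x" if "x \<in> G" for i x
    unfolding O'_def by (rule cSUP_upper[OF UNIV_I bdd[OF that]])
  have SC: "Ck_on n 1 G (S m)" and Sgrad: "x \<in> G \<Longrightarrow> grad_norm n (S m) x \<le> \<Gamma> x" for m x
    unfolding S_def[abs_def]
    by (rule soft_max_C1(1)[OF h]; simp) (rule soft_max_C1(2)[OF h _ _ _ \<Gamma>]; simp)
  have S: "0 \<le> S m x" "S m x \<le> O' x" "i < Suc m \<Longrightarrow> \<bar>h i x\<bar> - ln (2 * real (Suc m)) / real (Suc m) \<le> S m x"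
    if "x \<in> G" for m x i
    unfolding S_def
    by (rule soft_max_bounds[where c="O' x"]; use hO[OF that] in simp)+
  define g where "g m x = trunc (real (Suc m)) (S m x)" for m x
  have g0: "0 \<le> g m x" if "x \<in> G" for m x
    using S(1)[OF that, of m] by (simp add: g_def trunc_def)
  have gO: "g m x \<le> O' x" if "x \<in> G" for m x
    using abs_trunc_le[of "real (Suc m)" "S m x"] S(1,2)[OF that, of m] unfolding g_def by linarith
  show thesis
  proof (rule that[of g])
    show "Ck_on n 1 G (g m)" for m unfolding g_def by (rule C1_on_trunc(1)[OF SC]) simp
    show "0 \<le> g m x" if "x \<in> G" for m x using g0[OF that] .
    show "g m x \<le> (SUP i. \<bar>h i x\<bar>)" if "x \<in> G" for m x using gO[OF that] by (simp add: O'_def)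
    show "\<bar>g m x\<bar> \<le> 2 * real (Suc m)" for m x unfolding g_def by (rule abs_trunc_le_const) simp
    show "grad_norm n (g m) x \<le> \<Gamma> x" if "x \<in> G" for m x
      unfolding g_def by (rule order_trans[OF C1_on_trunc(2)[OF SC _ that] Sgrad[OF that]]) simp
    show "(\<lambda>m. g m x) \<longlonglongrightarrow> (SUP i. \<bar>h i x\<bar>)" if x: "x \<in> G" for x
      unfolding O'_def[symmetric]
    proof (rule order_tendstoI)
      fix a assume a: "a < O' x"
      \<comment> \<open>An intermediate level: some single |h_i| exceeds c, and truncating the fixed
        number c eventually leaves it above a.\<close>
      define c where "c = (a + O' x) / 2"
      have c: "a < c" "c < O' x" using a by (auto simp: c_def)
      then obtain i where i: "c < \<bar>h i x\<bar>"
        unfolding O'_def using less_cSUP_iff[OF _ bdd[OF x]] by auto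
      have lim0: "(\<lambda>m. ln (2 * real (Suc m)) / real (Suc m)) \<longlonglongrightarrow> 0" by real_asymp
      have "\<forall>\<^sub>F m in sequentially. ln (2 * real (Suc m)) / real (Suc m) < \<bar>h i x\<bar> - c"
        using order_tendstoD(2)[OF lim0] i by simp
      moreover have "\<forall>\<^sub>F m in sequentially. a < trunc (real (Suc m)) c"
        using order_tendstoD(1)[OF trunc_tendsto c(1)] .
      moreover have "\<forall>\<^sub>F m in sequentially. m \<ge> i" by (rule eventually_ge_at_top)
      ultimately show "\<forall>\<^sub>F m in sequentially. a < g m x"
      proof eventually_elim
        case (elim m)
        have "c \<le> S m x" using S(3)[OF x, of i m] elim by simp
        then have "trunc (real (Suc m)) c \<le> g m x" unfolding g_def by (intro trunc_mono) auto
        then show ?case using elim by simp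
      qed
    next
      fix a assume "O' x < a"
      then show "\<forall>\<^sub>F m in sequentially. g m x < a" using gO[OF x] by (auto intro: always_eventually le_less_trans)
    qed
  qed
qed

section \<open>Moment bounds\<close>

lemma deriv_HS_square: "(deriv_HS n k f x)\<^sup>2 = (\<Sum>is\<in>multi_indices n k. (iter_partial_deriv is f x)\<^sup>2)"
  by (simp add: deriv_HS_def L2_set_def sum_nonneg)

lemma deriv_HS_Suc_square:
  "(deriv_HS n (Suc k) f x)\<^sup>2 = (\<Sum>is\<in>multi_indices n k. (grad_norm n (iter_partial_deriv is f) x)\<^sup>2)"
  unfolding deriv_HS_square sum_multi_indices_Suc
  by (subst sum.swap) (simp add: grad_norm_def L2_set_def sum_nonneg iter_partial_deriv_Cons)

lemma deriv_form_C1: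
  assumes f: "Ck_on n d G f" and k: "k < d"
  shows "C1_on n G (\<lambda>x. deriv_form n k f x v)
    (\<lambda>i x. \<Sum>is\<in>multi_indices n k. iter_partial_deriv (i # is) f x * (\<Prod>j<k. v j (is ! j)))"
proof -
  have "C1_on n G (\<lambda>x. (\<Prod>j<k. v j (is ! j)) * iter_partial_deriv is f x)
      (\<lambda>i x. (\<Prod>j<k. v j (is ! j)) * iter_partial_deriv (i # is) f x)" if "is \<in> multi_indices n k" for "is"
  proof -
    have "Ck_on n 1 G (iter_partial_deriv is f)"
      using Ck_on_1_mono[OF Ck_on_iter_partial_deriv[OF f, of "is"]] that k by (auto simp: multi_indices_def)
    then show ?thesis
      unfolding iter_partial_deriv_Cons by (intro C1_on_cmult) (simp only: Ck_on_1_iff)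
  qed
  from C1_on_sum[of "multi_indices n k", OF this] show ?thesis
    unfolding deriv_form_def by (simp add: mult.commute)
qed

text \<open>Paired with w, the gradient of the k-form at fixed vectors is the (k+1)-form with w put
  in front. This bounds gradients by the supremum one order higher.\<close>

lemma deriv_form_Cons:
  "deriv_form n (Suc k) f x (\<lambda>j. (w # vs) ! j) =
    (\<Sum>i<n. w i * (\<Sum>is\<in>multi_indices n k. iter_partial_deriv (i # is) f x * (\<Prod>j<k. (vs ! j) (is ! j))))"
  unfolding deriv_form_def sum_multi_indices_Suc prod.lessThan_Suc_shift
  by (simp add: sum_distrib_left mult_ac)

section \<open>From moments to the exponential integral\<close>

lemma exp_ge_power_div_fact: "x \<ge> 0 \<Longrightarrow> x ^ j / fact j \<le> exp (x::real)"
proof -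
  assume x: "x \<ge> 0"
  have "(\<Sum>i\<in>{j}. x ^ i /\<^sub>R fact i) \<le> (\<Sum>i. x ^ i /\<^sub>R fact i)"
    by (rule sum_le_suminf[OF summable_exp_generic]) (use x in auto)
  then show ?thesis by (simp add: exp_def divide_inverse mult.commute)
qed

text \<open>For Y = |f|^(2/d) the hypothesis is E Y^(d 2^r) \<le> t^(d 2^r) with t = 4 * 2^r s. For
  an integer j \<ge> 1 some 2^r lies in [j, 2 j], and interpolation down to exponent j gives (8 j
  s)^j. The constant 1/48 = 1/(8 * 6) turns the j-th term of the series into (j/6)^j / j!, at most
  2^(-j), and these bounds sum to 2.\<close>

lemma (in prob_space) exp_moment_bound:
  fixes d :: nat
  assumes f: "f \<in> borel_measurable M" and s: "s > 0" and d: "d \<ge> 1"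
    and mom: "\<And>r. (\<integral>\<^sup>+ x. ennreal (\<bar>f x\<bar> ^ (2 * 2 ^ r)) \<partial>M) \<le> ennreal (((4 * 2 ^ r * s) ^ d) ^ 2 ^ r)"
  shows "(\<integral>\<^sup>+ x. ennreal (exp (1 / 48 / s * \<bar>f x\<bar> powr (2 / real d))) \<partial>M) \<le> 2"
proof -
  note [measurable] = f
  define Y where "Y x = \<bar>f x\<bar> powr (2 / real d)" for x
  have [measurable]: "Y \<in> borel_measurable M" unfolding Y_def[abs_def] by measurable
  have Y0: "Y x \<ge> 0" for x by (simp add: Y_def)
  have Ymom: "(\<integral>\<^sup>+ x. ennreal (Y x ^ j) \<partial>M) \<le> ennreal ((8 * real j * s) ^ j)" if j: "j \<ge> 1" for j
  proof -
    obtain r where r: "j \<le> 2 ^ r" "2 ^ r \<le> 2 * j"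
    proof -
      \<comment> \<open>Minimality of r is what bounds 2^r by 2 j.\<close>
      define r where "r = (LEAST r. j \<le> 2 ^ r)"
      have ex: "j \<le> 2 ^ j" by (rule less_imp_le[OF less_exp])
      have 1: "j \<le> 2 ^ r" unfolding r_def by (rule LeastI[of "\<lambda>r. j \<le> 2 ^ r", OF ex])
      have "2 ^ r \<le> 2 * j"
      proof (cases r)
        case 0 then show ?thesis using j by simp
      next
        case (Suc r')
        then have "\<not> j \<le> 2 ^ r'" using not_less_Least[of r' "\<lambda>r. j \<le> 2 ^ r"] unfolding r_def by simp
        then show ?thesis using Suc by simp
      qed
      with 1 show thesis using that by blast
    qed
    define t where "t = 4 * 2 ^ r * s"
    define T where "T = (t ^ d) ^ 2 ^ r"
    have t: "t > 0" using s by (simp add: t_def)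
    then have T: "T > 0" by (simp add: T_def)
    \<comment> \<open>Chosen so that Y^j = (|f|^p)^\<theta> and t^j = T^\<theta>.\<close>
    define \<theta> where "\<theta> = real j / (real d * 2 ^ r)"
    have "real j \<le> real d * 2 ^ r"
    proof -
      have "real j \<le> 1 * 2 ^ r" using r(1) of_nat_le_iff[of j "2 ^ r", where 'a=real] by simp
      also have "\<dots> \<le> real d * 2 ^ r" using d by (intro mult_right_mono) auto
      finally show ?thesis .
    qed
    then have \<theta>: "0 \<le> \<theta>" "\<theta> \<le> 1" using d by (auto simp: \<theta>_def field_simps)
    define p :: nat where "p = 2 * 2 ^ r"
    have pt: "Y x ^ j \<le> t ^ j * (1 - \<theta>) + t ^ j * \<theta> / T * \<bar>f x\<bar> ^ p" for x
    proof (cases "f x = 0")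
      case True
      then show ?thesis using j t T \<theta> by (simp add: Y_def p_def power_0_left)
    next
      case False
      define y where "y = \<bar>f x\<bar>"
      have y: "y > 0" using False by (simp add: y_def)
      \<comment> \<open>The concave power U^\<theta> lies below its tangent \<theta> U + 1 -
        \<theta> at 1, which takes the place of Jensen's inequality.\<close>
      define U where "U = y ^ p / T"
      have U: "U > 0" using y T by (simp add: U_def)
      have lnU: "ln U = real p * ln y - 2 ^ r * (real d * ln t)"
        using y T t by (simp add: U_def T_def ln_div ln_realpow)
      have "\<theta> * ln U = 2 / real d * real j * ln y - real j * ln t"
        unfolding lnU using d by (simp add: \<theta>_def p_def field_simps)
      then have "U powr \<theta> = y powr (2 / real d * real j) / t ^ j"
        using U y t by (simp add: powr_def exp_diff ln_realpow[symmetric])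
      moreover have "y powr (2 / real d * real j) = Y x ^ j"
        using y powr_powr[of y "2 / real d" "real j"] powr_realpow[of "y powr (2 / real d)" j]
        by (simp add: Y_def y_def[symmetric])
      moreover have "U powr \<theta> * 1 powr (1 - \<theta>) \<le> \<theta> * U + (1 - \<theta>) * 1"
        by (rule Youngs_inequality_0) (use \<theta> U in auto)
      ultimately have "Y x ^ j / t ^ j \<le> \<theta> * U + (1 - \<theta>)" by simp
      then have "Y x ^ j \<le> (\<theta> * U + (1 - \<theta>)) * t ^ j" using t by (simp add: pos_divide_le_eq)
      also have "\<dots> = t ^ j * (1 - \<theta>) + t ^ j * \<theta> / T * y ^ p" by (simp add: U_def algebra_simps)
      finally show ?thesis by (simp add: y_def)
    qed
    have "(\<integral>\<^sup>+ x. ennreal (Y x ^ j) \<partial>M) \<le> (\<integral>\<^sup>+ x. ennreal (t ^ j * (1 - \<theta>)) + ennreal (t ^ j * \<theta> / T) * ennreal (\<bar>f x\<bar> ^ p) \<partial>M)"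
    proof (rule nn_integral_mono)
      fix x
      have "ennreal (t ^ j * (1 - \<theta>)) + ennreal (t ^ j * \<theta> / T) * ennreal (\<bar>f x\<bar> ^ p) =
          ennreal (t ^ j * (1 - \<theta>) + t ^ j * \<theta> / T * \<bar>f x\<bar> ^ p)"
        using t T \<theta> by (subst ennreal_mult[symmetric]; simp?)
      then show "ennreal (Y x ^ j) \<le> ennreal (t ^ j * (1 - \<theta>)) + ennreal (t ^ j * \<theta> / T) * ennreal (\<bar>f x\<bar> ^ p)"
        using pt by (simp add: ennreal_leI)
    qed
    also have "\<dots> = ennreal (t ^ j * (1 - \<theta>)) + ennreal (t ^ j * \<theta> / T) * (\<integral>\<^sup>+ x. ennreal (\<bar>f x\<bar> ^ p) \<partial>M)"
      by (simp add: nn_integral_add nn_integral_cmult emeasure_space_1)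
    also have "\<dots> \<le> ennreal (t ^ j * (1 - \<theta>)) + ennreal (t ^ j * \<theta> / T) * ennreal T"
      using mom[of r] by (intro add_mono mult_left_mono) (auto simp: T_def t_def p_def)
    also have "\<dots> = ennreal (t ^ j * (1 - \<theta>) + t ^ j * \<theta> / T * T)"
      using t T \<theta> by (subst ennreal_mult[symmetric]; simp?)
    also have "t ^ j * (1 - \<theta>) + t ^ j * \<theta> / T * T = t ^ j"
      using T by (simp add: algebra_simps)
    also have "ennreal (t ^ j) \<le> ennreal ((8 * real j * s) ^ j)"
    proof (intro ennreal_leI power_mono)
      have "real (2 ^ r) \<le> real (2 * j)" using r(2) by (rule of_nat_mono)
      then have "2 ^ r \<le> 2 * real j" by simp
      then show "t \<le> 8 * real j * s" using s by (simp add: t_def)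
    qed (use t in simp)
    finally show ?thesis .
  qed
  define a where "a j x = (1 / 48 / s * Y x) ^ j / fact j" for j x
  have a0: "a j x \<ge> 0" for j x using Y0[of x] s by (simp add: a_def)
  have [measurable]: "a j \<in> borel_measurable M" for j unfolding a_def[abs_def] by measurable
  have series: "ennreal (exp (1 / 48 / s * Y x)) = (\<Sum>j. ennreal (a j x))" for x
  proof -
    have "c ^ j /\<^sub>R fact j = c ^ j / fact j" for c :: real and j
      by (simp add: divide_inverse mult.commute)
    then have "(\<lambda>j. a j x) sums exp (1 / 48 / s * Y x)"
      using exp_converges[of "1 / 48 / s * Y x"] by (simp only: a_def)
    note sums = this
    show ?thesis
      unfolding sums_unique[OF sums] by (rule suminf_ennreal2[OF a0 sums_summable[OF sums], symmetric])
  qed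
  have term_le: "(\<integral>\<^sup>+ x. ennreal (a j x) \<partial>M) \<le> ennreal ((1/2) ^ j)" for j
  proof (cases "j = 0")
    case True
    then show ?thesis by (simp add: a_def emeasure_space_1)
  next
    case False
    define c where "c = (1 / 48 / s) ^ j / fact j"
    have c: "c \<ge> 0" using s by (simp add: c_def)
    have "(\<integral>\<^sup>+ x. ennreal (a j x) \<partial>M) = (\<integral>\<^sup>+ x. ennreal c * ennreal (Y x ^ j) \<partial>M)"
    proof (rule nn_integral_cong)
      fix x
      have "a j x = c * Y x ^ j" by (simp add: a_def c_def power_mult_distrib power_divide)
      then show "ennreal (a j x) = ennreal c * ennreal (Y x ^ j)" using c Y0[of x] by (simp add: ennreal_mult)
    qed
    also have "\<dots> = ennreal c * (\<integral>\<^sup>+ x. ennreal (Y x ^ j) \<partial>M)" by (simp add: nn_integral_cmult)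
    also have "\<dots> \<le> ennreal c * ennreal ((8 * real j * s) ^ j)" using Ymom False by (intro mult_left_mono) auto
    also have "\<dots> = ennreal (c * (8 * real j * s) ^ j)" using c s by (simp add: ennreal_mult)
    also have "\<dots> \<le> ennreal ((1/2) ^ j)"
    proof (rule ennreal_leI)
      have "c * (8 * real j * s) ^ j = (1 / 48 / s * (8 * real j * s)) ^ j / fact j"
        unfolding c_def power_mult_distrib[of "1 / 48 / s"] by (rule times_divide_eq_left)
      also have "1 / 48 / s * (8 * real j * s) = real j / 6" using s by simp
      also have "(real j / 6) ^ j / fact j = (1/6) ^ j * (real j ^ j / fact j)"
        by (simp add: power_divide)
      \<comment> \<open>The quotient j^j / j! is one term of the series of exp j; then e \<le> 3
        leaves the ratio 3/6.\<close>
      also have "\<dots> \<le> (1/6) ^ j * exp (real j)"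
        by (intro mult_left_mono exp_ge_power_div_fact) auto
      also have "exp (real j) = exp 1 ^ j" using exp_of_nat_mult[of j "1::real"] by simp
      also have "\<dots> \<le> 3 ^ j" by (intro power_mono exp_le) auto
      also have "(1/6) ^ j * 3 ^ j = (1/2::real) ^ j" by (simp add: power_mult_distrib[symmetric])
      finally show "c * (8 * real j * s) ^ j \<le> (1/2) ^ j" by simp
    qed
    finally show ?thesis .
  qed
  have "(\<integral>\<^sup>+ x. ennreal (exp (1 / 48 / s * Y x)) \<partial>M) = (\<Sum>j. \<integral>\<^sup>+ x. ennreal (a j x) \<partial>M)"
    unfolding series by (rule nn_integral_suminf) measurable
  also have "\<dots> \<le> (\<Sum>j. ennreal ((1/2) ^ j))" by (intro suminf_le term_le summableI)
  also have "\<dots> = ennreal 2"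
  proof -
    have sums: "(\<lambda>j. (1/2::real) ^ j) sums 2" using geometric_sums[of "1/2::real"] by simp
    have "(\<Sum>j. ennreal ((1/2) ^ j)) = ennreal (\<Sum>j. (1/2) ^ j)"
      by (rule suminf_ennreal2[OF _ sums_summable[OF sums]]) simp
    then show ?thesis by (simp only: sums_unique[OF sums, symmetric])
  qed
  finally show ?thesis by (simp add: Y_def)
qed

section \<open>Moments of the derivatives of f\<close>

context log_Sobolev_space
begin

lemma poincare_ennreal:
  assumes g: "Ck_on n 1 G g" "has_bochner_integral M g 0"
  shows "(\<integral>\<^sup>+ x. ennreal ((g x)\<^sup>2) \<partial>M) \<le> ennreal (2 * s) * (\<integral>\<^sup>+ x. ennreal ((grad_norm n g x)\<^sup>2) \<partial>M)"
proof (cases "(\<integral>\<^sup>+ x. ennreal ((grad_norm n g x)\<^sup>2) \<partial>M)")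
  case (real W)
  then have "(\<integral>\<^sup>+ x. ennreal ((g x)\<^sup>2) \<partial>M) \<le> ennreal (2 * s * W)" by (intro poincare[OF g]) auto
  then show ?thesis using real s_pos by (simp add: ennreal_mult)
next
  case top
  then show ?thesis using s_pos by (simp add: ennreal_mult_top)
qed

text \<open>The supremum is neither known to be C^1 nor to be bounded, so the doubling step with q =
  2 p is applied to C^1 approximants from below, and Fatou's lemma passes to the limit.\<close>

lemma sup_moment_step:
  assumes h: "\<And>i::nat. Ck_on n 1 G (h i)" and bdd: "\<And>x. x \<in> G \<Longrightarrow> bdd_above (range (\<lambda>i. \<bar>h i x\<bar>))"
    and \<Gamma>: "\<Gamma> \<in> borel_measurable M" "\<And>i x. x \<in> G \<Longrightarrow> grad_norm n (h i) x \<le> \<Gamma> x"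
    and p: "p \<ge> 1" and A: "A > 0" "(\<integral>\<^sup>+ x. ennreal ((SUP i. \<bar>h i x\<bar>) ^ (2 * p)) \<partial>M) \<le> ennreal (A ^ p)"
    and B: "B > 0" "(\<integral>\<^sup>+ x. ennreal (\<Gamma> x ^ (2 * (2 * p))) \<partial>M) \<le> ennreal (B ^ (2 * p))"
  shows "(\<integral>\<^sup>+ x. ennreal ((SUP i. \<bar>h i x\<bar>) ^ (2 * (2 * p))) \<partial>M) \<le> ennreal ((A + 2 * s * real (2 * p) * B) ^ (2 * p))"
proof -
  obtain g :: "nat \<Rightarrow> (nat \<Rightarrow> real) \<Rightarrow> real" where g: "\<And>m. Ck_on n 1 G (g m)" "\<And>m x. x \<in> G \<Longrightarrow> 0 \<le> g m x"
    "\<And>m x. x \<in> G \<Longrightarrow> g m x \<le> (SUP i. \<bar>h i x\<bar>)" "\<And>m x. \<bar>g m x\<bar> \<le> 2 * real (Suc m)"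
    "\<And>m x. x \<in> G \<Longrightarrow> grad_norm n (g m) x \<le> \<Gamma> x"
    "\<And>x. x \<in> G \<Longrightarrow> (\<lambda>m. g m x) \<longlonglongrightarrow> (SUP i. \<bar>h i x\<bar>)"
    using C1_approx_SUP[of n G h \<Gamma>, OF h bdd \<Gamma>(2)] by blast
  define C where "C = (A + 2 * s * real (2 * p) * B) ^ (2 * p)"
  have gm [measurable]: "g m \<in> borel_measurable M" for m
    by (rule continuous_on_measurable[OF Ck_on_continuous[OF g(1)]])
  have int: "integrable M (\<lambda>x. g m x ^ k)" for m k
    by (rule integrable_const_bound[where B="(2 * real (Suc m)) ^ k"])
      (use power_mono[OF g(4)[of m], of _ k] in \<open>auto simp: power_abs\<close>)
  have bound: "(\<integral>\<^sup>+ x. ennreal (g m x ^ (2 * (2 * p))) \<partial>M) \<le> ennreal C" for m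
  proof -
    have "ennreal (expectation (\<lambda>x. \<bar>g m x\<bar> ^ (2 * p))) = (\<integral>\<^sup>+ x. ennreal (g m x ^ (2 * p)) \<partial>M)"
      using int[of m "2 * p"] by (subst nn_integral_eq_integral) (auto simp: power_mult power_even_abs)
    also have "\<dots> \<le> (\<integral>\<^sup>+ x. ennreal ((SUP i. \<bar>h i x\<bar>) ^ (2 * p)) \<partial>M)"
      by (rule nn_integral_mono) (use g(2,3) space_M in \<open>auto intro!: ennreal_leI power_mono\<close>)
    also note A(2)
    finally have "expectation (\<lambda>x. \<bar>g m x\<bar> ^ (2 * p)) \<le> A ^ p" using A(1) by simp
    then have "(expectation (\<lambda>x. \<bar>g m x\<bar> ^ (2 * p)))\<^sup>2 \<le> (A ^ p)\<^sup>2"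
      by (rule power_mono) simp
    then have "expectation (\<lambda>x. g m x ^ (2 * (2 * p))) \<le> C"
      unfolding C_def using p A(1) B g(4,5)
      by (intro moment_step[OF g(1) _ \<Gamma>(1), where K="2 * real (Suc m)"])
        (auto simp: power_mult[symmetric] mult.commute)
    then show ?thesis
      using int[of m "2 * (2 * p)"] by (subst nn_integral_eq_integral) (auto simp: power_mult intro: ennreal_leI)
  qed
  have "(\<integral>\<^sup>+ x. ennreal ((SUP i. \<bar>h i x\<bar>) ^ (2 * (2 * p))) \<partial>M) =
      (\<integral>\<^sup>+ x. liminf (\<lambda>m. ennreal (g m x ^ (2 * (2 * p)))) \<partial>M)"
  proof (rule nn_integral_cong)
    fix x assume "x \<in> space M"
    then have "(\<lambda>m. ennreal (g m x ^ (2 * (2 * p)))) \<longlonglongrightarrow> ennreal ((SUP i. \<bar>h i x\<bar>) ^ (2 * (2 * p)))"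
      by (intro tendsto_ennrealI tendsto_power g(6)) (simp add: space_M)
    from lim_imp_Liminf[OF sequentially_bot this]
    show "ennreal ((SUP i. \<bar>h i x\<bar>) ^ (2 * (2 * p))) = liminf (\<lambda>m. ennreal (g m x ^ (2 * (2 * p))))" by simp
  qed
  also have "\<dots> \<le> liminf (\<lambda>m. \<integral>\<^sup>+ x. ennreal (g m x ^ (2 * (2 * p))) \<partial>M)"
    by (rule nn_integral_liminf) measurable
  also have "\<dots> \<le> liminf (\<lambda>m. ennreal C)"
    by (rule Liminf_mono, rule always_eventually, rule allI, rule bound)
  finally show ?thesis by (simp add: C_def Liminf_const)
qed

text \<open>The Poincare inequality is applied entry by entry: the squared gradients of the entries
  of order k sum to the squared Hilbert-Schmidt norm of order k + 1. This is where every order below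
  d must be centred.\<close>

lemma deriv_HS_bound:
  assumes f: "Ck_on n d G f" "has_bochner_integral M f 0"
    and mean: "\<And>k is. 1 \<le> k \<Longrightarrow> k \<le> d - 1 \<Longrightarrow> is \<in> multi_indices n k \<Longrightarrow> has_bochner_integral M (iter_partial_deriv is f) 0"
    and HS: "(\<integral>\<^sup>+ x. ennreal ((deriv_HS n d f x)\<^sup>2) \<partial>M) \<le> 1"
    and "k \<le> d"
  shows "(\<integral>\<^sup>+ x. ennreal ((deriv_HS n k f x)\<^sup>2) \<partial>M) \<le> ennreal ((2 * s) ^ (d - k))"
  using \<open>k \<le> d\<close>
proof (induction k rule: inc_induct)
  case base
  then show ?case using HS by simp
next
  case (step k)
  have C1: "Ck_on n 1 G (iter_partial_deriv is f)" if "is \<in> multi_indices n k" for "is"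
    using Ck_on_1_mono[OF Ck_on_iter_partial_deriv[OF f(1), of "is"]] that step.hyps by (auto simp: multi_indices_def)
  have m0: "has_bochner_integral M (iter_partial_deriv is f) 0" if "is \<in> multi_indices n k" for "is"
    using mean[of k "is"] that f(2) step.hyps by (cases "k = 0") auto
  have meas [measurable]: "iter_partial_deriv is f \<in> borel_measurable M" if "is \<in> multi_indices n k" for "is"
    by (rule continuous_on_measurable[OF Ck_on_continuous[OF C1[OF that]]])
  have [measurable]: "grad_norm n (iter_partial_deriv is f) \<in> borel_measurable M" if "is \<in> multi_indices n k" for "is"
    by (rule grad_norm_measurable[OF C1[OF that]])
  have "(\<integral>\<^sup>+ x. ennreal ((deriv_HS n k f x)\<^sup>2) \<partial>M) =
      (\<Sum>is\<in>multi_indices n k. \<integral>\<^sup>+ x. ennreal ((iter_partial_deriv is f x)\<^sup>2) \<partial>M)"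
    unfolding deriv_HS_square by (subst nn_integral_sum[symmetric]) (auto simp: sum_ennreal)
  also have "\<dots> \<le> (\<Sum>is\<in>multi_indices n k. ennreal (2 * s) * (\<integral>\<^sup>+ x. ennreal ((grad_norm n (iter_partial_deriv is f) x)\<^sup>2) \<partial>M))"
    by (intro sum_mono poincare_ennreal C1 m0)
  also have "\<dots> = ennreal (2 * s) * (\<integral>\<^sup>+ x. ennreal ((deriv_HS n (Suc k) f x)\<^sup>2) \<partial>M)"
    unfolding deriv_HS_Suc_square sum_distrib_left[symmetric]
    by (subst nn_integral_sum[symmetric]) (auto simp: sum_ennreal)
  also have "\<dots> \<le> ennreal (2 * s) * ennreal ((2 * s) ^ (d - Suc k))"
    using step.IH by (rule mult_left_mono) simp
  also have "\<dots> = ennreal ((2 * s) ^ (d - k))"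
  proof -
    have "d - k = Suc (d - Suc k)" using step.hyps by simp
    then show ?thesis using s_pos by (simp add: ennreal_mult[symmetric])
  qed
  finally show ?case .
qed

lemma moment_bound:
  assumes n: "n \<ge> 1" and d: "d \<ge> 1" and f: "Ck_on n d G f" "has_bochner_integral M f 0"
    and mean: "\<And>k is. 1 \<le> k \<Longrightarrow> k \<le> d - 1 \<Longrightarrow> is \<in> multi_indices n k \<Longrightarrow> has_bochner_integral M (iter_partial_deriv is f) 0"
    and HS: "(\<integral>\<^sup>+ x. ennreal ((deriv_HS n d f x)\<^sup>2) \<partial>M) \<le> 1"
    and Op: "AE x in M. deriv_Op n d f x \<le> 1"
  shows "(\<integral>\<^sup>+ x. ennreal (\<bar>f x\<bar> ^ (2 * 2 ^ r)) \<partial>M) \<le> ennreal (((4 * 2 ^ r * s) ^ d) ^ 2 ^ r)"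
proof -
  obtain W where W: "countable W" "W \<subseteq> unit_vectors n" "\<And>C. closed C \<Longrightarrow> W \<subseteq> C \<Longrightarrow> unit_vectors n \<subseteq> C"
    using countable_dense_subset by blast
  have "W \<noteq> {}"
  proof
    assume "W = {}"
    then have "unit_vectors n = {}" using W(3)[of "{}"] by auto
    then show False using first_basis_vector_unit[OF n] by blast
  qed
  \<comment> \<open>Tuples of vectors are lists over W, so that prefixing a vector raises the order
    by one.\<close>
  define V where "V k = {vs \<in> lists W. length vs = k}" for k
  have "countable (V k)" for k
    unfolding V_def by (rule countable_subset[OF _ countable_lists[OF W(1)]]) auto
  moreover have "V k \<noteq> {}" for k
  proof -
    obtain w where "w \<in> W" using \<open>W \<noteq> {}\<close> by blast
    then have "replicate k w \<in> V k" by (auto simp: V_def)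
    then show ?thesis by blast
  qed
  ultimately have range: "range (from_nat_into (V k)) = V k" for k by (intro range_from_nat_into)
  define h where "h k j x = deriv_form n k f x (\<lambda>l. from_nat_into (V k) j ! l)" for k j x
  \<comment> \<open>A countable surrogate for the operator norm of order k: measurable for k \<le>
    d, at most \<open>deriv_HS\<close>, and for k = d at most \<open>deriv_Op\<close>.\<close>
  define O' where "O' k x = (SUP j. \<bar>h k j x\<bar>)" for k x
  have eV: "from_nat_into (V k) j \<in> V k" for k j using range by blast
  have unit: "from_nat_into (V k) j ! l \<in> unit_vectors n" if "l < k" for k j l
  proof -
    have "set (from_nat_into (V k) j) \<subseteq> W" "l < length (from_nat_into (V k) j)"
      using eV[of k j] that by (auto simp: V_def lists_eq_set)
    then show ?thesis using W(2) nth_mem by blast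
  qed
  have hHS: "\<bar>h k j x\<bar> \<le> deriv_HS n k f x" for k j x
    unfolding h_def by (rule abs_deriv_form_le_HS) (use unit in \<open>auto simp: unit_vectors_def\<close>)
  have bdd: "bdd_above (range (\<lambda>j. \<bar>h k j x\<bar>))" for k x
    by (rule bdd_aboveI[of _ "deriv_HS n k f x"]) (use hHS in auto)
  have hO: "\<bar>h k j x\<bar> \<le> O' k x" for k j x unfolding O'_def by (rule cSUP_upper[OF UNIV_I bdd])
  have O0: "0 \<le> O' k x" for k x using hO[of k 0 x] by linarith
  have OHS: "O' k x \<le> deriv_HS n k f x" for k x unfolding O'_def by (rule cSUP_least) (use hHS in auto)
  have formO: "\<bar>deriv_form n k f x (\<lambda>l. vs ! l)\<bar> \<le> O' k x" if "vs \<in> V k" for vs k x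
  proof -
    have "vs \<in> range (from_nat_into (V k))" using that by (simp only: range)
    then obtain j where "vs = from_nat_into (V k) j" by (rule rangeE)
    then show ?thesis using hO[of k j x] by (simp add: h_def)
  qed
  have hcont: "continuous_on G (h k j)" if "k \<le> d" for k j
    unfolding h_def deriv_form_def
    by (intro continuous_intros Ck_on_continuous[OF Ck_on_iter_partial_deriv[OF f(1)]])
      (use that in \<open>auto simp: multi_indices_def\<close>)
  have Om: "O' k \<in> borel_measurable M" if "k \<le> d" for k
    unfolding O'_def[abs_def]
    by (rule borel_measurable_cSUP) (use bdd hcont[OF that] in \<open>auto intro!: continuous_on_measurable continuous_on_rabs\<close>)
  have hC: "Ck_on n 1 G (h k j)" if "k < d" for k j
    unfolding h_def by (rule C1_on_imp_Ck_on[OF deriv_form_C1[OF f(1) that]])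
  have grad: "grad_norm n (h k j) x \<le> O' (Suc k) x" if k: "k < d" and x: "x \<in> G" for k j x
  proof -
    let ?vs = "from_nat_into (V k) j"
    have "grad_norm n (h k j) x = L2_set (\<lambda>i. \<Sum>is\<in>multi_indices n k. iter_partial_deriv (i # is) f x * (\<Prod>l<k. (?vs ! l) (is ! l))) {..<n}"
      unfolding h_def by (rule C1_on_grad_norm[OF deriv_form_C1[OF f(1) k] x])
    also have "\<dots> \<le> O' (Suc k) x"
    proof (rule L2_set_le_if_unit_dense[OF n W(3)])
      fix w assume "w \<in> W"
      then have "w # ?vs \<in> V (Suc k)" using eV[of k j] by (auto simp: V_def)
      from formO[OF this, of x, unfolded deriv_form_Cons]
      show "(\<Sum>i<n. w i * (\<Sum>is\<in>multi_indices n k. iter_partial_deriv (i # is) f x * (\<Prod>l<k. (?vs ! l) (is ! l)))) \<le> O' (Suc k) x"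
        by linarith
    qed
    finally show ?thesis .
  qed
  have Od: "AE x in M. O' d x \<le> 1"
    using Op
  proof eventually_elim
    case (elim x)
    have "O' d x \<le> deriv_Op n d f x"
      unfolding O'_def h_def by (rule cSUP_least) (auto intro!: abs_deriv_form_le_Op unit d)
    then show ?case using elim by simp
  qed
  have claim: "(\<integral>\<^sup>+ x. ennreal (O' k x ^ (2 * 2 ^ r)) \<partial>M) \<le> ennreal (((4 * 2 ^ r * s) ^ (d - k)) ^ 2 ^ r)"
    if "k \<le> d" for k r
    using that
  \<comment> \<open>The order k descends from d. At each order an inner induction doubles the
    exponent 2 * 2^r, using order k + 1 at the already doubled exponent.\<close>
  proof (induction k arbitrary: r rule: inc_induct)
    case base
    have "(\<integral>\<^sup>+ x. ennreal (O' d x ^ (2 * 2 ^ r)) \<partial>M) \<le> (\<integral>\<^sup>+ x. 1 \<partial>M)"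
    proof (rule nn_integral_mono_AE)
      show "AE x in M. ennreal (O' d x ^ (2 * 2 ^ r)) \<le> 1"
        using Od by eventually_elim (simp add: power_le_one O0)
    qed
    then show ?case by (simp add: emeasure_space_1)
  next
    case (step k)
    have e: "d - k = Suc (d - Suc k)" using step.hyps by simp
    show ?case
    proof (induction r)
      case 0
      have "(\<integral>\<^sup>+ x. ennreal ((O' k x)\<^sup>2) \<partial>M) \<le> (\<integral>\<^sup>+ x. ennreal ((deriv_HS n k f x)\<^sup>2) \<partial>M)"
        by (intro nn_integral_mono ennreal_leI power_mono OHS O0)
      also have "\<dots> \<le> ennreal ((2 * s) ^ (d - k))"
        by (rule deriv_HS_bound[OF f mean HS]) (use step.hyps in auto)
      also have "\<dots> \<le> ennreal ((4 * s) ^ (d - k))"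
        using s_pos by (intro ennreal_leI power_mono) auto
      finally show ?case by simp
    next
      case (Suc r)
      \<comment> \<open>This is 2 p s for the new exponent p = 2 * 2^(r+1). The recursion becomes
        (X/2)^m + (X/2) X^(m-1) \<le> X^m with m = d - k \<ge> 1: the two terms are at most half of
        X^m each, which is where the factor 4 comes from.\<close>
      define X where "X = 4 * 2 ^ Suc r * s"
      have X: "X > 0" using s_pos by (simp add: X_def)
      have IH: "(\<integral>\<^sup>+ x. ennreal (O' k x ^ (2 * 2 ^ r)) \<partial>M) \<le> ennreal (((X / 2) ^ (d - k)) ^ 2 ^ r)"
      proof -
        have "X / 2 = 4 * 2 ^ r * s" by (simp add: X_def)
        then show ?thesis using Suc.IH by (simp only:)
      qed
      have IH': "(\<integral>\<^sup>+ x. ennreal (O' (Suc k) x ^ (2 * (2 * 2 ^ r))) \<partial>M) \<le> ennreal ((X ^ (d - Suc k)) ^ (2 * 2 ^ r))"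
        using step.IH[of "Suc r"] by (simp add: X_def)
      have "(\<integral>\<^sup>+ x. ennreal (O' k x ^ (2 * (2 * 2 ^ r))) \<partial>M) \<le>
          ennreal (((X / 2) ^ (d - k) + 2 * s * real (2 * 2 ^ r) * X ^ (d - Suc k)) ^ (2 * 2 ^ r))"
        unfolding O'_def
      proof (rule sup_moment_step[where \<Gamma>="O' (Suc k)"])
        show "Ck_on n 1 G (h k i)" for i using hC step.hyps by simp
        show "grad_norm n (h k i) x \<le> O' (Suc k) x" if "x \<in> G" for i x using grad step.hyps that by simp
        show "O' (Suc k) \<in> borel_measurable M" using Om step.hyps by simp
      qed (use IH IH' X bdd in \<open>simp_all add: O'_def\<close>)
      also have "\<dots> \<le> ennreal ((X ^ (d - k)) ^ (2 * 2 ^ r))"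
      proof (intro ennreal_leI power_mono)
        have "(X / 2) ^ (d - k) \<le> X ^ (d - k) / 2"
        proof -
          have "(2::real) ^ 1 \<le> 2 ^ (d - k)" by (rule power_increasing) (use e in auto)
          then show ?thesis using X unfolding power_divide by (intro divide_left_mono) auto
        qed
        moreover have "2 * s * real (2 * 2 ^ r) * X ^ (d - Suc k) = X ^ (d - k) / 2"
          unfolding e by (simp add: X_def)
        ultimately show "(X / 2) ^ (d - k) + 2 * s * real (2 * 2 ^ r) * X ^ (d - Suc k) \<le> X ^ (d - k)" by simp
        show "0 \<le> (X / 2) ^ (d - k) + 2 * s * real (2 * 2 ^ r) * X ^ (d - Suc k)"
          using X s_pos by simp
      qed
      finally show ?case by (simp add: X_def)
    qed
  qed
  \<comment> \<open>The only 0-tuple is the empty one, so the supremum of order 0 is |f|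
    itself.\<close>
  have "V 0 = {[]}" by (auto simp: V_def)
  then have "O' 0 x = \<bar>f x\<bar>" for x by (simp add: O'_def h_def deriv_form_def)
  then show ?thesis using claim[of 0 r] by simp
qed

end

theorem theorem1p10:
  shows "\<exists>c::real. c > 0 \<and>
    (\<forall>(n::nat) (G :: (nat \<Rightarrow> real) set) (M :: (nat \<Rightarrow> real) measure) (\<sigma>::real) (d::nat)
       (f :: (nat \<Rightarrow> real) \<Rightarrow> real).
       openin (Euclidean_space n) G \<longrightarrow>
       prob_space M \<longrightarrow>
       sets M = sets (restrict_space borel G) \<longrightarrow>
       \<sigma>\<^sup>2 > 0 \<longrightarrow>
       log_Sobolev n G M (\<sigma>\<^sup>2) \<longrightarrow>
       d \<ge> 1 \<longrightarrow>
       Ck_on n d G f \<longrightarrow>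
       has_bochner_integral M f 0 \<longrightarrow>
       (\<forall>k\<in>{1..d - 1}. \<forall>is\<in>multi_indices n k.
          has_bochner_integral M (iter_partial_deriv is f) 0) \<longrightarrow>
       L2_norm M (deriv_HS n d f) \<le> 1 \<longrightarrow>
       Linf_norm M (deriv_Op n d f) \<le> 1 \<longrightarrow>
       (\<integral>\<^sup>+ x. ennreal (exp (c / \<sigma>\<^sup>2 * \<bar>f x\<bar> powr (2 / real d))) \<partial>M) \<le> 2)"
proof (intro exI[of _ "1/48"] conjI allI impI)
  fix n :: nat and G and M :: "(nat \<Rightarrow> real) measure" and \<sigma> :: real and d :: nat and f :: "(nat \<Rightarrow> real) \<Rightarrow> real"
  assume asm: "openin (Euclidean_space n) G" "prob_space M" "sets M = sets (restrict_space borel G)"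
    "\<sigma>\<^sup>2 > 0" "log_Sobolev n G M (\<sigma>\<^sup>2)" "d \<ge> 1" "Ck_on n d G f" "has_bochner_integral M f 0"
    and mean: "\<forall>k\<in>{1..d - 1}. \<forall>is\<in>multi_indices n k. has_bochner_integral M (iter_partial_deriv is f) 0"
    and HS: "L2_norm M (deriv_HS n d f) \<le> 1" and Op: "Linf_norm M (deriv_Op n d f) \<le> 1"
  interpret prob_space M by fact
  interpret log_Sobolev_space M n G "\<sigma>\<^sup>2" by standard (use asm in auto)
  show "(\<integral>\<^sup>+ x. ennreal (exp (1 / 48 / \<sigma>\<^sup>2 * \<bar>f x\<bar> powr (2 / real d))) \<partial>M) \<le> 2"
  \<comment> \<open>In dimension 0 there are no unit vectors to test with; but G has at most one
    point, where a centred f vanishes.\<close>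
  proof (cases "n = 0")
    case True
    have "G \<subseteq> {\<lambda>_. 0}"
      using openin_subset[OF asm(1)] True by (auto simp: topspace_Euclidean_space)
    then have const: "f x = f (\<lambda>_. 0)" if "x \<in> space M" for x using that space_M by auto
    have "expectation f = expectation (\<lambda>_. f (\<lambda>_. 0))"
      by (rule Bochner_Integration.integral_cong) (use const in auto)
    then have "f (\<lambda>_. 0) = 0" using asm(8) by (simp add: has_bochner_integral_iff prob_space)
    then have "(\<integral>\<^sup>+ x. ennreal (exp (1 / 48 / \<sigma>\<^sup>2 * \<bar>f x\<bar> powr (2 / real d))) \<partial>M) = (\<integral>\<^sup>+ x. 1 \<partial>M)"
      by (intro nn_integral_cong) (use const in auto)
    then show ?thesis by (simp add: emeasure_space_1)
  next
    case False
    \<comment> \<open>\<open>L2_norm\<close> is infinite unless the square is integrable, so the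
      bound contains integrability.\<close>
    have "integrable M (\<lambda>x. (deriv_HS n d f x)\<^sup>2)" "sqrt (expectation (\<lambda>x. (deriv_HS n d f x)\<^sup>2)) \<le> 1"
      using HS by (auto simp: L2_norm_def split: if_splits)
    then have HS': "(\<integral>\<^sup>+ x. ennreal ((deriv_HS n d f x)\<^sup>2) \<partial>M) \<le> 1"
      by (subst nn_integral_eq_integral) auto
    have "AE x in M. ereal \<bar>deriv_Op n d f x\<bar> \<le> Linf_norm M (deriv_Op n d f)"
      unfolding Linf_norm_def by (rule esssup_AE)
    then have Op': "AE x in M. deriv_Op n d f x \<le> 1"
    proof eventually_elim
      case (elim x)
      then have "ereal \<bar>deriv_Op n d f x\<bar> \<le> 1" using Op by (rule order_trans)
      then show ?case by simp
    qed
    show ?thesis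
    proof (rule exp_moment_bound[OF _ asm(4,6)])
      show "f \<in> borel_measurable M" using asm(8) by (auto simp: has_bochner_integral_iff)
      show "(\<integral>\<^sup>+ x. ennreal (\<bar>f x\<bar> ^ (2 * 2 ^ r)) \<partial>M) \<le> ennreal (((4 * 2 ^ r * \<sigma>\<^sup>2) ^ d) ^ 2 ^ r)" for r
        by (rule moment_bound[OF _ asm(6,7,8) _ HS' Op']) (use False mean in auto)
    qed
  qed
qed simp

end
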